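(* Let $p$ be a prime, $q=p^f$ with $f\ge 1$, and let $U(q)$ be a Sylow $p$-subgroup of the finite Chevalley group $\mathrm{G}_2(q)$, presented by root elements $x_1(t),\dots,x_6(t)$ ($t\in\mathbb{F}_q$) as in the context. (1) Suppose $p=2$. Then the following characters are irreducible and have the stated degrees, characters with different labels are distinct, and together they are all of $\mathrm{Irr}(U(q))$: - $\chi_{b_2}^{a_6}$, $a_6\in\mathbb{F}_q^\times$, $b_2\in\mathbb{F}_q$: $q(q-1)$ characters of degree $q^2$; - $\chi_{b_1,b_3}^{a_5}$, $a_5\in\mathbb{F}_q^\times$, $b_1,b_3\in\mathbb{F}_q$: $q^2(q-1)$ characters of degree $q$; - $\chi^{a_3,0}$, $a_3\in\mathbb{F}_q^\times$: $q-1$ characters of degree $q$; - $\chi^{0,a_4}$, $a_4\in\mathbb{F}_q^\times$: $q-1$ characters of degree $q$; - $\chi_{d_1,d_2}^{a_3,a_4}$, $a_3,a_4\in\mathbb{F}_q^\times$, $d_1,d_2\in\mathbb{F}_2$: $4(q-1)^2$ characters of degree $q/2$; - $\chi_{b_1,b_2}$, $b_1,b_2\in\mathbb{F}_q$: $q^2$ characters of degree $1$. (2) Suppose $p=3$, and let $S$ be the set of nonzero squares of $\mathbb{F}_q$. Then the following characters are irreducible and have the stated degrees, characters with different labels are distinct, and together they are all of $\mathrm{Irr}(U(q))$: - $\chi^{a_4,a_6}$, $a_4,a_6\in\mathbb{F}_q^\times$: $(q-1)^2$ characters of degree $q^2$; - $\chi_{b_2,b_3}^{a_6}$, $a_6\in\mathbb{F}_q^\times$,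 $b_2,b_3\in\mathbb{F}_q$: $q^2(q-1)$ characters of degree $q$; - $\chi_{b_1,b_5}^{a_4}$, $a_4\in\mathbb{F}_q^\times$, $b_1,b_5\in\mathbb{F}_q$: $q^2(q-1)$ characters of degree $q$; - $\chi^{a_3',a_5}$, $a_5\in\mathbb{F}_q^\times$, $a_3'\in\mathbb{F}_q^\times\setminus(-a_5S)$: $(q-1)^2/2$ characters of degree $q$; - $\chi^{a_3,0}$, $a_3\in\mathbb{F}_q^\times$: $q-1$ characters of degree $q$; - $\chi^{0,a_5}$, $a_5\in\mathbb{F}_q^\times$: $q-1$ characters of degree $q$; - $\chi_{e_1,e_2}^{a_3^*,a_5}$, $a_5\in\mathbb{F}_q^\times$, $a_3^*\in -a_5S$, $e_1,e_2\in\mathbb{F}_3$: $9(q-1)^2/2$ characters of degree $q/3$; - $\chi_{b_1,b_2}$, $b_1,b_2\in\mathbb{F}_q$: $q^2$ characters of degree $1$. (3) In particular, $$|\mathrm{Irr}(U(q))|=\begin{cases} q^3+2q^2-q-1, & \text{if } p\ge 5,\\ 2q^3+5q^2-10q+4, & \text{if } p=3,\\ q^3+5q^2-7q+2, & \text{if } p=2.\end{cases}$$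
   Context: $\mathrm{Irr}(G)$ is the set of complex irreducible characters of a finite group $G$. The group $U(q)$ of type $\mathrm{G}_2$: every element is uniquely a product $x_1(t_1)x_2(t_2)\cdots x_6(t_6)$ with $t_i\in\mathbb{F}_q$; $x_i(s)x_i(t)=x_i(s+t)$; and with $[x,y]=x^{-1}y^{-1}xy$, $[x_1(s),x_2(t)]=x_3(-st)x_4(st^2)x_5(-st^3)x_6(-s^2t^3)$, $[x_2(s),x_3(t)]=x_4(2st)x_5(-3s^2t)x_6(3st^2)$, $[x_2(s),x_4(t)]=x_5(3st)$, $[x_1(s),x_5(t)]=x_6(st)$, $[x_3(s),x_4(t)]=x_6(-3st)$, and $[x_i(s),x_j(t)]=1$ for the remaining pairs $i<j$. (Here $\alpha_1$ is the long and $\alpha_2$ the short simple root.) Thus $|U(q)|=q^6$. Put $X_i=\{x_i(t):t\in\mathbb{F}_q\}$, and for $I\subseteq\{1,\dots,6\}$ let $X_I$ be the set of products $\prod_{i\in I}x_i(t_i)$ in increasing order of $i$; every $X_I$ used below is a subgroup in the characteristic considered. Let $\phi:\mathbb{F}_q\to\mathbb{C}^\times$, $\phi(t)=e^{2\pi i\,\mathrm{Tr}(t)/p}$, where $\mathrm{Tr}:\mathbb{F}_q\to\mathbb{F}_p$ is the field trace. Below, "the linear character $\prod_{i\in I}x_i(t_i)\mapsto\phi(\ldots)$ of $X_I$" means the linear character of $X_I$ given by this formula, and Ind is induction of characters to $U(q)$. Labels for $p=2$: - $\chi_{b_2}^{a_6}=\mathrm{Ind}$ of the linear character $\phi(b_2t_2+a_6t_6)$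 of $X_{\{2,4,5,6\}}$. - $\chi_{b_1,b_3}^{a_5}=\mathrm{Ind}$ of the linear character $\phi(b_1t_1+b_3t_3+a_5t_5)$ of $X_{\{1,3,4,5,6\}}$. - $\chi^{a_3,0}$ is the unique irreducible character of $U(q)$ with $X_4X_5X_6$ in its kernel and whose restriction to $X_3$ is a multiple of $x_3(t)\mapsto\phi(a_3t)$. - $\chi^{0,a_4}$ is the unique irreducible character of $U(q)$ with $X_3X_5X_6$ in its kernel and whose restriction to $X_4$ is a multiple of $x_4(t)\mapsto\phi(a_4t)$. - $\chi_{d_1,d_2}^{a_3,a_4}$: let $X'=\{1,x_1(a_4/a_3^2)\}$, $Y'=\{1,x_2(a_3/a_4)\}$, and let $\tilde Y$ be a fixed complement of $Y'$ in $X_2$. Then $\chi_{d_1,d_2}^{a_3,a_4}$ is induced from the linear character of $X'X_{\{2,3,4,5,6\}}$ which is trivial on $\tilde Y X_5X_6$, equals $\phi(a_3t_3+a_4t_4)$ on $x_3(t_3)x_4(t_4)$, and takes the values $(-1)^{d_1}$ at $x_1(a_4/a_3^2)$ and $(-1)^{d_2}$ at $x_2(a_3/a_4)$. - $\chi_{b_1,b_2}$ is the linear character $x_1(t_1)\cdots x_6(t_6)\mapsto\phi(b_1t_1+b_2t_2)$. Labels for $p=3$ (with $\zeta_3$ a fixed primitive cube root of unity): - $\chi^{a_4,a_6}=\mathrm{Ind}$ of the linear character $\phi(a_4t_4+a_6t_6)$ of $X_{\{3,4,5,6\}}$. - $\chi_{b_2,b_3}^{a_6}=\mathrm{Ind}$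 of the linear character $\phi(b_2t_2+b_3t_3+a_6t_6)$ of $X_{\{2,3,4,5,6\}}$. - $\chi_{b_1,b_5}^{a_4}=\mathrm{Ind}$ of the linear character $\phi(b_1t_1+a_4t_4+b_5t_5)$ of $X_{\{1,3,4,5,6\}}$. - $\chi^{a_3',a_5}$, $\chi^{a_3,0}$, $\chi^{0,a_5}$ are induced from the linear characters $\phi(a_3't_3+a_5t_5)$, $\phi(a_3t_3)$, $\phi(a_5t_5)$ of $X_{\{2,3,4,5,6\}}$, respectively. - $\chi_{e_1,e_2}^{a_3^*,a_5}$: let $\omega$ be a fixed square root of $-a_3^*/a_5$, $X'=\{1,x_1(\pm1/(a_3^*\omega))\}$, $Y'=\{1,x_2(\pm\omega)\}$, and let $\tilde Y$ be a fixed complement of $Y'$ in $X_2$. Then $\chi_{e_1,e_2}^{a_3^*,a_5}$ is induced from the linear character of $X'X_{\{2,3,4,5,6\}}$ which is trivial on $\tilde YX_4X_6$, equals $\phi(a_3^*t_3+a_5t_5)$ on $x_3(t_3)x_5(t_5)$, and takes the values $\zeta_3^{e_1}$ at $x_1(1/(a_3^*\omega))$ and $\zeta_3^{e_2}$ at $x_2(\omega)$. - $\chi_{b_1,b_2}$ is the linear character $x_1(t_1)\cdots x_6(t_6)\mapsto\phi(b_1t_1+b_2t_2)$. *)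

theory Defs
  imports
    "Jordan_Normal_Form.VS_Connect"
    "HOL-Library.Cardinality"
    "HOL-Algebra.Coset"
    "HOL-Computational_Algebra.Factorial_Ring"
begin

section \<open>Complex characters of finite groups\<close>

abbreviation GL :: "nat \<Rightarrow> complex mat monoid" where
  "GL n \<equiv> units_of (ring_mat TYPE(complex) n ())"

definition irreducible_rep :: "('g, 'b) monoid_scheme \<Rightarrow> nat \<Rightarrow> ('g \<Rightarrow> complex mat) \<Rightarrow> bool" where
  "irreducible_rep G n \<rho> \<longleftrightarrow>
     0 < n \<and> \<rho> \<in> hom G (GL n) \<and>
     (\<forall>W. VectorSpace.subspace class_ring W (module_vec TYPE(complex) n) \<and>
          (\<forall>g\<in>carrier G. \<forall>w\<in>W. \<rho> g *\<^sub>v w \<in> W) \<longrightarrow>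
          W = {0\<^sub>v n} \<or> W = carrier_vec n)"

definition mat_trace :: "complex mat \<Rightarrow> complex" where
  "mat_trace A = (\<Sum>i<dim_row A. A $$ (i, i))"

text \<open>Class functions are total functions on the ambient type. They are set to 0 outside the group
  (or subgroup) on which they live, so that equality of functions is equality of characters.\<close>

definition Irr :: "('g, 'b) monoid_scheme \<Rightarrow> ('g \<Rightarrow> complex) set" where
  "Irr G = {\<chi>. \<exists>n \<rho>. irreducible_rep G n \<rho> \<and>
                  \<chi> = (\<lambda>g. if g \<in> carrier G then mat_trace (\<rho> g) else 0)}"

definition linear_character ::
    "('g, 'b) monoid_scheme \<Rightarrow> 'g set \<Rightarrow> ('g \<Rightarrow> complex) \<Rightarrow> bool" where
  "linear_character G H \<mu> \<longleftrightarrow>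
     subgroup H G \<and> \<mu> \<in> hom (G\<lparr>carrier := H\<rparr>) (units_of class_ring) \<and> (\<forall>g. g \<notin> H \<longrightarrow> \<mu> g = 0)"

definition induced ::
    "('g, 'b) monoid_scheme \<Rightarrow> 'g set \<Rightarrow> ('g \<Rightarrow> complex) \<Rightarrow> 'g \<Rightarrow> complex" where
  "induced G H \<mu> g =
     (if g \<in> carrier G
      then (\<Sum>y\<in>carrier G.
              if inv\<^bsub>G\<^esub> y \<otimes>\<^bsub>G\<^esub> g \<otimes>\<^bsub>G\<^esub> y \<in> H then \<mu> (inv\<^bsub>G\<^esub> y \<otimes>\<^bsub>G\<^esub> g \<otimes>\<^bsub>G\<^esub> y) else 0) / of_nat (card H)
      else 0)"

definition character_kernel :: "('g, 'b) monoid_scheme \<Rightarrow> ('g \<Rightarrow> complex) \<Rightarrow> 'g set" where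
  "character_kernel G \<chi> = {g \<in> carrier G. \<chi> g = \<chi> \<one>\<^bsub>G\<^esub>}"

definition complement_in ::
    "('g, 'b) monoid_scheme \<Rightarrow> 'g set \<Rightarrow> 'g set \<Rightarrow> 'g set \<Rightarrow> bool" where
  "complement_in G K H A \<longleftrightarrow>
     subgroup K G \<and> K \<subseteq> A \<and> H \<inter> K = {\<one>\<^bsub>G\<^esub>} \<and> H <#>\<^bsub>G\<^esub> K = A"

text \<open>Each row \<open>(L, n, d)\<close> of a table asserts that the labels in \<open>L\<close> give \<open>n\<close> characters of
  degree \<open>d\<close>. Bijectivity of the labelling says that all labels give irreducible characters, that
  different labels (of the same or of different tab) give different characters, and that these are
  all the irreducible characters. Counts and degrees are real, as some are written as fractions.\<close>

definition Irr_table ::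
    "('g, 'b) monoid_scheme \<Rightarrow> ('l \<Rightarrow> 'g \<Rightarrow> complex) \<Rightarrow> ('l set \<times> real \<times> real) list \<Rightarrow> bool" where
  "Irr_table G \<chi> tab \<longleftrightarrow>
     bij_betw \<chi> (\<Union>(L, n, d)\<in>set tab. L) (Irr G) \<and>
     (\<forall>(L, n, d)\<in>set tab.
        real (card (\<chi> ` L)) = n \<and> (\<forall>l\<in>L. \<chi> l \<one>\<^bsub>G\<^esub> = complex_of_real d))"


section \<open>The additive character of a finite field\<close>

text \<open>The field has \<open>CHAR('a) ^ f\<close> elements, where \<open>f\<close> is the multiplicity below, so this is the sum
  of the Galois conjugates over the prime field.\<close>

definition field_trace :: "'a::{field,finite} \<Rightarrow> 'a" where
  "field_trace t = (\<Sum>i<multiplicity CHAR('a) CARD('a). t ^ (CHAR('a) ^ i))"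

definition \<phi> :: "'a::{field,finite} \<Rightarrow> complex" where
  "\<phi> t = exp (2 * of_real pi * \<i> *
              of_nat (THE n. n < CHAR('a) \<and> of_nat n = field_trace t) / of_nat CHAR('a))"

definition nonzero_squares :: "'a::field set" where
  "nonzero_squares = {s. s \<noteq> 0 \<and> (\<exists>u. s = u\<^sup>2)}"


section \<open>The group of type G2\<close>

definition commutator :: "('g, 'b) monoid_scheme \<Rightarrow> 'g \<Rightarrow> 'g \<Rightarrow> 'g" where
  "commutator G g h = inv\<^bsub>G\<^esub> g \<otimes>\<^bsub>G\<^esub> inv\<^bsub>G\<^esub> h \<otimes>\<^bsub>G\<^esub> g \<otimes>\<^bsub>G\<^esub> h"

text \<open>The product of the \<open>x i (t i)\<close>, \<open>i \<in> I\<close>, in increasing order of \<open>i\<close>.\<close>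

definition root_prod ::
    "('g, 'b) monoid_scheme \<Rightarrow> (nat \<Rightarrow> 'a \<Rightarrow> 'g) \<Rightarrow> nat set \<Rightarrow> (nat \<Rightarrow> 'a) \<Rightarrow> 'g" where
  "root_prod G x I t = foldr (\<lambda>i g. x i (t i) \<otimes>\<^bsub>G\<^esub> g) (sorted_list_of_set I) \<one>\<^bsub>G\<^esub>"

definition root_set ::
    "('g, 'b) monoid_scheme \<Rightarrow> (nat \<Rightarrow> 'a \<Rightarrow> 'g) \<Rightarrow> nat set \<Rightarrow> 'g set" where
  "root_set G x I = range (root_prod G x I)"

locale G2_unipotent = group G for G :: "('g, 'b) monoid_scheme" (structure) +
  fixes x :: "nat \<Rightarrow> 'a::{field,finite} \<Rightarrow> 'g"
  assumes x_closed: "i \<in> {1..6} \<Longrightarrow> x i t \<in> carrier G"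
    and unique_product:
      "bij_betw (root_prod G x {1..6}) ({1..6} \<rightarrow>\<^sub>E (UNIV :: 'a set)) (carrier G)"
    and x_add: "i \<in> {1..6} \<Longrightarrow> x i s \<otimes> x i t = x i (s + t)"
    and comm_1_2: "commutator G (x 1 s) (x 2 t) =
      x 3 (- (s * t)) \<otimes> x 4 (s * t\<^sup>2) \<otimes> x 5 (- (s * t ^ 3)) \<otimes> x 6 (- (s\<^sup>2 * t ^ 3))"
    and comm_2_3: "commutator G (x 2 s) (x 3 t) =
      x 4 (2 * s * t) \<otimes> x 5 (- 3 * s\<^sup>2 * t) \<otimes> x 6 (3 * s * t\<^sup>2)"
    and comm_2_4: "commutator G (x 2 s) (x 4 t) = x 5 (3 * s * t)"
    and comm_1_5: "commutator G (x 1 s) (x 5 t) = x 6 (s * t)"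
    and comm_3_4: "commutator G (x 3 s) (x 4 t) = x 6 (- 3 * s * t)"
    and comm_trivial: "\<lbrakk>1 \<le> i; i < j; j \<le> 6; (i, j) \<notin> {(1,2), (2,3), (2,4), (1,5), (3,4)}\<rbrakk>
      \<Longrightarrow> commutator G (x i s) (x j t) = \<one>"


text \<open>The relations are consistent over every finite field: collecting products with them gives the
  following multiplication on coordinate tuples.\<close>

type_synonym 'a tuple6 = "'a \<times> 'a \<times> 'a \<times> 'a \<times> 'a \<times> 'a"

definition G2_tuples :: "'a::comm_ring_1 tuple6 monoid" where
  "G2_tuples = \<lparr>carrier = UNIV,
     mult = (\<lambda>(a1,a2,a3,a4,a5,a6) (b1,b2,b3,b4,b5,b6).
       (a1 + b1,
        a2 + b2,
        a3 + b3 + a2*b1,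
        a4 + b4 - 2*a2*b1*b2 - a2^2*b1 - 2*a3*b2,
        a5 + b5 + 3*a2*b1*b2^2 + 3*a2^2*b1*b2 + a2^3*b1 + 3*a3*b2^2 - 3*a4*b2,
        a6 + b6 - 6*a2*a3*b1*b2 - 6*a2*b1*b2*b3 - 3*a2^2*a3*b1 - 3*a2^2*b1*b3 - 3*a2^2*b1^2*b2
          - 2*a2^3*b1^2 - 6*a3*b2*b3 - 3*a3^2*b2 + 3*a4*b3 - a5*b1)),
     one = (0,0,0,0,0,0)\<rparr>"

definition G2_tuple_root :: "nat \<Rightarrow> 'a::comm_ring_1 \<Rightarrow> 'a tuple6" where
  "G2_tuple_root i t =
     (if i = 1 then t else 0, if i = 2 then t else 0, if i = 3 then t else 0,
      if i = 4 then t else 0, if i = 5 then t else 0, if i = 6 then t else 0)"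

lemma G2_tuples_group: "group (G2_tuples :: 'a::comm_ring_1 tuple6 monoid)"
proof (rule groupI)
  fix g h k :: "'a tuple6"
  show "g \<otimes>\<^bsub>G2_tuples\<^esub> h \<otimes>\<^bsub>G2_tuples\<^esub> k = g \<otimes>\<^bsub>G2_tuples\<^esub> (h \<otimes>\<^bsub>G2_tuples\<^esub> k)"
    by (cases g; cases h; cases k)
       (simp only: G2_tuples_def monoid.simps prod.case prod.inject,
        intro conjI; simp add: algebra_simps power2_eq_square power3_eq_cube)
next
  fix g :: "'a tuple6"
  obtain a1 a2 a3 a4 a5 a6 where g: "g = (a1,a2,a3,a4,a5,a6)"
    by (cases g)
  have "(- a1, - a2, a1*a2 - a3, a1*a2^2 - 2*a2*a3 - a4, a1*a2^3 - 3*a2*a4 - 3*a2^2*a3 - a5,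
      2*a1^2*a2^3 - 3*a1*a2*a4 - 6*a1*a2^2*a3 - a1*a5 + 3*a2*a3^2 + 3*a3*a4 - a6)
      \<otimes>\<^bsub>G2_tuples\<^esub> g = \<one>\<^bsub>G2_tuples\<^esub>"
    unfolding g
    by (simp only: G2_tuples_def monoid.simps prod.case prod.inject,
        intro conjI; simp add: algebra_simps power2_eq_square power3_eq_cube)
  then show "\<exists>h\<in>carrier G2_tuples. h \<otimes>\<^bsub>G2_tuples\<^esub> g = \<one>\<^bsub>G2_tuples\<^esub>"
    by (rule bexI) (simp add: G2_tuples_def)
qed (auto simp: G2_tuples_def)

lemma root_prod_G2_tuples:
  "root_prod G2_tuples G2_tuple_root {1..6} t = (t 1, t 2, t 3, t 4, t 5, t (6::nat))"
proof -
  have "sorted_list_of_set {1..6::nat} = [1,2,3,4,5,6]"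
    by (simp add: sorted_list_of_set_unique eval_nat_numeral atLeastAtMostSuc_conv)
  then show ?thesis
    by (simp add: root_prod_def G2_tuples_def G2_tuple_root_def)
qed

lemma G2_tuples_commutator:
  assumes "g \<otimes>\<^bsub>G2_tuples\<^esub> h = h \<otimes>\<^bsub>G2_tuples\<^esub> g \<otimes>\<^bsub>G2_tuples\<^esub> c"
  shows "commutator G2_tuples g h = c"
proof -
  interpret group "G2_tuples :: 'a::comm_ring_1 tuple6 monoid" by (rule G2_tuples_group)
  have [simp]: "u \<in> carrier G2_tuples" for u :: "'a tuple6" by (simp add: G2_tuples_def)
  show ?thesis unfolding commutator_def using assms
    by (simp add: m_assoc inv_solve_left' inv_mult_group[symmetric])
qed

lemma G2_unipotent_G2_tuples:
  "G2_unipotent (G2_tuples :: 'a::{field,finite} tuple6 monoid) G2_tuple_root"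
proof -
  interpret group "G2_tuples :: 'a tuple6 monoid" by (rule G2_tuples_group)
  note defs = G2_tuples_def G2_tuple_root_def
  show ?thesis
  proof (unfold_locales, goal_cases)
    case 2
    have "bij_betw (\<lambda>t. (t 1, t 2, t 3, t 4, t 5, t (6::nat)))
        ({1..6} \<rightarrow>\<^sub>E (UNIV :: 'a set)) UNIV"
    proof (rule bij_betwI')
      fix s t :: "nat \<Rightarrow> 'a"
      assume st: "s \<in> {1..6} \<rightarrow>\<^sub>E UNIV" "t \<in> {1..6} \<rightarrow>\<^sub>E UNIV"
      have "{1..6::nat} = {1,2,3,4,5,6}" by auto
      then show "((s 1, s 2, s 3, s 4, s 5, s 6) = (t 1, t 2, t 3, t 4, t 5, t 6)) = (s = t)"
        using PiE_ext[OF st] by auto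
    next
      fix y :: "'a tuple6"
      obtain a1 a2 a3 a4 a5 a6 where y: "y = (a1,a2,a3,a4,a5,a6)" by (cases y)
      define t :: "nat \<Rightarrow> 'a" where "t = (\<lambda>i\<in>{1..6}. [a1,a2,a3,a4,a5,a6] ! (i - 1))"
      show "\<exists>t\<in>{1..6} \<rightarrow>\<^sub>E UNIV. y = (t 1, t 2, t 3, t 4, t 5, t (6::nat))"
        by (rule bexI[of _ t]) (auto simp: t_def y)
    qed auto
    moreover have "root_prod G2_tuples G2_tuple_root {1..6}
        = (\<lambda>t :: nat \<Rightarrow> 'a. (t 1, t 2, t 3, t 4, t 5, t 6))"
      by (rule ext) (rule root_prod_G2_tuples)
    moreover have "carrier (G2_tuples :: 'a tuple6 monoid) = UNIV"
      by (simp add: G2_tuples_def)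
    ultimately show ?case by (simp only:)
  next
    case (9 i j s t)
    then have "i \<in> {1,2,3,4,5,6}" "j \<in> {1,2,3,4,5,6}" by auto
    with 9 show ?case
      by (intro G2_tuples_commutator) (auto simp: defs)
  qed (((rule G2_tuples_commutator)?,
        auto simp: defs algebra_simps power2_eq_square power3_eq_cube)[1])+
qed


section \<open>Labelled characters\<close>

text \<open>Definite descriptions below are only meaningful if the character exists and is unique.\<close>

definition root_linear ::
    "('g, 'b) monoid_scheme \<Rightarrow> (nat \<Rightarrow> 'a::{field,finite} \<Rightarrow> 'g) \<Rightarrow> nat set
      \<Rightarrow> ((nat \<Rightarrow> 'a) \<Rightarrow> 'a) \<Rightarrow> 'g \<Rightarrow> complex" where
  "root_linear G x I \<psi> =
     (THE \<mu>. linear_character G (root_set G x I) \<mu> \<and> (\<forall>t. \<mu> (root_prod G x I t) = \<phi> (\<psi> t)))"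

definition root_ind ::
    "('g, 'b) monoid_scheme \<Rightarrow> (nat \<Rightarrow> 'a::{field,finite} \<Rightarrow> 'g) \<Rightarrow> nat set
      \<Rightarrow> ((nat \<Rightarrow> 'a) \<Rightarrow> 'a) \<Rightarrow> 'g \<Rightarrow> complex" where
  "root_ind G x I \<psi> = induced G (root_set G x I) (root_linear G x I \<psi>)"

text \<open>The irreducible character with \<open>N\<close> in its kernel that restricts to a multiple of
  \<open>x i t \<mapsto> \<phi> (a * t)\<close>.\<close>

definition irr_above ::
    "('g, 'b) monoid_scheme \<Rightarrow> (nat \<Rightarrow> 'a::{field,finite} \<Rightarrow> 'g) \<Rightarrow> 'g set \<Rightarrow> nat
      \<Rightarrow> 'a \<Rightarrow> 'g \<Rightarrow> complex" where
  "irr_above G x N i a =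
     (THE \<chi>. \<chi> \<in> Irr G \<and> N \<subseteq> character_kernel G \<chi> \<and>
             (\<exists>m::nat. \<forall>t. \<chi> (x i t) = of_nat m * \<phi> (a * t)))"

text \<open>Constructors name the superscripts of the characters; their arguments are the subscripts
  followed by the superscripts. Elements of the prime field in subscripts are represented by the
  naturals below \<open>p\<close>. In characteristic 2, \<open>Y a3 a4\<close> is the chosen complement of
  \<open>{\<one>, x 2 (a3 / a4)}\<close>.\<close>

datatype 'a label2 =
    Two_a6 'a 'a
  | Two_a5 'a 'a 'a
  | Two_a3 'a
  | Two_a4 'a
  | Two_a3_a4 nat nat 'a 'a
  | Two_lin 'a 'a

fun chi2 ::
    "('g, 'b) monoid_scheme \<Rightarrow> (nat \<Rightarrow> 'a::{field,finite} \<Rightarrow> 'g) \<Rightarrow> ('a \<Rightarrow> 'a \<Rightarrow> 'g set)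
      \<Rightarrow> 'a label2 \<Rightarrow> 'g \<Rightarrow> complex" where
  "chi2 G x Y (Two_a6 b2 a6) = root_ind G x {2,4,5,6} (\<lambda>t. b2 * t 2 + a6 * t 6)"
| "chi2 G x Y (Two_a5 b1 b3 a5) =
     root_ind G x {1,3,4,5,6} (\<lambda>t. b1 * t 1 + b3 * t 3 + a5 * t 5)"
| "chi2 G x Y (Two_a3 a3) = irr_above G x (root_set G x {4,5,6}) 3 a3"
| "chi2 G x Y (Two_a4 a4) = irr_above G x (root_set G x {3,5,6}) 4 a4"
| "chi2 G x Y (Two_a3_a4 d1 d2 a3 a4) =
     (let H = {\<one>\<^bsub>G\<^esub>, x 1 (a4 / a3\<^sup>2)} <#>\<^bsub>G\<^esub> root_set G x {2,3,4,5,6} in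
      induced G H
        (THE \<mu>. linear_character G H \<mu> \<and>
           (\<forall>g \<in> Y a3 a4 <#>\<^bsub>G\<^esub> root_set G x {5,6}. \<mu> g = 1) \<and>
           (\<forall>t3 t4. \<mu> (x 3 t3 \<otimes>\<^bsub>G\<^esub> x 4 t4) = \<phi> (a3 * t3 + a4 * t4)) \<and>
           \<mu> (x 1 (a4 / a3\<^sup>2)) = (-1) ^ d1 \<and>
           \<mu> (x 2 (a3 / a4)) = (-1) ^ d2))"
| "chi2 G x Y (Two_lin b1 b2) = root_linear G x {1..6} (\<lambda>t. b1 * t 1 + b2 * t 2)"

text \<open>In characteristic 3, \<open>\<zeta>\<close> is the chosen primitive cube root of unity, \<open>w a3 a5\<close> the chosen square
  root of \<open>- a3 / a5\<close>, and \<open>Y a3 a5\<close> the chosen complement of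
  \<open>{\<one>, x 2 (w a3 a5), x 2 (- w a3 a5)}\<close>. The starred label is \<open>Three_a3s_a5\<close>.\<close>

datatype 'a label3 =
    Three_a4_a6 'a 'a
  | Three_a6 'a 'a 'a
  | Three_a4 'a 'a 'a
  | Three_a3_a5 'a 'a
  | Three_a3 'a
  | Three_a5 'a
  | Three_a3s_a5 nat nat 'a 'a
  | Three_lin 'a 'a

fun chi3 ::
    "('g, 'b) monoid_scheme \<Rightarrow> (nat \<Rightarrow> 'a::{field,finite} \<Rightarrow> 'g) \<Rightarrow> complex \<Rightarrow> ('a \<Rightarrow> 'a \<Rightarrow> 'a)
      \<Rightarrow> ('a \<Rightarrow> 'a \<Rightarrow> 'g set) \<Rightarrow> 'a label3 \<Rightarrow> 'g \<Rightarrow> complex" where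
  "chi3 G x \<zeta> w Y (Three_a4_a6 a4 a6) = root_ind G x {3,4,5,6} (\<lambda>t. a4 * t 4 + a6 * t 6)"
| "chi3 G x \<zeta> w Y (Three_a6 b2 b3 a6) =
     root_ind G x {2,3,4,5,6} (\<lambda>t. b2 * t 2 + b3 * t 3 + a6 * t 6)"
| "chi3 G x \<zeta> w Y (Three_a4 b1 b5 a4) =
     root_ind G x {1,3,4,5,6} (\<lambda>t. b1 * t 1 + a4 * t 4 + b5 * t 5)"
| "chi3 G x \<zeta> w Y (Three_a3_a5 a3 a5) = root_ind G x {2,3,4,5,6} (\<lambda>t. a3 * t 3 + a5 * t 5)"
| "chi3 G x \<zeta> w Y (Three_a3 a3) = root_ind G x {2,3,4,5,6} (\<lambda>t. a3 * t 3)"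
| "chi3 G x \<zeta> w Y (Three_a5 a5) = root_ind G x {2,3,4,5,6} (\<lambda>t. a5 * t 5)"
| "chi3 G x \<zeta> w Y (Three_a3s_a5 e1 e2 a3 a5) =
     (let s = 1 / (a3 * w a3 a5);
          H = {\<one>\<^bsub>G\<^esub>, x 1 s, x 1 (- s)} <#>\<^bsub>G\<^esub> root_set G x {2,3,4,5,6} in
      induced G H
        (THE \<mu>. linear_character G H \<mu> \<and>
           (\<forall>g \<in> Y a3 a5 <#>\<^bsub>G\<^esub> root_set G x {4,6}. \<mu> g = 1) \<and>
           (\<forall>t3 t5. \<mu> (x 3 t3 \<otimes>\<^bsub>G\<^esub> x 5 t5) = \<phi> (a3 * t3 + a5 * t5)) \<and>
           \<mu> (x 1 s) = \<zeta> ^ e1 \<and>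
           \<mu> (x 2 (w a3 a5)) = \<zeta> ^ e2))"
| "chi3 G x \<zeta> w Y (Three_lin b1 b2) = root_linear G x {1..6} (\<lambda>t. b1 * t 1 + b2 * t 2)"

end

theory Submission
  imports Defs "HOL-Algebra.Multiplicative_Group" "HOL-Number_Theory.Residues"
begin

text \<open>The group is identified with a group law on six-tuples by collecting root elements. Every character
  in question is induced from a linear character of a subgroup given by conditions on the coordinates.
  Two such inductions are orthogonal unless some \<open>y\<close> makes the inducing linear characters agree on all
  pairs \<open>h\<close>, \<open>h'\<close> with \<open>h y = y h'\<close>, and an induction is irreducible if only the \<open>y\<close> in the inducing
  subgroup do so for the character itself. Solving \<open>h y = y h'\<close> in coordinates reads off the label
  from this compatibility, which settles irreducibility and distinctness at once. The squares of
  the degrees add up to \<open>q\<^sup>6\<close>, so nothing is missing.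

  The exceptional families come from the polynomials \<open>a\<^sub>3 s b - a\<^sub>4 s\<^sup>2 b\<close> for \<open>p = 2\<close> and
  \<open>a\<^sub>3 s b + a\<^sub>5 s\<^sup>3 b\<close> for \<open>p = 3\<close>: since \<open>\<phi>\<close> is invariant under the Frobenius map, \<open>\<phi>\<close> of
  such a polynomial in \<open>s\<close> is a linear character, and it is trivial for exactly two, respectively
  one or three, values of \<open>b\<close>.\<close>

section \<open>Representations and linear characters\<close>

text \<open>The exceptional families stem from a pairing of X_1 and X_2. Under a character of X_3
  X_4 X_5 that is trivial on X_6, moving x_2(s) past x_1(b) costs the factor \<phi>(a_3 s b - a_4
  s^2 b + a_5 s^3 b), with a_5 = 0 for p = 2 and a_4 = 0 for p = 3. All other mixed terms carry the
  structure constants 2 or 3 and disappear. X' and Y' are the two radicals of this pairing: a_3/a_4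
  and \<omega> are nonzero roots in s, while a_4/a_3^2 and 1/(a_3 \<omega>) arise in b after the
  p-th power of s has been traded for a p-th power of the coefficient. Both radicals have order p,
  so X' X_{2,3,4,5,6} has index q/p, and p^2 characters arise from the values on X' and Y'; the
  complement of Y' only fixes how the value on Y' continues to X_2. For p = 3 the radicals are
  trivial when -a_3/a_5 is not a square, and the degree is q again. Compatibility is phrased with h
  y = y h' instead of a conjugate, because products are short polynomials in the coordinates and
  inverses are not.\<close>

lemma (in group) sum_eq_zero_of_translate:
  fixes f :: "'a \<Rightarrow> complex"
  assumes "h \<in> carrier G" and "\<And>g. g \<in> carrier G \<Longrightarrow> f (g \<otimes> h) = c * f g" and "c \<noteq> 1"
  shows "sum f (carrier G) = 0"
proof -
  have "sum f (carrier G) = (\<Sum>g\<in>carrier G. f (g \<otimes> h))"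
    by (rule sum.reindex_bij_witness[of _ "\<lambda>g. g \<otimes> h" "\<lambda>g. g \<otimes> inv h"])
       (use assms(1) in \<open>auto simp: m_assoc\<close>)
  also have "\<dots> = c * sum f (carrier G)"
    by (simp add: assms(2) sum_distrib_left)
  finally show ?thesis using assms(3) by (simp add: algebra_simps)
qed

text \<open>The units of \<open>class_ring\<close> are the nonzero complex numbers, so a
  homomorphism into them is a multiplicative function without zeros on \<open>H\<close>. The value 0
  off \<open>H\<close> allows sums over \<open>H\<close> to be written over the whole group.\<close>

lemma linear_character_iff:
  "linear_character G H \<mu> \<longleftrightarrow> subgroup H G \<and> (\<forall>h\<in>H. \<mu> h \<noteq> 0) \<and>
     (\<forall>h\<in>H. \<forall>k\<in>H. \<mu> (h \<otimes>\<^bsub>G\<^esub> k) = \<mu> h * \<mu> k) \<and> (\<forall>g. g \<notin> H \<longrightarrow> \<mu> g = 0)"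
proof -
  have "Units (class_ring :: complex ring) = - {0}"
    by (auto simp: Units_def) (metis mult.commute right_inverse)
  then show ?thesis
    by (auto simp: linear_character_def hom_def units_of_def)
qed

lemma (in group) linear_character_one:
  assumes "linear_character G H \<mu>"
  shows "\<mu> \<one> = 1"
proof -
  have "\<one> \<in> H" using assms by (auto simp: linear_character_iff subgroup.one_closed)
  then have "\<mu> \<one> * \<mu> \<one> = \<mu> \<one>" "\<mu> \<one> \<noteq> 0"
    using assms unfolding linear_character_iff by (metis l_one one_closed)+
  then show ?thesis by simp
qed

lemma (in group) linear_character_inv:
  assumes "linear_character G H \<mu>" "h \<in> H"
  shows "\<mu> (inv h) = inverse (\<mu> h)"
proof -
  have H: "subgroup H G" using assms by (simp add: linear_character_iff)
  then have "h \<in> carrier G" "inv h \<in> H"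
    using assms(2) by (auto simp: subgroup.m_inv_closed dest: subgroup.mem_carrier)
  then have "\<mu> h * \<mu> (inv h) = 1"
    using assms linear_character_one[OF assms(1)] unfolding linear_character_iff
    by (metis r_inv)
  then show ?thesis by (rule inverse_unique[symmetric])
qed

text \<open>By finiteness the values on \<open>H\<close> are roots of unity, for which inverse and
  conjugate agree. Off \<open>H\<close> both sides are 0, so the formula holds on all of
  \<open>G\<close>.\<close>

lemma (in group) linear_character_cnj:
  assumes "finite (carrier G)" "linear_character G H \<mu>" "g \<in> carrier G"
  shows "\<mu> (inv g) = cnj (\<mu> g)"
proof (cases "g \<in> H")
  case True
  have H: "subgroup H G" using assms by (simp add: linear_character_iff)
  have pow: "\<mu> (g [^] n) = \<mu> g ^ n \<and> g [^] n \<in> H" for n :: nat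
  proof (induction n)
    case 0
    then show ?case using H linear_character_one[OF assms(2)] by (simp add: subgroup.one_closed)
  next
    case (Suc n)
    then show ?case using H True assms(2)
      by (simp add: linear_character_iff subgroup.m_closed)
  qed
  have "g [^] Coset.order G = \<one>" by (rule pow_order_eq_1[OF assms(3)])
  then have "\<mu> g ^ Coset.order G = 1" using pow[of "Coset.order G"] linear_character_one[OF assms(2)] by simp
  moreover have "Coset.order G > 0" using assms(1) by (simp add: order_gt_0_iff_finite)
  ultimately have "norm (\<mu> g) = 1"
    by (metis norm_one norm_power norm_ge_zero power_eq_1_iff not_less0)
  then have "\<mu> g * cnj (\<mu> g) = 1" by (simp add: complex_norm_square[symmetric])
  then show ?thesis using linear_character_inv[OF assms(2) True] inverse_unique by metis
next
  case False
  have H: "subgroup H G" using assms by (simp add: linear_character_iff)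
  have "inv g \<notin> H" using False subgroup.m_inv_closed[OF H, of "inv g"] assms(3) by auto
  then show ?thesis using False assms(2) by (simp add: linear_character_iff)
qed

lemma GL_carrier_iff:
  "A \<in> carrier (GL n) \<longleftrightarrow> A \<in> carrier_mat n n \<and> (\<exists>B\<in>carrier_mat n n. B * A = 1\<^sub>m n \<and> A * B = 1\<^sub>m n)"
  by (auto simp: units_of_def Units_def ring_mat_def)

lemma subspace_module_vec_iff:
  "VectorSpace.subspace class_ring W (module_vec TYPE(complex) n) \<longleftrightarrow>
     W \<subseteq> carrier_vec n \<and> 0\<^sub>v n \<in> W \<and> (\<forall>v\<in>W. \<forall>w\<in>W. v + w \<in> W) \<and> (\<forall>c. \<forall>v\<in>W. c \<cdot>\<^sub>v v \<in> W)"
  by (auto simp: VectorSpace.subspace_def submodule_def vec_vs vec_module module_vec_simps)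

text \<open>Multiplicativity together with \<rho>(1) = 1 already gives invertible matrices, with
  \<rho>(g^-1) as inverse. Spelling out \<open>GL\<close> and subspaces leaves only matrix
  identities to check.\<close>

lemma irreducible_rep_iff:
  assumes "group G"
  shows "irreducible_rep G n \<rho> \<longleftrightarrow> 0 < n \<and> (\<forall>g\<in>carrier G. \<rho> g \<in> carrier_mat n n) \<and>
     \<rho> \<one>\<^bsub>G\<^esub> = 1\<^sub>m n \<and> (\<forall>g\<in>carrier G. \<forall>h\<in>carrier G. \<rho> (g \<otimes>\<^bsub>G\<^esub> h) = \<rho> g * \<rho> h) \<and>
     (\<forall>W. W \<subseteq> carrier_vec n \<and> 0\<^sub>v n \<in> W \<and> (\<forall>v\<in>W. \<forall>w\<in>W. v + w \<in> W) \<and>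
          (\<forall>c. \<forall>v\<in>W. c \<cdot>\<^sub>v v \<in> W) \<and> (\<forall>g\<in>carrier G. \<forall>w\<in>W. \<rho> g *\<^sub>v w \<in> W) \<longrightarrow>
          W = {0\<^sub>v n} \<or> W = carrier_vec n)"
proof -
  interpret G: group G by fact
  have gl: "group (GL n)"
    by (rule monoid.units_group, rule ring.is_monoid, rule ring_mat)
  have "\<rho> \<in> hom G (GL n) \<longleftrightarrow> (\<forall>g\<in>carrier G. \<rho> g \<in> carrier_mat n n) \<and>
     \<rho> \<one>\<^bsub>G\<^esub> = 1\<^sub>m n \<and> (\<forall>g\<in>carrier G. \<forall>h\<in>carrier G. \<rho> (g \<otimes>\<^bsub>G\<^esub> h) = \<rho> g * \<rho> h)" (is "_ \<longleftrightarrow> ?R")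
  proof
    assume h: "\<rho> \<in> hom G (GL n)"
    then have "\<rho> \<one>\<^bsub>G\<^esub> = \<one>\<^bsub>GL n\<^esub>" using hom_one[OF h assms gl] by simp
    with h show ?R
      by (auto simp: hom_def Pi_iff GL_carrier_iff) (auto simp: units_of_def ring_mat_def)
  next
    assume r: ?R
    have "\<rho> g \<in> carrier (GL n)" if g: "g \<in> carrier G" for g
      unfolding GL_carrier_iff
      using r g G.l_inv[OF g] G.r_inv[OF g] G.inv_closed[OF g] by metis
    with r show "\<rho> \<in> hom G (GL n)"
      by (auto simp: hom_def units_of_def ring_mat_def)
  qed
  then show ?thesis
    by (simp add: irreducible_rep_def subspace_module_vec_iff)
qed

lemma mat_trace_mult_commute:
  assumes "A \<in> carrier_mat n m" "B \<in> carrier_mat m n"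
  shows "mat_trace (A * B) = mat_trace (B * A)"
proof -
  have "mat_trace (A * B) = (\<Sum>i<n. \<Sum>k<m. A $$ (i, k) * B $$ (k, i))"
    using assms by (auto simp: mat_trace_def scalar_prod_def atLeast0LessThan intro!: sum.cong)
  also have "\<dots> = (\<Sum>k<m. \<Sum>i<n. B $$ (k, i) * A $$ (i, k))"
    by (subst sum.swap) (simp add: mult.commute)
  also have "\<dots> = mat_trace (B * A)"
    using assms by (auto simp: mat_trace_def scalar_prod_def atLeast0LessThan intro!: sum.cong)
  finally show ?thesis .
qed

section \<open>Schur orthogonality\<close>

lemma mat_mult_unit_vec:
  fixes A :: "'a::semiring_1 mat"
  assumes "A \<in> carrier_mat n m" "j < m"
  shows "A *\<^sub>v unit_vec m j = col A j"
proof (rule eq_vecI)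
  fix i assume "i < dim_vec (col A j)"
  then have "i < n" using assms by simp
  moreover have "row A i \<bullet> unit_vec m j = row A i $ j"
    using assms by (intro scalar_prod_right_unit)
  ultimately show "(A *\<^sub>v unit_vec m j) $ i = col A j $ i" using assms by simp
qed (use assms in simp)

lemma mult_mat_zero_vec: "(A :: 'a::semiring_1 mat) \<in> carrier_mat n m \<Longrightarrow> A *\<^sub>v 0\<^sub>v m = 0\<^sub>v n"
  by (intro eq_vecI) auto

text \<open>Kernel and image of the intertwiner \<open>T\<close> are invariant subspaces. As
  \<open>T\<close> is nonzero, irreducibility of \<sigma> makes the kernel zero and irreducibility
  of \<rho> makes the image everything.\<close>

lemma schur_inverse:
  assumes G: "group G" and \<rho>: "irreducible_rep G n \<rho>" and \<sigma>: "irreducible_rep G m \<sigma>"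
    and T: "T \<in> carrier_mat n m" and TI: "\<And>g. g \<in> carrier G \<Longrightarrow> \<rho> g * T = T * \<sigma> g"
    and T0: "T \<noteq> 0\<^sub>m n m"
  obtains B where "B \<in> carrier_mat m n" "T * B = 1\<^sub>m n" "B * T = 1\<^sub>m m"
proof -
  note R = \<rho>[unfolded irreducible_rep_iff[OF G]] and S = \<sigma>[unfolded irreducible_rep_iff[OF G]]
  have Rc: "\<rho> g \<in> carrier_mat n n" and Sc: "\<sigma> g \<in> carrier_mat m m" if "g \<in> carrier G" for g
    using R S that by auto
  have TIv: "T *\<^sub>v (\<sigma> g *\<^sub>v v) = \<rho> g *\<^sub>v (T *\<^sub>v v)" if "g \<in> carrier G" "v \<in> carrier_vec m" for g v
    using assoc_mult_mat_vec[OF T Sc that(2)] assoc_mult_mat_vec[OF Rc T that(2)] TI that(1) by simp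
  obtain i j where ij: "i < n" "j < m" "T $$ (i, j) \<noteq> 0"
  proof (rule ccontr)
    assume "\<not> thesis"
    with that have "T = 0\<^sub>m n m" using T by (intro eq_matI) auto
    with T0 show False ..
  qed
  have Tu: "T *\<^sub>v unit_vec m j \<noteq> 0\<^sub>v n"
    using ij T by (auto simp: mat_mult_unit_vec dest!: arg_cong[where f = "\<lambda>v. v $ i"])
  define K where "K = {v \<in> carrier_vec m. T *\<^sub>v v = 0\<^sub>v n}"
  have Kcl: "K \<subseteq> carrier_vec m" "0\<^sub>v m \<in> K"
    "v \<in> K \<Longrightarrow> w \<in> K \<Longrightarrow> v + w \<in> K" "v \<in> K \<Longrightarrow> c \<cdot>\<^sub>v v \<in> K"
    "g \<in> carrier G \<Longrightarrow> v \<in> K \<Longrightarrow> \<sigma> g *\<^sub>v v \<in> K" for v w c g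
    using Sc[of g] mult_mat_zero_vec[OF T] mult_mat_zero_vec[OF Rc[of g]]
    by (auto simp: K_def mult_add_distrib_mat_vec[OF T] mult_mat_vec[OF T] TIv)
  have "K = {0\<^sub>v m} \<or> K = carrier_vec m"
    using S[THEN conjunct2, THEN conjunct2, THEN conjunct2, THEN conjunct2, rule_format, of K] Kcl by blast
  moreover have "K \<noteq> carrier_vec m"
    using Tu unit_vec_carrier[of m j] unfolding K_def by blast
  ultimately have K: "K = {0\<^sub>v m}" by blast
  define I where "I = (\<lambda>v. T *\<^sub>v v) ` carrier_vec m"
  have Icl: "I \<subseteq> carrier_vec n" "0\<^sub>v n \<in> I"
    "v \<in> I \<Longrightarrow> w \<in> I \<Longrightarrow> v + w \<in> I" "v \<in> I \<Longrightarrow> c \<cdot>\<^sub>v v \<in> I"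
    "g \<in> carrier G \<Longrightarrow> v \<in> I \<Longrightarrow> \<rho> g *\<^sub>v v \<in> I" for v w c g
  proof -
    show "I \<subseteq> carrier_vec n" using T by (auto simp: I_def)
    show "0\<^sub>v n \<in> I" unfolding I_def
      by (rule image_eqI[of _ _ "0\<^sub>v m"]) (use T in auto)
    show "v \<in> I \<Longrightarrow> w \<in> I \<Longrightarrow> v + w \<in> I"
      unfolding I_def by (auto simp: mult_add_distrib_mat_vec[OF T, symmetric])
    show "v \<in> I \<Longrightarrow> c \<cdot>\<^sub>v v \<in> I"
      unfolding I_def by (auto simp: mult_mat_vec[OF T, symmetric])
    show "g \<in> carrier G \<Longrightarrow> v \<in> I \<Longrightarrow> \<rho> g *\<^sub>v v \<in> I"
      unfolding I_def by (auto simp: TIv[symmetric] intro!: imageI mult_mat_vec_carrier[OF Sc])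
  qed
  have "I = {0\<^sub>v n} \<or> I = carrier_vec n"
    using R[THEN conjunct2, THEN conjunct2, THEN conjunct2, THEN conjunct2, rule_format, of I] Icl by blast
  moreover have "I \<noteq> {0\<^sub>v n}"
    using Tu unfolding I_def by auto
  ultimately have I: "I = carrier_vec n" by blast
  have "\<forall>k. \<exists>v. v \<in> carrier_vec m \<and> unit_vec n k = T *\<^sub>v v"
    using I unfolding I_def by (metis imageE unit_vec_carrier)
  then obtain b where b: "\<And>k. b k \<in> carrier_vec m" "\<And>k. T *\<^sub>v b k = unit_vec n k"
    by metis
  \<comment> \<open>The columns of \<open>B\<close> are preimages of the unit vectors, so
    \<open>B\<close> is a right inverse; injectivity of \<open>T\<close> makes it a left inverse as
    well.\<close>
  define B where "B = mat m n (\<lambda>(i, k). b k $ i)"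
  have Bc: "B \<in> carrier_mat m n" by (simp add: B_def)
  have Bcol: "col B k = b k" if "k < n" for k
    using that b(1)[of k] by (intro eq_vecI) (auto simp: B_def)
  have TB: "T * B = 1\<^sub>m n"
  proof (rule eq_matI)
    fix i k assume "i < dim_row (1\<^sub>m n)" "k < dim_col (1\<^sub>m n)"
    then have ik: "i < n" "k < n" by auto
    then have "(T * B) $$ (i, k) = (T *\<^sub>v b k) $ i"
      using T Bc by (simp add: Bcol)
    then show "(T * B) $$ (i, k) = 1\<^sub>m n $$ (i, k)" using ik by (simp add: b(2))
  qed (use T Bc in auto)
  have BT: "B * T = 1\<^sub>m m"
  proof (rule eq_matI)
    fix i k assume "i < dim_row (1\<^sub>m m)" "k < dim_col (1\<^sub>m m)"
    then have ik: "i < m" "k < m" by auto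
    have BTc: "B * T \<in> carrier_mat m m" using Bc T by simp
    let ?v = "(B * T) *\<^sub>v unit_vec m k - unit_vec m k"
    have "T *\<^sub>v ((B * T) *\<^sub>v unit_vec m k) = (T * (B * T)) *\<^sub>v unit_vec m k"
      using T BTc by simp
    also have "T * (B * T) = T" using assoc_mult_mat[OF T Bc T] TB T by simp
    finally have "T *\<^sub>v ?v = 0\<^sub>v n"
      using T BTc by (subst mult_minus_distrib_mat_vec[OF T]) auto
    then have "?v \<in> K" using BTc by (auto simp: K_def)
    then have "?v = 0\<^sub>v m" using K by simp
    then have "?v $ i = 0" using ik by simp
    then show "(B * T) $$ (i, k) = 1\<^sub>m m $$ (i, k)"
      using ik BTc index_col[of i "B * T" k] carrier_matD[OF BTc]
      by (simp add: mat_mult_unit_vec[OF BTc] del: index_mult_mat)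
  qed (use T Bc in auto)
  show thesis by (rule that[OF Bc TB BT])
qed

lemma mult_mat_index:
  assumes "A \<in> carrier_mat n m" "B \<in> carrier_mat m r" "i < n" "j < r"
  shows "(A * B) $$ (i, j) = (\<Sum>k<m. A $$ (i, k) * B $$ (k, j))"
  using assms by (simp add: scalar_prod_def atLeast0LessThan)

text \<open>Summing \<rho>(g) E_kl \<sigma>(g^-1) over the group, with E_kl a matrix unit, produces
  an intertwiner. A nonzero one would be invertible and would identify the two traces, so all these
  sums vanish; the product of the traces is made of their entries.\<close>

lemma (in group) Irr_orthogonal:
  assumes fin: "finite (carrier G)" and chi: "\<chi> \<in> Irr G" "\<psi> \<in> Irr G" "\<chi> \<noteq> \<psi>"
  shows "(\<Sum>g\<in>carrier G. \<chi> g * \<psi> (inv g)) = 0"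
proof -
  obtain n \<rho> where \<rho>: "irreducible_rep G n \<rho>"
      and \<chi>: "\<chi> = (\<lambda>g. if g \<in> carrier G then mat_trace (\<rho> g) else 0)"
    using chi(1) unfolding Irr_def by blast
  obtain m \<sigma> where \<sigma>: "irreducible_rep G m \<sigma>"
      and \<psi>: "\<psi> = (\<lambda>g. if g \<in> carrier G then mat_trace (\<sigma> g) else 0)"
    using chi(2) unfolding Irr_def by blast
  note R = \<rho>[unfolded irreducible_rep_iff[OF is_group]] and S = \<sigma>[unfolded irreducible_rep_iff[OF is_group]]
  have Rc: "\<rho> g \<in> carrier_mat n n" and Sc: "\<sigma> g \<in> carrier_mat m m" if "g \<in> carrier G" for g
    using R S that by auto
  have Rm: "\<rho> (g \<otimes> h) = \<rho> g * \<rho> h" and Sm: "\<sigma> (g \<otimes> h) = \<sigma> g * \<sigma> h"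
    if "g \<in> carrier G" "h \<in> carrier G" for g h
    using R S that by auto
  have coeff: "(\<Sum>g\<in>carrier G. \<rho> g $$ (i, k) * \<sigma> (inv g) $$ (l, j)) = 0"
    if "i < n" "k < n" "l < m" "j < m" for i j k l
  proof -
    note kl = that
    define T where "T = mat n m (\<lambda>(i, j). \<Sum>g\<in>carrier G. \<rho> g $$ (i, k) * \<sigma> (inv g) $$ (l, j))"
    have Tc: "T \<in> carrier_mat n m" by (simp add: T_def)
    have TI: "\<rho> h * T = T * \<sigma> h" if h: "h \<in> carrier G" for h
    proof (rule eq_matI)
      fix i j assume "i < dim_row (T * \<sigma> h)" "j < dim_col (T * \<sigma> h)"
      then have ij: "i < n" "j < m" using Tc Sc[OF h] by auto
      have "(\<rho> h * T) $$ (i, j) = (\<Sum>r<n. \<rho> h $$ (i, r) * T $$ (r, j))"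
        by (rule mult_mat_index[OF Rc[OF h] Tc ij])
      also have "\<dots> = (\<Sum>r<n. \<Sum>g\<in>carrier G. \<rho> h $$ (i, r) * \<rho> g $$ (r, k) * \<sigma> (inv g) $$ (l, j))"
        using ij by (simp add: T_def sum_distrib_left mult.assoc)
      also have "\<dots> = (\<Sum>g\<in>carrier G. \<rho> (h \<otimes> g) $$ (i, k) * \<sigma> (inv g) $$ (l, j))"
      proof (subst sum.swap, rule sum.cong[OF refl])
        fix g assume g: "g \<in> carrier G"
        show "(\<Sum>r<n. \<rho> h $$ (i, r) * \<rho> g $$ (r, k) * \<sigma> (inv g) $$ (l, j)) =
            \<rho> (h \<otimes> g) $$ (i, k) * \<sigma> (inv g) $$ (l, j)"
          unfolding Rm[OF h g] mult_mat_index[OF Rc[OF h] Rc[OF g] ij(1) kl(2)]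
          by (simp add: sum_distrib_right)
      qed
      also have "\<dots> = (\<Sum>g\<in>carrier G. \<rho> g $$ (i, k) * \<sigma> (inv g \<otimes> h) $$ (l, j))"
      proof (rule sum.reindex_bij_witness[of _ "\<lambda>g. inv h \<otimes> g" "\<lambda>g. h \<otimes> g"])
        fix g assume g: "g \<in> carrier G"
        show "\<rho> (h \<otimes> g) $$ (i, k) * \<sigma> (inv (h \<otimes> g) \<otimes> h) $$ (l, j) =
            \<rho> (h \<otimes> g) $$ (i, k) * \<sigma> (inv g) $$ (l, j)"
          using g h by (simp add: inv_mult_group m_assoc)
        show "inv h \<otimes> (h \<otimes> g) = g" "h \<otimes> (inv h \<otimes> g) = g"
          using g h by (simp_all add: m_assoc[symmetric])
      qed (use h in simp_all)
      also have "\<dots> = (\<Sum>g\<in>carrier G. \<Sum>r<m. \<rho> g $$ (i, k) * \<sigma> (inv g) $$ (l, r) * \<sigma> h $$ (r, j))"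
      proof (rule sum.cong[OF refl])
        fix g assume g: "g \<in> carrier G"
        show "\<rho> g $$ (i, k) * \<sigma> (inv g \<otimes> h) $$ (l, j) =
            (\<Sum>r<m. \<rho> g $$ (i, k) * \<sigma> (inv g) $$ (l, r) * \<sigma> h $$ (r, j))"
          unfolding Sm[OF inv_closed[OF g] h] mult_mat_index[OF Sc[OF inv_closed[OF g]] Sc[OF h] kl(3) ij(2)]
          by (simp add: sum_distrib_left mult.assoc)
      qed
      also have "\<dots> = (\<Sum>r<m. T $$ (i, r) * \<sigma> h $$ (r, j))"
        by (subst sum.swap) (use ij in \<open>simp add: T_def sum_distrib_right\<close>)
      also have "\<dots> = (T * \<sigma> h) $$ (i, j)"
        by (rule mult_mat_index[OF Tc Sc[OF h] ij, symmetric])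
      finally show "(\<rho> h * T) $$ (i, j) = (T * \<sigma> h) $$ (i, j)" .
    qed (use Tc Rc[OF h] Sc[OF h] in auto)
    have "T = 0\<^sub>m n m"
    proof (rule ccontr)
      assume "T \<noteq> 0\<^sub>m n m"
      from schur_inverse[OF is_group \<rho> \<sigma> Tc TI this]
      obtain B where B: "B \<in> carrier_mat m n" "T * B = 1\<^sub>m n" "B * T = 1\<^sub>m m" by blast
      have "mat_trace (\<sigma> g) = mat_trace (\<rho> g)" if g: "g \<in> carrier G" for g
      proof -
        have "mat_trace (\<sigma> g) = mat_trace (B * (T * \<sigma> g))"
          using assoc_mult_mat[OF B(1) Tc Sc[OF g]] B(3) Sc[OF g] by simp
        also have "\<dots> = mat_trace (T * \<sigma> g * B)"
          using Tc Sc[OF g] B(1) by (intro mat_trace_mult_commute) auto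
        also have "T * \<sigma> g * B = \<rho> g"
          using assoc_mult_mat[OF Rc[OF g] Tc B(1)] B(2) Rc[OF g] by (simp add: TI[OF g, symmetric])
        finally show ?thesis .
      qed
      then have "\<chi> = \<psi>" by (auto simp: \<chi> \<psi>)
      with chi(3) show False ..
    qed
    then have "T $$ (i, j) = 0" using that by simp
    then show ?thesis using that by (simp add: T_def)
  qed
  have "(\<Sum>g\<in>carrier G. \<chi> g * \<psi> (inv g)) =
      (\<Sum>g\<in>carrier G. \<Sum>i<n. \<Sum>l<m. \<rho> g $$ (i, i) * \<sigma> (inv g) $$ (l, l))"
    using carrier_matD(1)[OF Rc] carrier_matD(1)[OF Sc[OF inv_closed]]
    by (intro sum.cong) (auto simp: \<chi> \<psi> mat_trace_def sum_product)
  also have "\<dots> = (\<Sum>i<n. \<Sum>l<m. \<Sum>g\<in>carrier G. \<rho> g $$ (i, i) * \<sigma> (inv g) $$ (l, l))"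
    by (subst sum.swap, intro sum.cong refl, rule sum.swap)
  also have "\<dots> = 0" by (simp add: coeff)
  finally show ?thesis .
qed

section \<open>Induced linear characters\<close>

text \<open>For \<open>b\<close> in \<open>H\<close>, the product \<open>a \<otimes> b\<close> lies
  in \<open>H\<close> exactly when \<open>a\<close> does, so extension by 0 keeps this
  multiplicativity for arbitrary \<open>a\<close>.\<close>

lemma (in group) linear_character_mult_right:
  assumes "linear_character G H \<mu>" "a \<in> carrier G" "b \<in> H"
  shows "\<mu> (a \<otimes> b) = \<mu> a * \<mu> b"
proof (cases "a \<in> H")
  case True
  then show ?thesis using assms by (simp add: linear_character_iff)
next
  case False
  have H: "subgroup H G" using assms by (simp add: linear_character_iff)
  have b: "b \<in> carrier G" using subgroup.mem_carrier[OF H assms(3)] .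
  have "a = (a \<otimes> b) \<otimes> inv b" using assms(2) b by (simp add: m_assoc)
  then have "a \<otimes> b \<notin> H"
    using False subgroup.m_closed[OF H _ subgroup.m_inv_closed[OF H assms(3)]] by metis
  then show ?thesis using False assms by (simp add: linear_character_iff)
qed

text \<open>Representatives of the left cosets of \<open>H\<close>, numbered from 0 so that they can
  index rows and columns of matrices.\<close>

locale transversal = group G for G :: "('g, 'b) monoid_scheme" (structure) +
  fixes H :: "'g set" and n :: nat and r :: "nat \<Rightarrow> 'g"
  assumes subH: "subgroup H G"
    and r_closed: "i < n \<Longrightarrow> r i \<in> carrier G"
    and r_inj: "\<lbrakk>i < n; j < n; inv (r i) \<otimes> r j \<in> H\<rbrakk> \<Longrightarrow> i = j"
    and r_surj: "g \<in> carrier G \<Longrightarrow> \<exists>i<n. inv (r i) \<otimes> g \<in> H"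

lemma (in group) exists_transversal:
  assumes H: "subgroup H G" and fin: "finite (carrier G)"
  shows "\<exists>n r. transversal G H n r"
proof -
  define E where "E a b \<longleftrightarrow> inv a \<otimes> b \<in> H" for a b
  have Er: "E a a" if "a \<in> carrier G" for a
    using that H by (simp add: E_def subgroup.one_closed)
  have Es: "E b a" if "E a b" "a \<in> carrier G" "b \<in> carrier G" for a b
    using subgroup.m_inv_closed[OF H, of "inv a \<otimes> b"] that by (simp add: E_def inv_mult_group)
  have Et: "E a c" if "E a b" "E b c" "a \<in> carrier G" "b \<in> carrier G" "c \<in> carrier G" for a b c
  proof -
    have "(inv a \<otimes> b) \<otimes> (inv b \<otimes> c) = inv a \<otimes> (b \<otimes> inv b) \<otimes> c"
      using that(3-5) by (simp only: m_assoc inv_closed m_closed)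
    then show ?thesis
      using subgroup.m_closed[OF H, of "inv a \<otimes> b" "inv b \<otimes> c"] that by (simp add: E_def)
  qed
  \<comment> \<open>For equivalent elements the predicates under \<open>SOME\<close> coincide, so
    \<open>rep\<close> is constant on each coset.\<close>
  define rep where "rep g = (SOME y. y \<in> carrier G \<and> E y g)" for g
  have rep: "rep g \<in> carrier G \<and> E (rep g) g" if "g \<in> carrier G" for g
    unfolding rep_def by (rule someI[of _ g]) (use that Er in auto)
  have rep_eq: "rep g = rep g'" if "E g g'" "g \<in> carrier G" "g' \<in> carrier G" for g g'
  proof -
    have "(\<lambda>y. y \<in> carrier G \<and> E y g) = (\<lambda>y. y \<in> carrier G \<and> E y g')"
      using that Et Es by blast
    then show ?thesis by (simp add: rep_def)
  qed
  let ?R = "rep ` carrier G"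
  obtain r where r: "bij_betw r {0..<card ?R} ?R"
    using ex_bij_betw_nat_finite[of ?R] fin by blast
  have "transversal G H (card ?R) r"
  proof (intro transversal.intro is_group transversal_axioms.intro)
    show "r i \<in> carrier G" if "i < card ?R" for i
    proof -
      have "r i \<in> ?R" using bij_betwE[OF r] that by (meson atLeastLessThan_iff le0)
      then obtain g where "g \<in> carrier G" "r i = rep g" by (rule imageE) simp
      then show ?thesis using rep[of g] by simp
    qed
    show "i = j" if ij: "i < card ?R" "j < card ?R" "inv (r i) \<otimes> r j \<in> H" for i j
    proof -
      have "r i \<in> ?R" "r j \<in> ?R"
        using bij_betwE[OF r] ij(1,2) by (meson atLeastLessThan_iff le0)+
      then obtain g g' where g: "g \<in> carrier G" "r i = rep g" "g' \<in> carrier G" "r j = rep g'"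
        by blast
      have "E (rep g) (rep g')" using ij(3) g by (simp add: E_def)
      then have "E g g'" using rep g Et Es by metis
      then have "r i = r j" using rep_eq g by simp
      then show ?thesis using r ij by (auto simp: bij_betw_def inj_on_def)
    qed
    show "\<exists>i<card ?R. inv (r i) \<otimes> g \<in> H" if g: "g \<in> carrier G" for g
    proof -
      have "rep g \<in> r ` {0..<card ?R}" using r g by (simp add: bij_betw_def)
      then show ?thesis using rep[OF g] by (auto simp: E_def)
    qed
  qed (rule H)
  then show ?thesis by blast
qed

context transversal
begin

lemma bij: "bij_betw (\<lambda>(i, h). r i \<otimes> h) ({..<n} \<times> H) (carrier G)"
proof (rule bij_betwI')
  fix x y assume xy: "x \<in> {..<n} \<times> H" "y \<in> {..<n} \<times> H"
  obtain i h j k where x: "x = (i, h)" and y: "y = (j, k)" by (cases x, cases y)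
  have ih: "i < n" "h \<in> H" "j < n" "k \<in> H" using xy x y by auto
  have hc: "h \<in> carrier G" "k \<in> carrier G" using ih subgroup.mem_carrier[OF subH] by auto
  note rc = r_closed[OF ih(1)] r_closed[OF ih(3)]
  have "x = y" if eq: "r i \<otimes> h = r j \<otimes> k"
  proof -
    have "inv (r i) \<otimes> (r i \<otimes> h) = inv (r i) \<otimes> (r j \<otimes> k)" by (simp only: eq)
    then have "h = inv (r i) \<otimes> r j \<otimes> k" using rc hc by (simp add: m_assoc[symmetric])
    then have "inv (r i) \<otimes> r j = h \<otimes> inv k" using rc hc by (simp add: m_assoc)
    then have "inv (r i) \<otimes> r j \<in> H"
      using ih subH by (simp add: subgroup.m_closed subgroup.m_inv_closed)
    then have "i = j" using r_inj ih by blast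
    then show ?thesis using eq rc hc by (simp add: x y)
  qed
  then show "((case x of (i, h) \<Rightarrow> r i \<otimes> h) = (case y of (i, h) \<Rightarrow> r i \<otimes> h)) = (x = y)"
    by (auto simp: x y)
next
  fix x assume "x \<in> {..<n} \<times> H"
  then show "(case x of (i, h) \<Rightarrow> r i \<otimes> h) \<in> carrier G"
    using r_closed subgroup.mem_carrier[OF subH] by auto
next
  fix g assume g: "g \<in> carrier G"
  then obtain i where i: "i < n" "inv (r i) \<otimes> g \<in> H" using r_surj by blast
  have "g = r i \<otimes> (inv (r i) \<otimes> g)" using g r_closed[OF i(1)] by (simp add: m_assoc[symmetric])
  then show "\<exists>x\<in>{..<n} \<times> H. g = (case x of (i, h) \<Rightarrow> r i \<otimes> h)"
    using i by (intro bexI[of _ "(i, inv (r i) \<otimes> g)"]) auto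
qed

lemma card_eq: "card (carrier G) = n * card H"
  using bij_betw_same_card[OF bij] by (simp add: card_cartesian_product)

lemma n_pos: "0 < n"
  using r_surj[OF one_closed] by auto

lemma sum_carrier: "sum f (carrier G) = (\<Sum>i<n. \<Sum>h\<in>H. f (r i \<otimes> h))"
proof -
  have "sum f (carrier G) = (\<Sum>x\<in>{..<n} \<times> H. f (case x of (i, h) \<Rightarrow> r i \<otimes> h))"
    using sum.reindex_bij_betw[OF bij, of f] by simp
  also have "\<dots> = (\<Sum>(i, h)\<in>{..<n} \<times> H. f (r i \<otimes> h))"
    by (intro sum.cong) auto
  finally show ?thesis by (simp add: sum.cartesian_product)
qed

text \<open>As \<mu> vanishes off \<open>H\<close>, these are monomial matrices: for
  \<open>g\<close> in \<open>G\<close>, column j has its only nonzero entry in the row i with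
  \<open>g \<otimes> r j\<close> in the coset of \<open>r i\<close>.\<close>

definition induced_rep :: "('g \<Rightarrow> complex) \<Rightarrow> 'g \<Rightarrow> complex mat" where
  "induced_rep \<mu> g = mat n n (\<lambda>(i, j). \<mu> (inv (r i) \<otimes> g \<otimes> r j))"

lemma induced_rep_mult:
  assumes mu: "linear_character G H \<mu>" and g: "g \<in> carrier G" and h: "h \<in> carrier G"
  shows "induced_rep \<mu> (g \<otimes> h) = induced_rep \<mu> g * induced_rep \<mu> h"
proof (rule eq_matI)
  fix i j assume "i < dim_row (induced_rep \<mu> g * induced_rep \<mu> h)"
    "j < dim_col (induced_rep \<mu> g * induced_rep \<mu> h)"
  then have ij: "i < n" "j < n" by (auto simp: induced_rep_def)
  note rc = r_closed[OF ij(1)] r_closed[OF ij(2)]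
  \<comment> \<open>\<open>k\<close> is the coset of \<open>h \<otimes> r j\<close>. Only the
    summand with this index survives in the matrix product.\<close>
  obtain k where k: "k < n" "inv (r k) \<otimes> (h \<otimes> r j) \<in> H"
    using r_surj[of "h \<otimes> r j"] h rc by auto
  have zero: "\<mu> (inv (r l) \<otimes> h \<otimes> r j) = 0" if l: "l < n" "l \<noteq> k" for l
  proof -
    have "inv (r l) \<otimes> h \<otimes> r j \<notin> H"
    proof
      assume a: "inv (r l) \<otimes> h \<otimes> r j \<in> H"
      have "inv (r l) \<otimes> r k = (inv (r l) \<otimes> h \<otimes> r j) \<otimes> inv (inv (r k) \<otimes> (h \<otimes> r j))"
      proof -
        have "(inv (r l) \<otimes> h \<otimes> r j) \<otimes> inv (inv (r k) \<otimes> (h \<otimes> r j))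
            = inv (r l) \<otimes> ((h \<otimes> r j) \<otimes> inv (h \<otimes> r j)) \<otimes> r k"
          using h rc r_closed[OF k(1)] r_closed[OF l(1)]
          by (simp only: inv_mult_group m_assoc inv_closed m_closed inv_inv)
        then show ?thesis using h rc r_closed[OF k(1)] r_closed[OF l(1)] by simp
      qed
      then have "inv (r l) \<otimes> r k \<in> H"
        using a k(2) subH by (simp add: subgroup.m_closed subgroup.m_inv_closed)
      then show False using r_inj[OF l(1) k(1)] l(2) by blast
    qed
    then show ?thesis using mu by (simp add: linear_character_iff)
  qed
  have "(induced_rep \<mu> g * induced_rep \<mu> h) $$ (i, j)
      = (\<Sum>l<n. \<mu> (inv (r i) \<otimes> g \<otimes> r l) * \<mu> (inv (r l) \<otimes> h \<otimes> r j))"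
    using ij by (subst mult_mat_index[of _ n n _ n]) (auto simp: induced_rep_def)
  also have "\<dots> = (\<Sum>l\<in>{k}. \<mu> (inv (r i) \<otimes> g \<otimes> r l) * \<mu> (inv (r l) \<otimes> h \<otimes> r j))"
    by (rule sum.mono_neutral_right) (use k zero in auto)
  also have "\<dots> = \<mu> ((inv (r i) \<otimes> g \<otimes> r k) \<otimes> (inv (r k) \<otimes> (h \<otimes> r j)))"
    using linear_character_mult_right[OF mu _ k(2), of "inv (r i) \<otimes> g \<otimes> r k"]
      g h rc r_closed[OF k(1)] by (simp add: m_assoc)
  also have "(inv (r i) \<otimes> g \<otimes> r k) \<otimes> (inv (r k) \<otimes> (h \<otimes> r j))
      = inv (r i) \<otimes> g \<otimes> (r k \<otimes> inv (r k)) \<otimes> (h \<otimes> r j)"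
    using g h rc r_closed[OF k(1)] by (simp only: m_assoc inv_closed m_closed)
  also have "\<dots> = inv (r i) \<otimes> (g \<otimes> h) \<otimes> r j"
    using g h rc r_closed[OF k(1)] by (simp add: m_assoc)
  finally show "induced_rep \<mu> (g \<otimes> h) $$ (i, j) = (induced_rep \<mu> g * induced_rep \<mu> h) $$ (i, j)"
    using ij by (simp add: induced_rep_def)
qed (auto simp: induced_rep_def)

lemma induced_rep_one:
  assumes mu: "linear_character G H \<mu>"
  shows "induced_rep \<mu> \<one> = 1\<^sub>m n"
proof (rule eq_matI)
  fix i j assume "i < dim_row (1\<^sub>m n)" "j < dim_col (1\<^sub>m n)"
  then have ij: "i < n" "j < n" by auto
  then show "induced_rep \<mu> \<one> $$ (i, j) = 1\<^sub>m n $$ (i, j)"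
    using r_closed[OF ij(1)] r_closed[OF ij(2)] r_inj[OF ij] mu linear_character_one[OF mu]
    by (auto simp: induced_rep_def linear_character_iff)
qed (auto simp: induced_rep_def)

text \<open>Conjugation by an element of \<open>H\<close> does not change the extended \<mu>, so
  every coset contributes \<open>card H\<close> equal summands to the sum over \<open>G\<close>,
  which cancels the denominator in \<open>induced\<close>.\<close>

lemma trace_induced_rep:
  assumes mu: "linear_character G H \<mu>" and fin: "finite (carrier G)" and g: "g \<in> carrier G"
  shows "mat_trace (induced_rep \<mu> g) = induced G H \<mu> g"
proof -
  have H0: "card H \<noteq> 0"
    using card_eq fin one_closed by (metis card_gt_0_iff empty_iff mult_is_0 neq0_conv)
  have "(\<Sum>y\<in>carrier G. if inv y \<otimes> g \<otimes> y \<in> H then \<mu> (inv y \<otimes> g \<otimes> y) else 0)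
      = (\<Sum>y\<in>carrier G. \<mu> (inv y \<otimes> g \<otimes> y))"
    using mu by (intro sum.cong) (auto simp: linear_character_iff)
  also have "\<dots> = (\<Sum>i<n. \<Sum>h\<in>H. \<mu> (inv (r i \<otimes> h) \<otimes> g \<otimes> (r i \<otimes> h)))"
    by (rule sum_carrier)
  also have "\<dots> = (\<Sum>i<n. \<Sum>h\<in>H. \<mu> (inv (r i) \<otimes> g \<otimes> r i))"
  proof (intro sum.cong refl)
    fix i h assume "i \<in> {..<n}" and h: "h \<in> H"
    then have rc: "r i \<in> carrier G" using r_closed by simp
    have hc: "h \<in> carrier G" using subgroup.mem_carrier[OF subH h] .
    let ?a = "inv (r i) \<otimes> g \<otimes> r i"
    have ac: "?a \<in> carrier G" using rc g by simp
    have "inv (r i \<otimes> h) \<otimes> g \<otimes> (r i \<otimes> h) = inv h \<otimes> ?a \<otimes> h"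
      using rc hc g by (simp add: inv_mult_group m_assoc)
    moreover have "\<mu> (inv h \<otimes> ?a \<otimes> h) = \<mu> ?a"
    proof (cases "?a \<in> H")
      case True
      then show ?thesis
        using h mu hc ac linear_character_inv[OF mu h] subH
        by (simp add: linear_character_iff subgroup.m_closed subgroup.m_inv_closed)
    next
      case False
      have "inv h \<otimes> ?a \<otimes> h \<notin> H"
      proof
        assume "inv h \<otimes> ?a \<otimes> h \<in> H"
        then have "h \<otimes> (inv h \<otimes> ?a \<otimes> h) \<otimes> inv h \<in> H"
          using subH h by (simp add: subgroup.m_closed subgroup.m_inv_closed)
        moreover have "h \<otimes> (inv h \<otimes> ?a \<otimes> h) \<otimes> inv h = (h \<otimes> inv h) \<otimes> ?a \<otimes> (h \<otimes> inv h)"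
          using hc ac by (simp only: m_assoc inv_closed m_closed)
        ultimately show False using False hc ac by simp
      qed
      then show ?thesis using False mu by (simp add: linear_character_iff)
    qed
    ultimately show "\<mu> (inv (r i \<otimes> h) \<otimes> g \<otimes> (r i \<otimes> h)) = \<mu> ?a" by simp
  qed
  also have "\<dots> = of_nat (card H) * (\<Sum>i<n. \<mu> (inv (r i) \<otimes> g \<otimes> r i))"
    by (simp add: sum_distrib_left)
  also have "(\<Sum>i<n. \<mu> (inv (r i) \<otimes> g \<otimes> r i)) = mat_trace (induced_rep \<mu> g)"
    by (simp add: mat_trace_def induced_rep_def)
  finally show ?thesis using g H0 by (simp add: induced_def)
qed

text \<open>Mackey's criterion. If \<open>W\<close> is invariant and \<open>w \<in> W\<close> has a nonzero \<open>j\<close>-th coordinate, then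
  averaging \<open>w\<close> over \<open>r j H (r j)\<^sup>-\<^sup>1\<close> against the conjugate of \<open>\<mu>\<close> produces a nonzero multiple of
  the \<open>j\<close>-th unit vector, and the group permutes the coordinate lines transitively.\<close>

lemma induced_rep_irreducible:
  assumes mu: "linear_character G H \<mu>" and fin: "finite (carrier G)"
    and mackey: "\<And>y. y \<in> carrier G \<Longrightarrow> y \<notin> H \<Longrightarrow>
      \<exists>h\<in>H. \<exists>h'\<in>H. h \<otimes> y = y \<otimes> h' \<and> \<mu> h \<noteq> \<mu> h'"
  shows "irreducible_rep G n (induced_rep \<mu>)"
  unfolding irreducible_rep_iff[OF is_group]
proof (intro conjI ballI allI impI)
  show "0 < n" by (rule n_pos)
  show "induced_rep \<mu> \<one> = 1\<^sub>m n" by (rule induced_rep_one[OF mu])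
  show "induced_rep \<mu> g \<in> carrier_mat n n" for g by (simp add: induced_rep_def)
  show "induced_rep \<mu> (g \<otimes> h) = induced_rep \<mu> g * induced_rep \<mu> h"
    if "g \<in> carrier G" "h \<in> carrier G" for g h
    using induced_rep_mult[OF mu that] .
next
  fix W assume "W \<subseteq> carrier_vec n \<and> 0\<^sub>v n \<in> W \<and> (\<forall>v\<in>W. \<forall>w\<in>W. v + w \<in> W) \<and>
    (\<forall>c. \<forall>v\<in>W. c \<cdot>\<^sub>v v \<in> W) \<and> (\<forall>g\<in>carrier G. \<forall>w\<in>W. induced_rep \<mu> g *\<^sub>v w \<in> W)"
  then have W: "W \<subseteq> carrier_vec n" "0\<^sub>v n \<in> W" "\<And>v w. v \<in> W \<Longrightarrow> w \<in> W \<Longrightarrow> v + w \<in> W"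
    "\<And>c v. v \<in> W \<Longrightarrow> c \<cdot>\<^sub>v v \<in> W" "\<And>g w. g \<in> carrier G \<Longrightarrow> w \<in> W \<Longrightarrow> induced_rep \<mu> g *\<^sub>v w \<in> W"
    by auto
  have Wsum: "vec n (\<lambda>i. \<Sum>a\<in>A. f a $ i) \<in> W" if "finite A" "\<And>a. a \<in> A \<Longrightarrow> f a \<in> W"
    for A :: "'c set" and f
    using that
  proof (induction A rule: finite_induct)
    case empty
    have "vec n (\<lambda>i. \<Sum>a\<in>{}. f a $ i) = 0\<^sub>v n" by (intro eq_vecI) auto
    then show ?case using W(2) by simp
  next
    case (insert a A)
    have "f a \<in> carrier_vec n" using insert W(1) by auto
    then have "vec n (\<lambda>i. \<Sum>a\<in>insert a A. f a $ i) = f a + vec n (\<lambda>i. \<Sum>a\<in>A. f a $ i)"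
      using insert(1,2) by (intro eq_vecI) auto
    then show ?case using insert W(3) by auto
  qed
  have app: "(induced_rep \<mu> g *\<^sub>v w) $ i = (\<Sum>k<n. \<mu> (inv (r i) \<otimes> g \<otimes> r k) * w $ k)"
    if "w \<in> carrier_vec n" "i < n" for g w i
    using that by (simp add: induced_rep_def scalar_prod_def atLeast0LessThan)
  have finH: "finite H" using subgroup.subset[OF subH] fin finite_subset by blast
  have unit: "unit_vec n j \<in> W" if w: "w \<in> W" and j: "j < n" and wj: "w $ j \<noteq> 0" for w j
  proof -
    have wc: "w \<in> carrier_vec n" using w W(1) by blast
    note rj = r_closed[OF j]
    have H1: "\<one> \<in> H" by (rule subgroup.one_closed[OF subH])
    define f where "f h = \<mu> (inv h) \<cdot>\<^sub>v (induced_rep \<mu> (r j \<otimes> h \<otimes> inv (r j)) *\<^sub>v w)" for h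
    have fW: "f h \<in> W" if "h \<in> H" for h
      unfolding f_def using rj subgroup.mem_carrier[OF subH that] w by (intro W(4,5)) auto
    define S where "S i k = (\<Sum>h\<in>H. \<mu> (inv h) * \<mu> (inv (r i) \<otimes> (r j \<otimes> h \<otimes> inv (r j)) \<otimes> r k))" for i k
    have fi: "(\<Sum>h\<in>H. f h $ i) = (\<Sum>k<n. w $ k * S i k)" if i: "i < n" for i
    proof -
      have "(\<Sum>h\<in>H. f h $ i) = (\<Sum>h\<in>H. \<Sum>k<n. w $ k * (\<mu> (inv h) * \<mu> (inv (r i) \<otimes> (r j \<otimes> h \<otimes> inv (r j)) \<otimes> r k)))"
      proof (rule sum.cong[OF refl])
        fix h assume "h \<in> H"
        have "dim_vec (induced_rep \<mu> (r j \<otimes> h \<otimes> inv (r j)) *\<^sub>v w) = n" by (simp add: induced_rep_def)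
        then have "f h $ i = \<mu> (inv h) * (induced_rep \<mu> (r j \<otimes> h \<otimes> inv (r j)) *\<^sub>v w) $ i"
          using i by (simp only: f_def index_smult_vec)
        then show "f h $ i = (\<Sum>k<n. w $ k * (\<mu> (inv h) * \<mu> (inv (r i) \<otimes> (r j \<otimes> h \<otimes> inv (r j)) \<otimes> r k)))"
          unfolding app[OF wc i] sum_distrib_left by (simp add: mult_ac)
      qed
      also have "\<dots> = (\<Sum>k<n. w $ k * S i k)"
        unfolding S_def sum_distrib_left by (rule sum.swap)
      finally show ?thesis .
    qed
    \<comment> \<open>With the Mackey pair \<open>h0\<close>, \<open>h1\<close> for the element
      \<open>?y\<close>, replacing \<open>h\<close> by \<open>h \<otimes> h0\<close> multiplies the
      sum by \<open>\<mu> h1 / \<mu> h0\<close>, which is not 1.\<close>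
    have S0: "S i k = 0" if i: "i < n" and k: "k < n" "k \<noteq> j" for i k
    proof -
      let ?y = "inv (r j) \<otimes> r k"
      have yc: "?y \<in> carrier G" using rj r_closed[OF k(1)] by simp
      have "?y \<notin> H" using r_inj[OF j k(1)] k(2) by blast
      then obtain h0 h1 where h0: "h0 \<in> H" "h1 \<in> H" "h0 \<otimes> ?y = ?y \<otimes> h1" "\<mu> h0 \<noteq> \<mu> h1"
        using mackey[OF yc] by blast
      have hc: "h0 \<in> carrier G" "h1 \<in> carrier G" using h0 subgroup.mem_carrier[OF subH] by auto
      have "S i k = (\<Sum>h\<in>H. \<mu> (inv (h \<otimes> h0)) * \<mu> (inv (r i) \<otimes> (r j \<otimes> (h \<otimes> h0) \<otimes> inv (r j)) \<otimes> r k))"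
        unfolding S_def
      proof (rule sum.reindex_bij_witness[of _ "\<lambda>h. h \<otimes> h0" "\<lambda>h. h \<otimes> inv h0"])
        fix h assume h: "h \<in> H"
        then show "h \<otimes> inv h0 \<otimes> h0 = h" "h \<otimes> h0 \<otimes> inv h0 = h"
          using hc subgroup.mem_carrier[OF subH h] by (simp_all add: m_assoc)
        then show "\<mu> (inv (h \<otimes> inv h0 \<otimes> h0)) * \<mu> (inv (r i) \<otimes> (r j \<otimes> (h \<otimes> inv h0 \<otimes> h0) \<otimes> inv (r j)) \<otimes> r k)
          = \<mu> (inv h) * \<mu> (inv (r i) \<otimes> (r j \<otimes> h \<otimes> inv (r j)) \<otimes> r k)" by simp
        show "h \<otimes> inv h0 \<in> H" "h \<otimes> h0 \<in> H"
          using h h0 subH by (auto intro: subgroup.m_closed subgroup.m_inv_closed)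
      qed
      also have "\<dots> = (\<Sum>h\<in>H. (\<mu> h1 / \<mu> h0) * (\<mu> (inv h) * \<mu> (inv (r i) \<otimes> (r j \<otimes> h \<otimes> inv (r j)) \<otimes> r k)))"
      proof (rule sum.cong[OF refl])
        fix h assume h: "h \<in> H"
        have hc': "h \<in> carrier G" using subgroup.mem_carrier[OF subH h] .
        note rc = rj r_closed[OF i] r_closed[OF k(1)] hc hc'
        have "\<mu> (inv (h \<otimes> h0)) = \<mu> (inv h) / \<mu> h0"
        proof -
          have "h \<otimes> h0 \<in> H" "\<mu> (h \<otimes> h0) = \<mu> h * \<mu> h0"
            using h h0 mu by (auto simp: linear_character_iff subgroup.m_closed)
          then show ?thesis
            using linear_character_inv[OF mu h] linear_character_inv[OF mu, of "h \<otimes> h0"]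
            by (simp add: divide_inverse)
        qed
        moreover have "inv (r i) \<otimes> (r j \<otimes> (h \<otimes> h0) \<otimes> inv (r j)) \<otimes> r k
            = inv (r i) \<otimes> (r j \<otimes> h \<otimes> inv (r j)) \<otimes> r k \<otimes> h1"
        proof -
          have "inv (r i) \<otimes> (r j \<otimes> (h \<otimes> h0) \<otimes> inv (r j)) \<otimes> r k
              = inv (r i) \<otimes> r j \<otimes> h \<otimes> (h0 \<otimes> ?y)"
            using rc by (simp only: m_assoc inv_closed m_closed)
          also have "\<dots> = inv (r i) \<otimes> r j \<otimes> h \<otimes> (?y \<otimes> h1)" by (simp only: h0(3))
          also have "\<dots> = inv (r i) \<otimes> (r j \<otimes> h \<otimes> inv (r j)) \<otimes> r k \<otimes> h1"
            using rc by (simp only: m_assoc inv_closed m_closed)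
          finally show ?thesis .
        qed
        moreover have "\<mu> (inv (r i) \<otimes> (r j \<otimes> h \<otimes> inv (r j)) \<otimes> r k \<otimes> h1)
            = \<mu> (inv (r i) \<otimes> (r j \<otimes> h \<otimes> inv (r j)) \<otimes> r k) * \<mu> h1"
          using rc h0 by (intro linear_character_mult_right[OF mu]) auto
        ultimately show "\<mu> (inv (h \<otimes> h0)) * \<mu> (inv (r i) \<otimes> (r j \<otimes> (h \<otimes> h0) \<otimes> inv (r j)) \<otimes> r k)
          = (\<mu> h1 / \<mu> h0) * (\<mu> (inv h) * \<mu> (inv (r i) \<otimes> (r j \<otimes> h \<otimes> inv (r j)) \<otimes> r k))"
          by simp
      qed
      also have "\<dots> = (\<mu> h1 / \<mu> h0) * S i k" by (simp add: S_def sum_distrib_left)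
      finally have "S i k = (\<mu> h1 / \<mu> h0) * S i k" .
      moreover have "\<mu> h1 / \<mu> h0 \<noteq> 1" using h0 mu by (auto simp: linear_character_iff)
      ultimately show ?thesis by (metis mult_cancel_right1 mult_cancel_right2)
    qed
    have Sj: "S i j = (if i = j then of_nat (card H) else 0)" if i: "i < n" for i
    proof -
      have "\<mu> (inv h) * \<mu> (inv (r i) \<otimes> (r j \<otimes> h \<otimes> inv (r j)) \<otimes> r j) = (if i = j then 1 else 0)"
        if h: "h \<in> H" for h
      proof -
        have hc: "h \<in> carrier G" using subgroup.mem_carrier[OF subH h] .
        note rc = rj r_closed[OF i] hc
        have "inv (r i) \<otimes> (r j \<otimes> h \<otimes> inv (r j)) \<otimes> r j = inv (r i) \<otimes> r j \<otimes> h"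
          using rc by (simp add: m_assoc)
        then have e: "\<mu> (inv (r i) \<otimes> (r j \<otimes> h \<otimes> inv (r j)) \<otimes> r j) = \<mu> (inv (r i) \<otimes> r j) * \<mu> h"
          using linear_character_mult_right[OF mu _ h, of "inv (r i) \<otimes> r j"] rc by simp
        show ?thesis
        proof (cases "i = j")
          case True
          have "\<mu> h \<noteq> 0" using mu h by (simp add: linear_character_iff)
          then show ?thesis
            unfolding e linear_character_inv[OF mu h] using True rj linear_character_one[OF mu] by simp
        next
          case False
          then have "inv (r i) \<otimes> r j \<notin> H" using r_inj[OF i j] by blast
          then show ?thesis unfolding e using False mu by (simp add: linear_character_iff)
        qed
      qed
      then show ?thesis by (simp add: S_def)
    qed
    have "vec n (\<lambda>i. \<Sum>h\<in>H. f h $ i) \<in> W" by (rule Wsum[OF finH fW])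
    then have "(1 / (w $ j * of_nat (card H))) \<cdot>\<^sub>v vec n (\<lambda>i. \<Sum>h\<in>H. f h $ i) \<in> W" by (rule W(4))
    moreover have "(1 / (w $ j * of_nat (card H))) \<cdot>\<^sub>v vec n (\<lambda>i. \<Sum>h\<in>H. f h $ i) = unit_vec n j"
    proof (rule eq_vecI)
      fix i assume "i < dim_vec (unit_vec n j)"
      then have i: "i < n" by simp
      have "(\<Sum>k<n. w $ k * S i k) = (\<Sum>k\<in>{j}. w $ k * S i k)"
        by (rule sum.mono_neutral_right) (use j S0[OF i] in auto)
      then have "(\<Sum>h\<in>H. f h $ i) = w $ j * (if i = j then of_nat (card H) else 0)"
        using fi[OF i] Sj[OF i] by simp
      then show "((1 / (w $ j * of_nat (card H))) \<cdot>\<^sub>v vec n (\<lambda>i. \<Sum>h\<in>H. f h $ i)) $ i = unit_vec n j $ i"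
        using i j wj finH H1 by auto
    qed simp
    ultimately show ?thesis by simp
  qed
  show "W = {0\<^sub>v n} \<or> W = carrier_vec n"
  proof (rule disjCI)
    assume "W \<noteq> carrier_vec n"
    show "W = {0\<^sub>v n}"
    proof (rule ccontr)
      assume "W \<noteq> {0\<^sub>v n}"
      then obtain w where w: "w \<in> W" "w \<noteq> 0\<^sub>v n" using W(2) by blast
      then obtain j where j: "j < n" "w $ j \<noteq> 0"
        using W(1) by (metis carrier_vecD eq_vecI index_zero_vec subsetD)
      note uj = unit[OF w(1) j]
      \<comment> \<open>\<open>r k \<otimes> inv (r j)\<close> carries the j-th unit vector to a
        vector with k-th coordinate 1, so that \<open>unit\<close> applies once more.\<close>
      have units: "unit_vec n k \<in> W" if k: "k < n" for k
      proof -
        have "(induced_rep \<mu> (r k \<otimes> inv (r j)) *\<^sub>v unit_vec n j) $ k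
            = \<mu> (inv (r k) \<otimes> (r k \<otimes> inv (r j)) \<otimes> r j)"
        proof -
          have "(\<Sum>l<n. \<mu> (inv (r k) \<otimes> (r k \<otimes> inv (r j)) \<otimes> r l) * unit_vec n j $ l)
            = (\<Sum>l\<in>{j}. \<mu> (inv (r k) \<otimes> (r k \<otimes> inv (r j)) \<otimes> r l) * unit_vec n j $ l)"
            by (rule sum.mono_neutral_right) (use j in auto)
          then show ?thesis using j k by (subst app) auto
        qed
        also have "inv (r k) \<otimes> (r k \<otimes> inv (r j)) \<otimes> r j = \<one>"
          using r_closed[OF k] r_closed[OF j(1)] by (simp add: m_assoc[symmetric])
        finally have "(induced_rep \<mu> (r k \<otimes> inv (r j)) *\<^sub>v unit_vec n j) $ k \<noteq> 0"
          using linear_character_one[OF mu] by simp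
        then show ?thesis
          using r_closed[OF k] r_closed[OF j(1)] by (intro unit[OF W(5)[OF _ uj] k]) auto
      qed
      have "v \<in> W" if v: "v \<in> carrier_vec n" for v
      proof -
        have "vec n (\<lambda>i. \<Sum>k<n. (v $ k \<cdot>\<^sub>v unit_vec n k) $ i) \<in> W"
          by (rule Wsum) (auto intro: W(4) units)
        also have "vec n (\<lambda>i. \<Sum>k<n. (v $ k \<cdot>\<^sub>v unit_vec n k) $ i) = v"
        proof (rule eq_vecI)
          fix i assume "i < dim_vec v"
          then have i: "i < n" using v by simp
          have "(\<Sum>k<n. (v $ k \<cdot>\<^sub>v unit_vec n k) $ i) = (\<Sum>k\<in>{i}. (v $ k \<cdot>\<^sub>v unit_vec n k) $ i)"
            by (rule sum.mono_neutral_right) (use i in auto)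
          then show "vec n (\<lambda>i. \<Sum>k<n. (v $ k \<cdot>\<^sub>v unit_vec n k) $ i) $ i = v $ i" using i by simp
        qed (use v in simp)
        finally show ?thesis .
      qed
      then show False using \<open>W \<noteq> carrier_vec n\<close> W(1) by blast
    qed
  qed
qed

end

lemma (in group) induced_in_Irr:
  assumes "finite (carrier G)" and mu: "linear_character G H \<mu>"
    and "\<And>y. y \<in> carrier G \<Longrightarrow> y \<notin> H \<Longrightarrow>
      \<exists>h\<in>H. \<exists>h'\<in>H. h \<otimes> y = y \<otimes> h' \<and> \<mu> h \<noteq> \<mu> h'"
  shows "induced G H \<mu> \<in> Irr G"
proof -
  obtain n r where "transversal G H n r"
    using exists_transversal assms by (metis linear_character_iff)
  then interpret transversal G H n r .
  have "irreducible_rep G n (induced_rep \<mu>)"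
    by (rule induced_rep_irreducible[OF mu assms(1,3)])
  moreover have "induced G H \<mu> = (\<lambda>g. if g \<in> carrier G then mat_trace (induced_rep \<mu> g) else 0)"
    using trace_induced_rep[OF mu assms(1)] by (auto simp: induced_def)
  ultimately show ?thesis unfolding Irr_def by blast
qed

lemma Irr_one_nonzero:
  assumes "group G" "\<chi> \<in> Irr G"
  shows "\<chi> \<one>\<^bsub>G\<^esub> \<noteq> 0"
proof -
  interpret group G by fact
  obtain n \<rho> where "irreducible_rep G n \<rho>"
      and \<chi>: "\<chi> = (\<lambda>g. if g \<in> carrier G then mat_trace (\<rho> g) else 0)"
    using assms(2) unfolding Irr_def by blast
  then have "\<rho> \<one>\<^bsub>G\<^esub> = 1\<^sub>m n" "0 < n" by (simp_all add: irreducible_rep_iff[OF assms(1)])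
  then show ?thesis by (simp add: \<chi> mat_trace_def)
qed

section \<open>Inner products of induced characters and completeness of a family\<close>

context group
begin

lemma linear_character_mult_left:
  assumes "linear_character G H \<mu>" "a \<in> carrier G" "b \<in> H"
  shows "\<mu> (b \<otimes> a) = \<mu> b * \<mu> a"
proof (cases "a \<in> H")
  case True
  then show ?thesis using assms by (simp add: linear_character_iff)
next
  case False
  have H: "subgroup H G" using assms by (simp add: linear_character_iff)
  have b: "b \<in> carrier G" using subgroup.mem_carrier[OF H assms(3)] .
  have "a = inv b \<otimes> (b \<otimes> a)" using assms(2) b by (simp add: m_assoc[symmetric])
  then have "b \<otimes> a \<notin> H"
    using False subgroup.m_closed[OF H subgroup.m_inv_closed[OF H assms(3)]] by metis
  then show ?thesis using False assms by (simp add: linear_character_iff)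
qed

lemma induced_eq:
  assumes "linear_character G H \<mu>" "g \<in> carrier G"
  shows "induced G H \<mu> g = (\<Sum>y\<in>carrier G. \<mu> (inv y \<otimes> g \<otimes> y)) / of_nat (card H)"
proof -
  have "(\<Sum>y\<in>carrier G. if inv y \<otimes> g \<otimes> y \<in> H then \<mu> (inv y \<otimes> g \<otimes> y) else 0)
      = (\<Sum>y\<in>carrier G. \<mu> (inv y \<otimes> g \<otimes> y))"
    using assms by (intro sum.cong) (auto simp: linear_character_iff)
  then show ?thesis using assms(2) by (simp add: induced_def)
qed

lemma induced_one:
  assumes "linear_character G H \<mu>"
  shows "induced G H \<mu> \<one> = of_nat (card (carrier G)) / of_nat (card H)"
proof -
  have "(\<Sum>y\<in>carrier G. \<mu> (inv y \<otimes> \<one> \<otimes> y)) = (\<Sum>y\<in>carrier G. 1)"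
    using linear_character_one[OF assms] by (intro sum.cong) auto
  then show ?thesis using induced_eq[OF assms one_closed] by simp
qed

lemma sum_conj_carrier:
  fixes f :: "'a \<Rightarrow> complex"
  assumes "y \<in> carrier G"
  shows "(\<Sum>g\<in>carrier G. f (inv y \<otimes> g \<otimes> y)) = sum f (carrier G)"
  by (rule sum.reindex_bij_witness[of _ "\<lambda>g. y \<otimes> g \<otimes> inv y" "\<lambda>g. inv y \<otimes> g \<otimes> y"])
     (use assms in \<open>simp_all add: m_assoc\<close>, simp_all add: m_assoc[symmetric])

text \<open>Expanding both inductions gives a sum over two conjugating elements. The inner sum
  \<open>F\<close> is a class function of \<open>g\<close>, so one of the two can be substituted
  away and contributes only the factor |G|.\<close>

lemma induced_inner:
  assumes mu: "linear_character G H \<mu>" and nu: "linear_character G K \<nu>"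
  shows "(\<Sum>g\<in>carrier G. induced G H \<mu> g * induced G K \<nu> (inv g))
    = of_nat (card (carrier G)) / (of_nat (card H) * of_nat (card K)) *
      (\<Sum>z\<in>carrier G. \<Sum>g\<in>carrier G. \<mu> g * \<nu> (inv z \<otimes> inv g \<otimes> z))"
proof -
  let ?N = "of_nat (card (carrier G)) :: complex"
  define F where "F g = (\<Sum>z\<in>carrier G. \<nu> (inv z \<otimes> inv g \<otimes> z))" for g
  have F: "F (inv y \<otimes> g \<otimes> y) = F g" if "y \<in> carrier G" "g \<in> carrier G" for y g
    unfolding F_def
    by (rule sum.reindex_bij_witness[of _ "\<lambda>z. inv y \<otimes> z" "\<lambda>z. y \<otimes> z"])
       (use that in \<open>simp_all add: m_assoc inv_mult_group\<close>, simp_all add: m_assoc[symmetric])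
  have "(\<Sum>g\<in>carrier G. induced G H \<mu> g * induced G K \<nu> (inv g))
      = (\<Sum>g\<in>carrier G. \<Sum>y\<in>carrier G. \<mu> (inv y \<otimes> g \<otimes> y) * F g) / (of_nat (card H) * of_nat (card K))"
  proof (subst sum_divide_distrib, rule sum.cong[OF refl])
    fix g assume g: "g \<in> carrier G"
    show "induced G H \<mu> g * induced G K \<nu> (inv g)
        = (\<Sum>y\<in>carrier G. \<mu> (inv y \<otimes> g \<otimes> y) * F g) / (of_nat (card H) * of_nat (card K))"
      using induced_eq[OF mu g] induced_eq[OF nu inv_closed[OF g]]
      by (simp add: F_def[symmetric] sum_distrib_right)
  qed
  also have "(\<Sum>g\<in>carrier G. \<Sum>y\<in>carrier G. \<mu> (inv y \<otimes> g \<otimes> y) * F g)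
      = (\<Sum>y\<in>carrier G. \<Sum>g\<in>carrier G. \<mu> (inv y \<otimes> g \<otimes> y) * F (inv y \<otimes> g \<otimes> y))"
    by (subst sum.swap) (auto simp: F intro!: sum.cong)
  also have "\<dots> = ?N * (\<Sum>g\<in>carrier G. \<mu> g * F g)"
    by (simp add: sum_conj_carrier[where f = "\<lambda>g. \<mu> g * F g"])
  also have "(\<Sum>g\<in>carrier G. \<mu> g * F g)
      = (\<Sum>z\<in>carrier G. \<Sum>g\<in>carrier G. \<mu> g * \<nu> (inv z \<otimes> inv g \<otimes> z))"
    unfolding F_def sum_distrib_left by (rule sum.swap)
  finally show ?thesis by simp
qed

text \<open>Right translation by \<open>h\<close> multiplies the summand by
  \<open>\<mu> h / \<nu> h'\<close>, which is not 1. One incompatible pair thus annihilates the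
  contribution of \<open>z\<close> to the inner product.\<close>

lemma twisted_sum_eq_zero:
  assumes mu: "linear_character G H \<mu>" and nu: "linear_character G K \<nu>"
    and z: "z \<in> carrier G" and h: "h \<in> H" "h' \<in> K" "h \<otimes> z = z \<otimes> h'" "\<mu> h \<noteq> \<nu> h'"
  shows "(\<Sum>g\<in>carrier G. \<mu> g * \<nu> (inv z \<otimes> inv g \<otimes> z)) = 0"
proof (rule sum_eq_zero_of_translate)
  have hc: "h \<in> carrier G" "h' \<in> carrier G"
    using mu nu h by (auto simp: linear_character_iff dest: subgroup.mem_carrier)
  then show "h \<in> carrier G" by simp
  have nz: "\<nu> h' \<noteq> 0" using nu h by (simp add: linear_character_iff)
  show "\<mu> h / \<nu> h' \<noteq> 1" using h(4) nz by simp
  have h'_inv: "inv h' \<in> K" using nu h by (simp add: linear_character_iff subgroup.m_inv_closed)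
  fix g assume g: "g \<in> carrier G"
  have "inv (h \<otimes> z) = inv (z \<otimes> h')" by (simp only: h(3))
  then have "inv z \<otimes> inv h = inv h' \<otimes> inv z" using hc z by (simp add: inv_mult_group)
  then have "inv z \<otimes> inv (g \<otimes> h) \<otimes> z = inv h' \<otimes> (inv z \<otimes> inv g \<otimes> z)"
    using hc z g by (simp add: inv_mult_group m_assoc[symmetric])
  then have "\<nu> (inv z \<otimes> inv (g \<otimes> h) \<otimes> z) = inverse (\<nu> h') * \<nu> (inv z \<otimes> inv g \<otimes> z)"
    using linear_character_mult_left[OF nu _ h'_inv, of "inv z \<otimes> inv g \<otimes> z"]
      linear_character_inv[OF nu h(2)] z g by simp
  then show "\<mu> (g \<otimes> h) * \<nu> (inv z \<otimes> inv (g \<otimes> h) \<otimes> z)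
      = \<mu> h / \<nu> h' * (\<mu> g * \<nu> (inv z \<otimes> inv g \<otimes> z))"
    using linear_character_mult_right[OF mu g h(1)] by (simp add: divide_inverse)
qed

text \<open>Each \<open>z\<close> in \<open>H\<close> contributes |H| to the expanded inner product,
  and by the Mackey hypothesis every other \<open>z\<close> contributes 0.\<close>

lemma induced_norm:
  assumes fin: "finite (carrier G)" and mu: "linear_character G H \<mu>"
    and mackey: "\<And>y. y \<in> carrier G \<Longrightarrow> y \<notin> H \<Longrightarrow>
      \<exists>h\<in>H. \<exists>h'\<in>H. h \<otimes> y = y \<otimes> h' \<and> \<mu> h \<noteq> \<mu> h'"
  shows "(\<Sum>g\<in>carrier G. induced G H \<mu> g * induced G H \<mu> (inv g)) = of_nat (card (carrier G))"
proof -
  have H: "subgroup H G" using mu by (simp add: linear_character_iff)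
  have HG: "H \<subseteq> carrier G" by (rule subgroup.subset[OF H])
  have finH: "finite H" using HG fin finite_subset by blast
  have cH: "card H \<noteq> 0" using finH subgroup.one_closed[OF H] by auto
  have "(\<Sum>g\<in>carrier G. \<mu> g * \<mu> (inv z \<otimes> inv g \<otimes> z)) = of_nat (card H)" if z: "z \<in> H" for z
  proof -
    have zc: "z \<in> carrier G" "inv z \<in> H" using z HG H by (auto simp: subgroup.m_inv_closed)
    have nz: "\<mu> z \<noteq> 0" using mu z by (simp add: linear_character_iff)
    have "(\<Sum>g\<in>carrier G. \<mu> g * \<mu> (inv z \<otimes> inv g \<otimes> z)) = (\<Sum>g\<in>H. \<mu> g * \<mu> (inv z \<otimes> inv g \<otimes> z))"
      by (rule sum.mono_neutral_right) (use fin HG mu in \<open>auto simp: linear_character_iff\<close>)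
    also have "\<dots> = (\<Sum>g\<in>H. 1)"
    proof (rule sum.cong[OF refl])
      fix g assume g: "g \<in> H"
      then have gc: "g \<in> carrier G" using HG by blast
      have "\<mu> (inv z \<otimes> inv g \<otimes> z) = inverse (\<mu> z) * inverse (\<mu> g) * \<mu> z"
        using linear_character_mult_right[OF mu _ z, of "inv z \<otimes> inv g"]
          linear_character_mult_left[OF mu _ zc(2), of "inv g"]
          linear_character_inv[OF mu g] linear_character_inv[OF mu z] zc(1) gc by simp
      then show "\<mu> g * \<mu> (inv z \<otimes> inv g \<otimes> z) = 1"
        using nz mu g by (simp add: linear_character_iff field_simps)
    qed
    finally show ?thesis by simp
  qed
  moreover have "(\<Sum>g\<in>carrier G. \<mu> g * \<mu> (inv z \<otimes> inv g \<otimes> z)) = 0"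
    if z: "z \<in> carrier G" "z \<notin> H" for z
    using mackey[OF z] twisted_sum_eq_zero[OF mu mu z(1)] by blast
  ultimately have "(\<Sum>z\<in>carrier G. \<Sum>g\<in>carrier G. \<mu> g * \<mu> (inv z \<otimes> inv g \<otimes> z))
      = (\<Sum>z\<in>carrier G. if z \<in> H then of_nat (card H) else 0)"
    by (intro sum.cong) auto
  also have "\<dots> = (\<Sum>z\<in>H. of_nat (card H))"
    using HG fin by (simp add: sum.If_cases Int_absorb1)
  finally show ?thesis
    unfolding induced_inner[OF mu mu] using cH by simp
qed

lemma induced_cnj:
  assumes fin: "finite (carrier G)" and mu: "linear_character G H \<mu>" and g: "g \<in> carrier G"
  shows "induced G H \<mu> (inv g) = cnj (induced G H \<mu> g)"
proof -
  have "\<mu> (inv y \<otimes> inv g \<otimes> y) = cnj (\<mu> (inv y \<otimes> g \<otimes> y))" if y: "y \<in> carrier G" for y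
  proof -
    have "inv y \<otimes> inv g \<otimes> y = inv (inv y \<otimes> g \<otimes> y)"
      using y g by (simp add: inv_mult_group m_assoc)
    then show ?thesis using linear_character_cnj[OF fin mu, of "inv y \<otimes> g \<otimes> y"] y g by simp
  qed
  then show ?thesis using g by (simp add: induced_eq[OF mu])
qed

text \<open>If \<open>y\<close> makes \<open>\<mu> l\<close> and \<open>\<mu> m\<close> compatible only when \<open>l = m\<close> and \<open>y \<in> H l\<close>, then
  the induced characters are irreducible and distinct. The sum of squares then forces
  \<open>\<Sum>\<^sub>l \<chi>\<^sub>l(1) \<chi>\<^sub>l\<close> to be the regular character, so that no irreducible character is missing.\<close>

theorem Irr_bij_induced:
  assumes fin: "finite (carrier G)" and finL: "finite L"
    and lin: "\<And>l. l \<in> L \<Longrightarrow> linear_character G (H l) (\<mu> l)"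
    and compat: "\<And>l m y. \<lbrakk>l \<in> L; m \<in> L; y \<in> carrier G;
        \<And>h h'. \<lbrakk>h \<in> H l; h' \<in> H m; h \<otimes> y = y \<otimes> h'\<rbrakk> \<Longrightarrow> \<mu> l h = \<mu> m h'\<rbrakk> \<Longrightarrow> l = m \<and> y \<in> H l"
    and sum_sq: "(\<Sum>l\<in>L. (real (card (carrier G)) / real (card (H l)))\<^sup>2) = real (card (carrier G))"
  shows "bij_betw (\<lambda>l. induced G (H l) (\<mu> l)) L (Irr G)"
proof -
  define X where "X l = induced G (H l) (\<mu> l)" for l
  let ?C = "carrier G"
  let ?N = "of_nat (card ?C) :: complex"
  have mackey: "\<exists>h\<in>H l. \<exists>h'\<in>H l. h \<otimes> y = y \<otimes> h' \<and> \<mu> l h \<noteq> \<mu> l h'"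
    if "l \<in> L" "y \<in> ?C" "y \<notin> H l" for l y
    using compat[of l l y] that by blast
  have XI: "X l \<in> Irr G" if "l \<in> L" for l
    unfolding X_def by (rule induced_in_Irr[OF fin lin[OF that] mackey[OF that]])
  have norm: "(\<Sum>g\<in>?C. X l g * X l (inv g)) = ?N" if "l \<in> L" for l
    unfolding X_def by (rule induced_norm[OF fin lin[OF that] mackey[OF that]])
  have N0: "?N \<noteq> 0" using fin one_closed by auto
  have orth: "(\<Sum>g\<in>?C. X l g * X m (inv g)) = 0" if lm: "l \<in> L" "m \<in> L" "l \<noteq> m" for l m
  proof -
    have "(\<Sum>g\<in>?C. \<mu> l g * \<mu> m (inv z \<otimes> inv g \<otimes> z)) = 0" if z: "z \<in> ?C" for z
    proof -
      obtain h h' where "h \<in> H l" "h' \<in> H m" "h \<otimes> z = z \<otimes> h'" "\<mu> l h \<noteq> \<mu> m h'"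
        using compat[of l m z] lm z by blast
      then show ?thesis using twisted_sum_eq_zero[OF lin[OF lm(1)] lin[OF lm(2)] z] by blast
    qed
    then show ?thesis
      unfolding X_def induced_inner[OF lin[OF lm(1)] lin[OF lm(2)]] by simp
  qed
  have inj: "inj_on X L"
  proof (rule inj_onI, rule ccontr)
    fix l m assume "l \<in> L" "m \<in> L" "X l = X m" "l \<noteq> m"
    then show False using orth[of l m] norm[of l] N0 by simp
  qed
  define d where "d l = of_nat (card ?C) / (of_nat (card (H l)) :: complex)" for l
  have X1: "X l \<one> = d l" if "l \<in> L" for l
    unfolding X_def d_def by (rule induced_one[OF lin[OF that]])
  have "of_real (\<Sum>l\<in>L. (real (card ?C) / real (card (H l)))\<^sup>2) = ?N"
    by (simp only: sum_sq of_real_of_nat_eq)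
  then have dsq: "(\<Sum>l\<in>L. d l * d l) = ?N"
    by (simp add: d_def power2_eq_square)
  define F where "F g = (\<Sum>l\<in>L. d l * X l g)" for g
  \<comment> \<open>\<open>R\<close> is the regular character, to which \<open>F\<close> will turn
    out to be equal.\<close>
  define R where "R g = (if g = \<one> then ?N else 0)" for g
  have F1: "F \<one> = ?N" using X1 dsq by (simp add: F_def)
  have RA: "(\<Sum>g\<in>?C. R g * A g) = ?N * A \<one>" for A :: "'a \<Rightarrow> complex"
  proof -
    have "(\<Sum>g\<in>?C. R g * A g) = (\<Sum>g\<in>{\<one>}. R g * A g)"
      by (rule sum.mono_neutral_right) (use fin in \<open>auto simp: R_def\<close>)
    then show ?thesis by (simp add: R_def)
  qed
  have Rinv: "R (inv g) = R g" if "g \<in> ?C" for g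
    using that inv_inj by (auto simp: R_def)
  have FX: "(\<Sum>g\<in>?C. F g * X m (inv g)) = d m * ?N" if m: "m \<in> L" for m
  proof -
    have "(\<Sum>g\<in>?C. F g * X m (inv g)) = (\<Sum>l\<in>L. d l * (\<Sum>g\<in>?C. X l g * X m (inv g)))"
      unfolding F_def sum_distrib_right sum_distrib_left by (subst sum.swap) (simp add: mult.assoc)
    also have "\<dots> = (\<Sum>l\<in>{m}. d l * (\<Sum>g\<in>?C. X l g * X m (inv g)))"
      by (rule sum.mono_neutral_right) (use finL m orth in auto)
    finally show ?thesis using norm[OF m] by simp
  qed
  have FF: "(\<Sum>g\<in>?C. F g * F (inv g)) = ?N * ?N"
  proof -
    have "(\<Sum>g\<in>?C. F g * F (inv g)) = (\<Sum>l\<in>L. d l * (\<Sum>g\<in>?C. F g * X l (inv g)))"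
      unfolding F_def[of "inv _"] sum_distrib_left by (subst sum.swap) (simp add: mult_ac)
    also have "\<dots> = (\<Sum>l\<in>L. (d l * d l) * ?N)" using FX by (intro sum.cong) auto
    also have "\<dots> = ?N * ?N" unfolding sum_distrib_right[symmetric] dsq ..
    finally show ?thesis .
  qed
  have FR: "(\<Sum>g\<in>?C. F g * R (inv g)) = ?N * ?N"
    using RA[of F] Rinv F1 by (simp add: mult.commute cong: sum.cong)
  \<comment> \<open>Each of the four sums in the expansion equals |G|^2. As the second factor is the
    conjugate of the first, this forces R = F at every group element.\<close>
  have D0: "(\<Sum>g\<in>?C. (R g - F g) * (R (inv g) - F (inv g))) = 0"
  proof -
    have "(\<Sum>g\<in>?C. (R g - F g) * (R (inv g) - F (inv g)))
        = (\<Sum>g\<in>?C. R g * R (inv g)) - (\<Sum>g\<in>?C. R g * F (inv g)) - (\<Sum>g\<in>?C. F g * R (inv g))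
          + (\<Sum>g\<in>?C. F g * F (inv g))"
      by (simp add: sum_subtractf[symmetric] sum.distrib[symmetric] algebra_simps)
    also have "\<dots> = 0"
      unfolding FF FR RA[of "\<lambda>g. R (inv g)"] RA[of "\<lambda>g. F (inv g)"]
      using F1 by (simp add: R_def)
    finally show ?thesis .
  qed
  have dcnj: "cnj (d l) = d l" for l by (simp add: d_def)
  have "R (inv g) - F (inv g) = cnj (R g - F g)" if g: "g \<in> ?C" for g
    using induced_cnj[OF fin lin g] Rinv[OF g] by (simp add: F_def X_def dcnj R_def)
  then have "(\<Sum>g\<in>?C. of_real ((cmod (R g - F g))\<^sup>2)) = (0 :: complex)"
    using D0 by (simp add: complex_norm_square del: of_real_power complex_cnj_diff)
  then have "(\<Sum>g\<in>?C. (cmod (R g - F g))\<^sup>2) = 0"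
    unfolding of_real_sum[symmetric] by (simp only: of_real_eq_0_iff)
  then have RF: "R g = F g" if "g \<in> ?C" for g
    using that fin by (simp add: sum_nonneg_eq_0_iff)
  have "Irr G \<subseteq> X ` L"
  proof
    fix \<psi> assume psi: "\<psi> \<in> Irr G"
    show "\<psi> \<in> X ` L"
    proof (rule ccontr)
      \<comment> \<open>A missing \<psi> is orthogonal to every \<open>X l\<close>, hence to
        \<open>F\<close>; but pairing it with the regular character gives |G| \<psi>(1), which is
        nonzero.\<close>
      assume "\<psi> \<notin> X ` L"
      then have "(\<Sum>g\<in>?C. X l g * \<psi> (inv g)) = 0" if "l \<in> L" for l
        using Irr_orthogonal[OF fin XI[OF that] psi] that by blast
      then have "(\<Sum>g\<in>?C. F g * \<psi> (inv g)) = 0"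
        unfolding F_def sum_distrib_right
        by (subst sum.swap) (simp add: mult.assoc sum_distrib_left[symmetric])
      moreover have "(\<Sum>g\<in>?C. F g * \<psi> (inv g)) = ?N * \<psi> \<one>"
        using RA[of "\<lambda>g. \<psi> (inv g)"] RF by (simp cong: sum.cong)
      ultimately show False using N0 Irr_one_nonzero[OF is_group psi] by simp
    qed
  qed
  then have "bij_betw X L (Irr G)" using inj XI by (auto simp: bij_betw_def)
  then show ?thesis by (simp add: X_def[abs_def])
qed

end

section \<open>The additive character of the field\<close>

lemma prime_CHAR: "prime CHAR('a::{field,finite})"
  by (intro prime_CHAR_semidom finite_imp_CHAR_pos) auto

text \<open>Multiplication by a nonzero x permutes the nonzero elements, so their product equals
  x^(q-1) times itself.\<close>

lemma power_CARD_eq: "(x :: 'a::{field,finite}) ^ CARD('a) = x"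
proof (cases "x = 0")
  case False
  have "(\<Prod>y\<in>UNIV - {0}. x * y) = (\<Prod>y\<in>UNIV - {0}. y)"
    by (rule prod.reindex_bij_witness[of _ "\<lambda>y. y / x" "\<lambda>y. x * y"]) (use False in auto)
  then have "x ^ (CARD('a) - 1) * (\<Prod>y\<in>UNIV - {0}. y) = 1 * (\<Prod>y\<in>UNIV - {0 :: 'a}. y)"
    by (simp add: prod.distrib card_Diff_singleton)
  moreover have "(\<Prod>y\<in>UNIV - {0 :: 'a}. y) \<noteq> 0" by simp
  ultimately have "x ^ (CARD('a) - 1) = 1" by (metis mult_cancel_right)
  then have "x * x ^ (CARD('a) - 1) = x" by simp
  then show ?thesis by (simp add: power_Suc[symmetric] zero_less_card_finite del: power_Suc)
qed (simp add: zero_less_card_finite)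

lemma of_nat_power_CHAR: "(of_nat n :: 'a::{field,finite}) ^ CHAR('a) = of_nat n"
proof (induction n)
  case 0
  then show ?case using prime_gt_0_nat[OF prime_CHAR[where ?'a = 'a]] by simp
next
  case (Suc n)
  then show ?case by (simp add: freshmans_dream[OF prime_CHAR refl])
qed

text \<open>The p distinct images of natural numbers are roots of X^p - X, which has at most p
  roots.\<close>

lemma prime_field_eq:
  assumes "(y :: 'a::{field,finite}) ^ CHAR('a) = y"
  shows "\<exists>n<CHAR('a). of_nat n = y"
proof -
  let ?p = "CHAR('a)"
  have p: "prime ?p" by (rule prime_CHAR)
  let ?P = "Polynomial.monom 1 ?p - Polynomial.monom 1 1 :: 'a poly"
  have p1: "?p > 1" using prime_gt_1_nat[OF p] .
  have "Polynomial.coeff ?P ?p = 1" using p1 by simp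
  then have P0: "?P \<noteq> 0" by (metis coeff_0 zero_neq_one)
  have "Polynomial.degree ?P \<le> ?p"
    using p1 by (intro degree_diff_le) (auto simp: Polynomial.degree_monom_eq)
  moreover have "card {x. poly ?P x = 0} \<le> Polynomial.degree ?P" by (rule card_poly_roots_bound[OF P0])
  ultimately have "card {x. poly ?P x = 0} \<le> ?p" by linarith
  moreover have "card (of_nat ` {..<?p} :: 'a set) = ?p"
    by (subst card_image) (auto simp: inj_on_def of_nat_eq_iff_cong_CHAR cong_def)
  moreover have "of_nat ` {..<?p} \<subseteq> {x. poly ?P x = 0}"
    by (auto simp: poly_monom of_nat_power_CHAR)
  ultimately have "of_nat ` {..<?p} = {x. poly ?P x = 0}"
    by (intro card_seteq) auto
  moreover have "y \<in> {x. poly ?P x = 0}" using assms by (simp add: poly_monom)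
  ultimately have "y \<in> of_nat ` {..<?p}" by metis
  then show ?thesis by auto
qed

locale prime_power_field =
  fixes p f :: nat and field_type :: "'a::{field,finite} itself"
  assumes CHAR_eq: "CHAR('a) = p" and CARD_eq: "CARD('a) = p ^ f"
begin

lemma p: "prime p"
  using prime_CHAR[where ?'a = 'a] by (simp add: CHAR_eq)

lemma f_pos: "f > 0"
proof (rule ccontr)
  assume "\<not> f > 0"
  then have "CARD('a) = 1" using CARD_eq by simp
  then have "(0 :: 'a) = 1" by (metis UNIV_I card_1_singletonE singletonD)
  then show False by simp
qed

lemma power_p_add: "(s + t :: 'a) ^ p = s ^ p + t ^ p"
  by (rule freshmans_dream[OF prime_CHAR CHAR_eq[symmetric]])

lemma power_p_surj: "\<exists>s :: 'a. s ^ p = t"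
proof (rule exI)
  have "(t ^ p ^ (f - 1)) ^ p = t ^ p ^ Suc (f - 1)"
    by (simp add: power_mult[symmetric] mult.commute)
  also have "\<dots> = t" using f_pos power_CARD_eq[of t] CARD_eq by simp
  finally show "(t ^ p ^ (f - 1)) ^ p = t" .
qed

lemma field_trace_eq: "field_trace (t :: 'a) = (\<Sum>i<f. t ^ p ^ i)"
proof -
  have "multiplicity p (p ^ f) = f"
    using p by (intro multiplicity_same_power) (auto simp: prime_elem_not_unit)
  then show ?thesis by (simp add: field_trace_def CARD_eq CHAR_eq)
qed

lemma field_trace_add: "field_trace (s + t :: 'a) = field_trace s + field_trace t"
proof -
  have "(s + t) ^ p ^ i = s ^ p ^ i + t ^ p ^ i" for i
    by (rule freshmans_dream'[OF prime_CHAR]) (simp add: CHAR_eq)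
  then show ?thesis by (simp add: field_trace_eq sum.distrib)
qed

text \<open>Raising to the p-th power permutes the conjugates cyclically, because t^(p^f) =
  t.\<close>

lemma field_trace_power_p: "field_trace ((t :: 'a) ^ p) = field_trace t"
proof -
  have "(\<Sum>i<f. t ^ p ^ Suc i) + t = (\<Sum>i<Suc f. t ^ p ^ i)"
    unfolding sum.lessThan_Suc_shift by simp
  also have "\<dots> = (\<Sum>i<f. t ^ p ^ i) + t"
    using power_CARD_eq[of t] CARD_eq by simp
  finally show ?thesis by (simp add: field_trace_eq power_mult[symmetric])
qed

lemma field_trace_in_prime_field: "field_trace (t :: 'a) ^ p = field_trace t"
proof -
  have "field_trace t ^ p = field_trace (t ^ p)"
    by (simp add: field_trace_eq freshmans_dream_sum[OF prime_CHAR CHAR_eq[symmetric]] power_mult[symmetric] mult.commute)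
  then show ?thesis by (simp add: field_trace_power_p)
qed

text \<open>The trace is a nonzero polynomial of degree at most p^(f-1), which is below the number
  of field elements, so it cannot vanish everywhere.\<close>

lemma field_trace_nontrivial: "\<exists>t :: 'a. field_trace t \<noteq> 0"
proof (rule ccontr)
  assume a: "\<nexists>t :: 'a. field_trace t \<noteq> 0"
  define P where "P = (\<Sum>i<f. Polynomial.monom 1 (p ^ i) :: 'a poly)"
  have p1: "p > 1" using prime_gt_1_nat[OF p] .
  have "Polynomial.coeff P (p ^ (f - 1)) = (\<Sum>i<f. if i = f - 1 then 1 else 0)"
    unfolding P_def coeff_sum using p1 by (intro sum.cong) auto
  also have "\<dots> = 1" using f_pos by simp
  finally have P0: "P \<noteq> 0" by (metis coeff_0 zero_neq_one)
  have "Polynomial.degree P \<le> p ^ (f - 1)"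
    unfolding P_def using p1 f_pos
    by (intro degree_sum_le) (auto simp: Polynomial.degree_monom_eq intro!: power_increasing)
  also have "\<dots> < p ^ f" using p1 f_pos by (intro power_strict_increasing) auto
  finally have "Polynomial.degree P < CARD('a)" by (simp add: CARD_eq)
  moreover have "{x. poly P x = 0} = UNIV"
    using a by (simp add: P_def poly_sum poly_monom field_trace_eq)
  ultimately show False using card_poly_roots_bound[OF P0] by simp
qed

text \<open>Any natural number representing the trace may replace the one below p picked by the
  definition, since \<open>cis\<close> has period 2 pi. Additivity of \<phi> then needs no reduction
  modulo p.\<close>

lemma \<phi>_eq_cis:
  assumes "of_nat n = field_trace (t :: 'a)"
  shows "\<phi> t = cis (2 * pi * real n / real p)"
proof -
  have p0: "p > 0" using prime_gt_0_nat[OF p] .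
  define m where "m = n mod p"
  have m: "m < p" "of_nat m = field_trace t"
    using p0 by (simp_all add: m_def of_nat_eq_iff_cong_CHAR CHAR_eq flip: assms)
  have "(THE n. n < p \<and> of_nat n = field_trace t) = m"
  proof (rule the_equality)
    fix k assume "k < p \<and> of_nat k = field_trace t"
    then have "k < p" "(of_nat k :: 'a) = of_nat m" using m by simp_all
    then show "k = m" using m(1) by (simp add: of_nat_eq_iff_cong_CHAR cong_def CHAR_eq)
  qed (use m in simp)
  then have "\<phi> t = exp (2 * of_real pi * \<i> * of_nat m / of_nat p)"
    by (simp add: \<phi>_def CHAR_eq)
  also have "\<dots> = cis (2 * pi * real m / real p)"
    by (simp add: cis_conv_exp mult_ac)
  also have "\<dots> = cis (2 * pi * real m / real p) * cis (2 * pi * real (n div p))"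
    by (simp add: cis_multiple_2pi)
  also have "\<dots> = cis (2 * pi * real n / real p)"
  proof -
    have "real n = real m + real (n div p) * real p"
      unfolding m_def of_nat_mult[symmetric] of_nat_add[symmetric] by simp
    then show ?thesis using p0 by (simp add: cis_mult field_simps)
  qed
  finally show ?thesis .
qed

lemma field_trace_of_nat: "\<exists>n<p. of_nat n = field_trace (t :: 'a)"
  using prime_field_eq[of "field_trace t"] field_trace_in_prime_field by (simp add: CHAR_eq)

lemma \<phi>_add: "\<phi> (s + t :: 'a) = \<phi> s * \<phi> t"
proof -
  obtain m n where mn: "of_nat m = field_trace s" "of_nat n = field_trace t"
    using field_trace_of_nat by metis
  then have "of_nat (m + n) = field_trace (s + t)" by (simp add: field_trace_add)
  from \<phi>_eq_cis[OF this] show ?thesis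
    by (simp add: \<phi>_eq_cis[OF mn(1)] \<phi>_eq_cis[OF mn(2)] cis_mult add_divide_distrib distrib_left)
qed

lemma \<phi>_nonzero [simp]: "\<phi> (t :: 'a) \<noteq> 0"
  by (simp add: \<phi>_def)

lemma \<phi>_0 [simp]: "\<phi> (0 :: 'a) = 1"
  using \<phi>_add[of 0 0] by simp

lemma \<phi>_power_p: "\<phi> ((t :: 'a) ^ p) = \<phi> t"
  by (simp add: \<phi>_def field_trace_power_p)

lemma \<phi>_minus: "\<phi> (- t :: 'a) = inverse (\<phi> t)"
  using \<phi>_add[of t "- t"] by (simp add: inverse_unique)

lemma \<phi>_eq_1_imp: 
  assumes "\<phi> (t :: 'a) = 1"
  shows "field_trace t = 0"
proof -
  obtain n where n: "n < p" "of_nat n = field_trace t" using field_trace_of_nat by blast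
  have "inj_on (\<lambda>k. cis (2 * pi * real k / real p)) {..<p}"
    using bij_betw_roots_unity[OF prime_gt_0_nat[OF p]] by (simp add: bij_betw_def)
  moreover have "cis (2 * pi * real n / real p) = cis (2 * pi * real 0 / real p)"
    using \<phi>_eq_cis[OF n(2)] assms by simp
  ultimately have "n = 0" using n(1) by (auto simp: inj_on_def)
  then show ?thesis using n(2) by simp
qed

lemma \<phi>_trivial_iff: "(\<forall>s. \<phi> (a * s :: 'a) = 1) \<longleftrightarrow> a = 0"
proof
  assume a: "\<forall>s. \<phi> (a * s) = 1"
  show "a = 0"
  proof (rule ccontr)
    assume "a \<noteq> 0"
    obtain t :: 'a where "field_trace t \<noteq> 0" using field_trace_nontrivial by blast
    then have "\<phi> (a * (t / a)) \<noteq> 1" using \<phi>_eq_1_imp \<open>a \<noteq> 0\<close> by auto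
    then show False using a by blast
  qed
qed simp

text \<open>The comparisons of coefficients in the compatibility lemmas all rest on this consequence
  of the nontriviality of the trace.\<close>

lemma \<phi>_inj:
  assumes "\<And>s. \<phi> (a * s :: 'a) = \<phi> (b * s)"
  shows "a = b"
proof -
  have "\<phi> ((a - b) * s) = 1" for s
    using assms[of s] \<phi>_add[of "a * s" "- (b * s)"] by (simp add: \<phi>_minus left_diff_distrib)
  then show ?thesis using \<phi>_trivial_iff[of "a - b"] by simp
qed

text \<open>Writing \<open>b = c\<^sup>p\<close>, invariance of \<open>\<phi>\<close> under the Frobenius map turns \<open>\<phi> (b s\<^sup>p)\<close> into \<open>\<phi> (c s)\<close>.\<close>

lemma \<phi>_linearized_trivial_iff: "(\<forall>s. \<phi> (a * s + b * s ^ p :: 'a) = 1) \<longleftrightarrow> a ^ p + b = 0"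
proof -
  obtain c where c: "c ^ p = b" using power_p_surj by blast
  have "\<phi> (a * s + b * s ^ p) = \<phi> ((a + c) * s)" for s
    using \<phi>_power_p[of "c * s"] by (simp add: \<phi>_add distrib_right power_mult_distrib c)
  then have "(\<forall>s. \<phi> (a * s + b * s ^ p) = 1) \<longleftrightarrow> a + c = 0"
    using \<phi>_trivial_iff[of "a + c"] by simp
  also have "\<dots> \<longleftrightarrow> (a + c) ^ p = 0" using prime_gt_0_nat[OF p] by simp
  finally show ?thesis by (simp add: power_p_add c)
qed

lemma root_of_unity_mod:
  assumes "(\<epsilon> :: complex) ^ p = 1" "(of_nat j :: 'a) = of_nat k"
  shows "\<epsilon> ^ j = \<epsilon> ^ k"
proof -
  have "\<epsilon> ^ n = \<epsilon> ^ (n mod p)" for n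
  proof -
    have "\<epsilon> ^ (p * (n div p) + n mod p) = \<epsilon> ^ (n mod p)"
      by (simp only: power_add power_mult assms(1)) simp
    then show ?thesis by simp
  qed
  moreover have "j mod p = k mod p" using assms(2) by (simp add: of_nat_eq_iff_cong_CHAR cong_def CHAR_eq)
  ultimately show ?thesis by metis
qed

text \<open>The field is the direct sum of the prime multiples of \<open>v\<close> and of
  \<open>A\<close>. In s = j v + a the exponent j is determined modulo p, so s \<mapsto>
  \<epsilon>^j is a well defined character.\<close>

lemma exists_complement_character:
  fixes A :: "'a set" and v :: 'a and \<epsilon> :: complex
  assumes A: "0 \<in> A" "\<And>a b. a \<in> A \<Longrightarrow> b \<in> A \<Longrightarrow> a + b \<in> A" "\<And>a. a \<in> A \<Longrightarrow> - a \<in> A"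
    and dvd: "\<And>j. j < p \<Longrightarrow> of_nat j * v \<in> A \<Longrightarrow> j = 0"
    and sum: "\<And>s. \<exists>j. s - of_nat j * v \<in> A"
    and eps: "\<epsilon> ^ p = 1"
  shows "\<exists>\<eta>. (\<forall>s t. \<eta> (s + t) = \<eta> s * \<eta> t) \<and> \<eta> v = \<epsilon> \<and> (\<forall>a\<in>A. \<eta> a = 1)"
proof -
  define \<eta> where "\<eta> s = \<epsilon> ^ (SOME j. s - of_nat j * v \<in> A)" for s
  have eta: "\<eta> s = \<epsilon> ^ k" if k: "s - of_nat k * v \<in> A" for s k
  proof -
    define j where "j = (SOME j. s - of_nat j * v \<in> A)"
    have j: "s - of_nat j * v \<in> A" unfolding j_def by (rule someI_ex[OF sum])
    have p0: "p > 0" using prime_gt_0_nat[OF p] .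
    have *: "(of_nat j :: 'a) = of_nat k"
    proof -
      \<comment> \<open>A natural number below p that represents j - k in the field; adding
        \<open>p - k mod p\<close> avoids truncated subtraction.\<close>
      define i where "i = (j + (p - k mod p)) mod p"
      have kp: "k mod p < p" using p0 by simp
      have "(of_nat i :: 'a) = of_nat (j + (p - k mod p))"
        unfolding of_nat_eq_iff_cong_CHAR by (simp add: i_def CHAR_eq)
      also have "\<dots> = of_nat j - of_nat (k mod p)"
        using kp by (simp add: of_nat_diff less_imp_le flip: CHAR_eq)
      also have "(of_nat (k mod p) :: 'a) = of_nat k" by (simp add: of_nat_eq_iff_cong_CHAR CHAR_eq)
      finally have i: "(of_nat i :: 'a) = of_nat j - of_nat k" .
      have "(s - of_nat k * v) + - (s - of_nat j * v) \<in> A" using k j A by blast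
      then have "of_nat i * v \<in> A" by (simp add: i left_diff_distrib)
      then have "i = 0" using dvd[of i] p0 by (simp add: i_def)
      then show ?thesis using i by simp
    qed
    show ?thesis unfolding \<eta>_def j_def[symmetric] by (rule root_of_unity_mod[OF eps *])
  qed
  have "\<eta> (s + t) = \<eta> s * \<eta> t" for s t
  proof -
    obtain j k where jk: "s - of_nat j * v \<in> A" "t - of_nat k * v \<in> A" using sum by metis
    have "(s - of_nat j * v) + (t - of_nat k * v) \<in> A" using A(2) jk by blast
    then have "s + t - of_nat (j + k) * v \<in> A" by (simp add: algebra_simps)
    from eta[OF this] show ?thesis by (simp add: eta[OF jk(1)] eta[OF jk(2)] power_add)
  qed
  moreover have "\<eta> v = \<epsilon>" using eta[of v 1] A(1) by simp
  moreover have "\<eta> a = 1" if "a \<in> A" for a using eta[of a 0] that by simp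
  ultimately show ?thesis by blast
qed

end

section \<open>Coordinates\<close>

abbreviation tuple_mult :: "'a::comm_ring_1 tuple6 \<Rightarrow> 'a tuple6 \<Rightarrow> 'a tuple6"  (infixl "\<odot>" 70) where
  "a \<odot> b \<equiv> a \<otimes>\<^bsub>G2_tuples\<^esub> b"

lemma (in group) inv_cancel_left:
  assumes "g \<in> carrier G" "z \<in> carrier G"
  shows "g \<otimes> (inv g \<otimes> z) = z" "inv g \<otimes> (g \<otimes> z) = z"
  using assms by (simp_all add: m_assoc[symmetric])

text \<open>Left multiplication by \<open>a\<close> maps the finite set \<open>H\<close> injectively
  into itself, hence onto; this puts the unit and the inverse of \<open>a\<close> into
  \<open>H\<close>.\<close>

lemma (in group) finite_closed_imp_subgroup:
  assumes "finite (carrier G)" "H \<subseteq> carrier G" "H \<noteq> {}"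
    and closed: "\<And>a b. a \<in> H \<Longrightarrow> b \<in> H \<Longrightarrow> a \<otimes> b \<in> H"
  shows "subgroup H G"
proof (rule subgroupI)
  fix a assume a: "a \<in> H"
  then have ac: "a \<in> carrier G" using assms(2) by blast
  have inj: "inj_on (\<lambda>b. a \<otimes> b) H"
    using ac assms(2) by (intro inj_onI) (metis Units_eq Units_l_cancel subsetD)
  have "(\<lambda>b. a \<otimes> b) ` H \<subseteq> H" using closed[OF a] by blast
  then have img: "(\<lambda>b. a \<otimes> b) ` H = H"
    using inj finite_subset[OF assms(2,1)] by (simp add: card_image card_subset_eq)
  then obtain e where e: "e \<in> H" "a = a \<otimes> e" using a by blast
  have "e = \<one>" using l_cancel_one'[OF ac subsetD[OF assms(2) e(1)]] e(2) by simp
  then obtain c where c: "c \<in> H" "\<one> = a \<otimes> c" using img e(1) by blast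
  have "c = inv a \<otimes> (a \<otimes> c)" using inv_cancel_left(2)[OF ac, of c] subsetD[OF assms(2) c(1)] by simp
  also have "\<dots> = inv a" using ac by (simp flip: c(2))
  finally show "inv a \<in> H" using c(1) by simp
qed (use assms in auto)

declare One_nat_def [simp del]

section \<open>Collecting products of root elements\<close>

context G2_unipotent
begin

lemma x_closed' [simp]:
  "x 1 t \<in> carrier G" "x 2 t \<in> carrier G" "x 3 t \<in> carrier G"
  "x 4 t \<in> carrier G" "x 5 t \<in> carrier G" "x 6 t \<in> carrier G"
  using x_closed by auto

lemma x_add_left: "i \<in> {1..6} \<Longrightarrow> z \<in> carrier G \<Longrightarrow> x i s \<otimes> (x i t \<otimes> z) = x i (s + t) \<otimes> z"
  by (simp add: x_closed x_add m_assoc[symmetric])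

lemma x_zero: "i \<in> {1..6} \<Longrightarrow> x i 0 = \<one>"
  using x_add[of i 0 0] x_closed[of i 0] by (metis add_0 l_cancel_one)

text \<open>From g h = h g c one gets h g = g h c^-1. The inverse enters as an explicit
  \<open>d\<close>, so that in the applications the result is again a product of root
  elements.\<close>

lemma commutator_swap:
  assumes "commutator G g h = c" "c \<otimes> d = \<one>" "g \<in> carrier G" "h \<in> carrier G" "d \<in> carrier G"
  shows "h \<otimes> g = g \<otimes> (h \<otimes> d)"
proof -
  have c: "c \<in> carrier G" using assms(1,3,4) by (auto simp: commutator_def)
  have hgc: "h \<otimes> g \<otimes> c = g \<otimes> h"
    using assms(3,4) by (simp add: assms(1)[symmetric] commutator_def m_assoc inv_cancel_left)
  have "h \<otimes> g = h \<otimes> g \<otimes> (c \<otimes> d)" using assms(2-4) by simp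
  also have "\<dots> = h \<otimes> g \<otimes> c \<otimes> d" using assms(3-5) c by (simp only: m_assoc m_closed)
  also have "\<dots> = g \<otimes> (h \<otimes> d)" using assms(3-5) by (simp only: hgc m_assoc)
  finally show ?thesis .
qed

lemma swap_trivial:
  assumes "1 \<le> i" "i < j" "j \<le> 6" "(i, j) \<notin> {(1,2), (2,3), (2,4), (1,5), (3,4)}"
  shows "x j t \<otimes> x i s = x i s \<otimes> x j t"
  using commutator_swap[OF comm_trivial[OF assms], of \<one> s t] assms x_closed[of i s] x_closed[of j t]
  by auto

lemma swap_trivial_left:
  assumes "1 \<le> i" "i < j" "j \<le> 6" "(i, j) \<notin> {(1,2), (2,3), (2,4), (1,5), (3,4)}" "z \<in> carrier G"
  shows "x j t \<otimes> (x i s \<otimes> z) = x i s \<otimes> (x j t \<otimes> z)"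
  using swap_trivial[OF assms(1-4), of t s] assms x_closed[of i s] x_closed[of j t]
  by (simp add: m_assoc[symmetric])

lemmas swaps =
  swap_trivial[of 1 3, simplified] swap_trivial[of 1 4, simplified] swap_trivial[of 1 6, simplified]
  swap_trivial[of 2 5, simplified] swap_trivial[of 2 6, simplified] swap_trivial[of 3 5, simplified]
  swap_trivial[of 3 6, simplified] swap_trivial[of 4 5, simplified] swap_trivial[of 4 6, simplified]
  swap_trivial[of 5 6, simplified]

lemmas swaps_left =
  swap_trivial_left[of 1 3, simplified] swap_trivial_left[of 1 4, simplified]
  swap_trivial_left[of 1 6, simplified] swap_trivial_left[of 2 5, simplified]
  swap_trivial_left[of 2 6, simplified] swap_trivial_left[of 3 5, simplified]
  swap_trivial_left[of 3 6, simplified] swap_trivial_left[of 4 5, simplified]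
  swap_trivial_left[of 4 6, simplified] swap_trivial_left[of 5 6, simplified]

lemmas collect_add =
  x_add[of 1, simplified] x_add[of 2, simplified] x_add[of 3, simplified]
  x_add[of 4, simplified] x_add[of 5, simplified] x_add[of 6, simplified]
  x_add_left[of 1, simplified] x_add_left[of 2, simplified] x_add_left[of 3, simplified]
  x_add_left[of 4, simplified] x_add_left[of 5, simplified] x_add_left[of 6, simplified]

lemmas x_zeros =
  x_zero[of 1, simplified] x_zero[of 2, simplified] x_zero[of 3, simplified]
  x_zero[of 4, simplified] x_zero[of 5, simplified] x_zero[of 6, simplified]

text \<open>A swap rule in front of a tail \<open>z\<close>, the form in which it is applied inside
  a longer right-nested product.\<close>

lemma left_extend:
  assumes "a \<otimes> b = b \<otimes> (a \<otimes> c)" "a \<in> carrier G" "b \<in> carrier G" "c \<in> carrier G" "z \<in> carrier G"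
  shows "a \<otimes> (b \<otimes> z) = b \<otimes> (a \<otimes> (c \<otimes> z))"
proof -
  have "a \<otimes> (b \<otimes> z) = a \<otimes> b \<otimes> z" using assms(2-) by (simp add: m_assoc)
  also have "\<dots> = b \<otimes> (a \<otimes> c) \<otimes> z" by (simp only: assms(1))
  also have "\<dots> = b \<otimes> (a \<otimes> (c \<otimes> z))" using assms(2-) by (simp add: m_assoc)
  finally show ?thesis .
qed

lemma swap_3_4: "x 4 t \<otimes> x 3 s = x 3 s \<otimes> (x 4 t \<otimes> x 6 (3 * s * t))"
  by (rule commutator_swap[OF comm_3_4]) (simp_all add: collect_add x_zeros)

lemma swap_1_5: "x 5 t \<otimes> x 1 s = x 1 s \<otimes> (x 5 t \<otimes> x 6 (- (s * t)))"
  by (rule commutator_swap[OF comm_1_5]) (simp_all add: collect_add x_zeros)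

lemma swap_2_4: "x 4 t \<otimes> x 2 s = x 2 s \<otimes> (x 4 t \<otimes> x 5 (- (3 * s * t)))"
  by (rule commutator_swap[OF comm_2_4]) (simp_all add: collect_add x_zeros)

lemma swap_2_3: "x 3 t \<otimes> x 2 s
    = x 2 s \<otimes> (x 3 t \<otimes> (x 4 (- (2 * s * t)) \<otimes> (x 5 (3 * s\<^sup>2 * t) \<otimes> x 6 (- (3 * s * t\<^sup>2)))))"
  by (rule commutator_swap[OF comm_2_3]) (simp_all add: m_assoc swaps swaps_left collect_add x_zeros)

text \<open>Inverting the commutator moves an \<open>x 3\<close> past an \<open>x 4\<close>, which
  costs 3 s^2 t^3 in the last coordinate. The coefficient there is therefore s^2 t^3 - 3 s^2 t^3 =
  -2 s^2 t^3.\<close>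

lemma swap_1_2: "x 2 t \<otimes> x 1 s
    = x 1 s \<otimes> (x 2 t \<otimes> (x 3 (s * t) \<otimes> (x 4 (- (s * t\<^sup>2)) \<otimes>
        (x 5 (s * t ^ 3) \<otimes> x 6 (- (2 * s\<^sup>2 * t ^ 3))))))"
proof (rule commutator_swap[OF comm_1_2])
  show "x 3 (- (s * t)) \<otimes> x 4 (s * t\<^sup>2) \<otimes> x 5 (- (s * t ^ 3)) \<otimes> x 6 (- (s\<^sup>2 * t ^ 3)) \<otimes>
      (x 3 (s * t) \<otimes> (x 4 (- (s * t\<^sup>2)) \<otimes> (x 5 (s * t ^ 3) \<otimes> x 6 (- (2 * s\<^sup>2 * t ^ 3))))) = \<one>"
    by (simp add: m_assoc swaps swaps_left swap_3_4 left_extend[OF swap_3_4] collect_add x_zeros)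
       (simp add: algebra_simps power2_eq_square power3_eq_cube x_zeros)
qed simp_all

fun coord :: "'a tuple6 \<Rightarrow> 'g" where
  "coord (a1, a2, a3, a4, a5, a6) = x 1 a1 \<otimes> (x 2 a2 \<otimes> (x 3 a3 \<otimes> (x 4 a4 \<otimes> (x 5 a5 \<otimes> x 6 a6))))"

lemma coord_closed [simp]: "coord a \<in> carrier G"
  by (cases a) simp

text \<open>Rewriting with these rules sorts a product: each swap moves the smaller index to the
  left and creates only root elements of index larger than both.\<close>

lemmas collect = m_assoc swaps swaps_left collect_add swap_3_4 left_extend[OF swap_3_4]
  swap_1_5 left_extend[OF swap_1_5] swap_2_4 left_extend[OF swap_2_4]
  swap_2_3 left_extend[OF swap_2_3] swap_1_2 left_extend[OF swap_1_2]

lemma coord_mult_root: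
  "coord (a \<odot> (0, 0, 0, 0, 0, t)) = coord a \<otimes> x 6 t"
  "coord (a \<odot> (0, 0, 0, 0, t, 0)) = coord a \<otimes> x 5 t"
  "coord (a \<odot> (0, 0, 0, t, 0, 0)) = coord a \<otimes> x 4 t"
  "coord (a \<odot> (0, 0, t, 0, 0, 0)) = coord a \<otimes> x 3 t"
  "coord (a \<odot> (0, t, 0, 0, 0, 0)) = coord a \<otimes> x 2 t"
  "coord (a \<odot> (t, 0, 0, 0, 0, 0)) = coord a \<otimes> x 1 t"
proof -
  obtain a1 a2 a3 a4 a5 a6 where a: "a = (a1, a2, a3, a4, a5, a6)" by (cases a)
  show "coord (a \<odot> (0, 0, 0, 0, 0, t)) = coord a \<otimes> x 6 t"
    "coord (a \<odot> (0, 0, 0, 0, t, 0)) = coord a \<otimes> x 5 t"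
    "coord (a \<odot> (0, 0, 0, t, 0, 0)) = coord a \<otimes> x 4 t"
    "coord (a \<odot> (0, 0, t, 0, 0, 0)) = coord a \<otimes> x 3 t"
    by (simp_all add: a G2_tuples_def collect ac_simps)
  show "coord (a \<odot> (0, t, 0, 0, 0, 0)) = coord a \<otimes> x 2 t"
    by (simp add: a G2_tuples_def collect) (simp add: algebra_simps power2_eq_square)
  show "coord (a \<odot> (t, 0, 0, 0, 0, 0)) = coord a \<otimes> x 1 t"
    by (simp add: a G2_tuples_def collect) (simp add: algebra_simps power2_eq_square power3_eq_cube)
qed

text \<open>A tuple is the product of its six root tuples, so right multiplication by root elements
  suffices. From here on calculations in \<open>G\<close> are polynomial identities in six
  coordinates.\<close>

lemma coord_mult: "coord (a \<odot> b) = coord a \<otimes> coord b"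
proof -
  interpret T: group "G2_tuples :: 'a tuple6 monoid" by (rule G2_tuples_group)
  have [simp]: "u \<in> carrier G2_tuples" for u :: "'a tuple6" by (simp add: G2_tuples_def)
  obtain b1 b2 b3 b4 b5 b6 where b: "b = (b1, b2, b3, b4, b5, b6)" by (cases b)
  have "b = (b1,0,0,0,0,0) \<odot> (0,b2,0,0,0,0) \<odot> (0,0,b3,0,0,0) \<odot> (0,0,0,b4,0,0) \<odot> (0,0,0,0,b5,0) \<odot> (0,0,0,0,0,b6)"
    by (simp add: b G2_tuples_def)
  then have "a \<odot> b = a \<odot> (b1,0,0,0,0,0) \<odot> (0,b2,0,0,0,0) \<odot> (0,0,b3,0,0,0) \<odot> (0,0,0,b4,0,0)
      \<odot> (0,0,0,0,b5,0) \<odot> (0,0,0,0,0,b6)"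
    by (simp only: T.m_assoc[symmetric] \<open>\<And>u. u \<in> carrier G2_tuples\<close> T.m_closed)
  then have "coord (a \<odot> b) = coord a \<otimes> x 1 b1 \<otimes> x 2 b2 \<otimes> x 3 b3 \<otimes> x 4 b4 \<otimes> x 5 b5 \<otimes> x 6 b6"
    by (simp only: coord_mult_root)
  then show ?thesis by (simp add: b m_assoc)
qed

lemma root_prod_eq_coord:
  assumes "I \<subseteq> {1..6}"
  shows "root_prod G x I t = coord (if 1 \<in> I then t 1 else 0, if 2 \<in> I then t 2 else 0,
    if 3 \<in> I then t 3 else 0, if 4 \<in> I then t 4 else 0, if 5 \<in> I then t 5 else 0, if 6 \<in> I then t 6 else 0)"
proof -
  have "sorted_list_of_set I = filter (\<lambda>i. i \<in> I) [1, 2, 3, 4, 5, 6]"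
  proof (rule sorted_distinct_set_unique)
    show "set (sorted_list_of_set I) = set (filter (\<lambda>i. i \<in> I) [1, 2, 3, 4, 5, 6])"
    proof -
      have "finite I" using assms finite_subset by blast
      moreover have "set [1, 2, 3, 4, 5, 6] = {1..6::nat}" by auto
      ultimately show ?thesis using assms by (simp only: set_filter set_sorted_list_of_set) blast
    qed
  qed auto
  then show ?thesis
    by (simp add: root_prod_def x_zeros)
qed

declare coord.simps [simp del]

lemma bij_coord: "bij_betw coord UNIV (carrier G)"
proof -
  let ?f = "\<lambda>t :: nat \<Rightarrow> 'a. (t 1, t 2, t 3, t 4, t 5, t 6)"
  have b: "bij_betw (coord \<circ> ?f) ({1..6} \<rightarrow>\<^sub>E UNIV) (carrier G)"
  proof -
    have "root_prod G x {1..6} = coord \<circ> ?f"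
      by (rule ext) (simp add: root_prod_eq_coord)
    then show ?thesis using unique_product by simp
  qed
  have s: "?f ` ({1..6} \<rightarrow>\<^sub>E UNIV) = UNIV"
  proof -
    have "y \<in> ?f ` ({1..6} \<rightarrow>\<^sub>E UNIV)" for y
    proof -
      obtain a1 a2 a3 a4 a5 a6 where y: "y = (a1,a2,a3,a4,a5,a6)" by (cases y)
      show ?thesis
        by (rule image_eqI[of _ _ "\<lambda>i\<in>{1..6}. [a1,a2,a3,a4,a5,a6] ! (i - 1)"]) (auto simp: y)
    qed
    then show ?thesis by blast
  qed
  have "inj_on coord (?f ` ({1..6} \<rightarrow>\<^sub>E UNIV))"
    using b by (intro inj_on_imageI) (simp add: bij_betw_def)
  moreover have "coord ` (?f ` ({1..6} \<rightarrow>\<^sub>E UNIV)) = carrier G"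
    using b by (simp add: bij_betw_def image_comp)
  ultimately show ?thesis by (simp add: bij_betw_def s)
qed

lemma coord_eq_iff [simp]: "coord a = coord b \<longleftrightarrow> a = b"
  using bij_coord by (simp add: bij_betw_def inj_eq)

lemma coord_surj:
  assumes "g \<in> carrier G"
  obtains a where "g = coord a"
  using assms bij_coord by (metis bij_betw_imp_surj_on imageE)

lemma finite_carrier: "finite (carrier G)"
  using bij_betw_finite[OF bij_coord] by simp

lemma card_carrier: "card (carrier G) = CARD('a) ^ 6"
proof -
  have "CARD('a) ^ 6 = CARD('a) * (CARD('a) * (CARD('a) * (CARD('a) * (CARD('a) * CARD('a)))))"
    by (simp add: numeral_eq_Suc One_nat_def)
  then show ?thesis using bij_betw_same_card[OF bij_coord] by simp
qed

definition push :: "('a tuple6 \<Rightarrow> complex) \<Rightarrow> 'g \<Rightarrow> complex" where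
  "push \<mu> g = (if g \<in> carrier G then \<mu> (the_inv_into UNIV coord g) else 0)"

lemma push_coord [simp]: "push \<mu> (coord a) = \<mu> a"
  using bij_coord by (simp add: push_def the_inv_into_f_f bij_betw_def)

text \<open>Coordinate form of \<open>linear_character\<close>. Closure under products makes
  \<open>H\<close> a subgroup because the group is finite.\<close>

definition tuple_linear :: "'a tuple6 set \<Rightarrow> ('a tuple6 \<Rightarrow> complex) \<Rightarrow> bool" where
  "tuple_linear H \<mu> \<longleftrightarrow> H \<noteq> {} \<and> (\<forall>a. a \<notin> H \<longrightarrow> \<mu> a = 0) \<and> (\<forall>a\<in>H. \<mu> a \<noteq> 0) \<and>
     (\<forall>a\<in>H. \<forall>b\<in>H. a \<odot> b \<in> H \<and> \<mu> (a \<odot> b) = \<mu> a * \<mu> b)"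

lemma linear_character_push:
  assumes "tuple_linear H \<mu>"
  shows "linear_character G (coord ` H) (push \<mu>)"
proof -
  have "subgroup (coord ` H) G"
  proof (rule finite_closed_imp_subgroup[OF finite_carrier])
    show "coord ` H \<noteq> {}" using assms by (simp add: tuple_linear_def)
    fix g h assume "g \<in> coord ` H" "h \<in> coord ` H"
    then obtain a b where ab: "a \<in> H" "b \<in> H" "g = coord a" "h = coord b" by blast
    then have "a \<odot> b \<in> H" using assms by (simp add: tuple_linear_def)
    then show "g \<otimes> h \<in> coord ` H" using ab by (simp flip: coord_mult)
  qed auto
  moreover have "push \<mu> g = 0" if "g \<notin> coord ` H" for g
  proof (cases "g \<in> carrier G")
    case True
    then obtain a where a: "g = coord a" by (rule coord_surj)
    then have "a \<notin> H" using that by blast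
    then show ?thesis using a assms unfolding tuple_linear_def by (metis push_coord)
  qed (simp add: push_def)
  ultimately show ?thesis
    using assms by (auto simp: linear_character_iff tuple_linear_def simp flip: coord_mult)
qed

lemma Irr_bij_tuples:
  assumes finL: "finite L" and lin: "\<And>l. l \<in> L \<Longrightarrow> tuple_linear (H l) (\<mu> l)"
    and compat: "\<And>l m y. \<lbrakk>l \<in> L; m \<in> L;
        \<And>h h'. \<lbrakk>h \<in> H l; h' \<in> H m; h \<odot> y = y \<odot> h'\<rbrakk> \<Longrightarrow> \<mu> l h = \<mu> m h'\<rbrakk> \<Longrightarrow> l = m \<and> y \<in> H l"
    and sum_sq: "(\<Sum>l\<in>L. (real CARD('a) ^ 6 / real (card (H l)))\<^sup>2) = real CARD('a) ^ 6"
  shows "bij_betw (\<lambda>l. induced G (coord ` H l) (push (\<mu> l))) L (Irr G)"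
proof (rule Irr_bij_induced[OF finite_carrier finL])
  show "linear_character G (coord ` H l) (push (\<mu> l))" if "l \<in> L" for l
    using linear_character_push[OF lin[OF that]] .
  have "card (coord ` A) = card A" for A
    using bij_coord by (intro card_image) (auto simp: bij_betw_def intro: inj_on_subset)
  then show "(\<Sum>l\<in>L. (real (card (carrier G)) / real (card (coord ` H l)))\<^sup>2) = real (card (carrier G))"
    using sum_sq by (simp add: card_carrier)
  fix l m g
  assume lm: "l \<in> L" "m \<in> L" and g: "g \<in> carrier G"
    and c: "\<And>h h'. h \<in> coord ` H l \<Longrightarrow> h' \<in> coord ` H m \<Longrightarrow> h \<otimes> g = g \<otimes> h' \<Longrightarrow> push (\<mu> l) h = push (\<mu> m) h'"
  obtain y where y: "g = coord y" using g by (rule coord_surj)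
  have "\<mu> l h = \<mu> m h'" if "h \<in> H l" "h' \<in> H m" "h \<odot> y = y \<odot> h'" for h h'
    using c[of "coord h" "coord h'"] that by (simp add: y flip: coord_mult)
  then show "l = m \<and> g \<in> coord ` H l"
    using compat[OF lm] y by blast
qed

lemma induced_push_one:
  assumes "tuple_linear H \<mu>"
  shows "induced G (coord ` H) (push \<mu>) \<one> = of_nat (CARD('a) ^ 6) / of_nat (card H)"
proof -
  have "card (coord ` H) = card H"
    using bij_coord by (intro card_image) (auto simp: bij_betw_def intro: inj_on_subset)
  then show ?thesis
    using induced_one[OF linear_character_push[OF assms]] by (simp add: card_carrier)
qed

end

text \<open>\<open>F\<close> stands for the degree. Pairwise disjointness of the rows, expressed by
  \<open>sorted_wrt\<close>, lets both sums over all labels be taken row by row.\<close>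

lemma table_sums:
  fixes tab :: "('l set \<times> real \<times> real) list" and F :: "'l \<Rightarrow> real"
  assumes "sorted_wrt (\<lambda>r s. fst r \<inter> fst s = {}) tab"
    and "\<And>L n d. (L, n, d) \<in> set tab \<Longrightarrow> finite L \<and> real (card L) = n \<and> (\<forall>l\<in>L. F l = d)"
  shows "finite (\<Union>(L, n, d)\<in>set tab. L) \<and>
    (\<Sum>l\<in>(\<Union>(L, n, d)\<in>set tab. L). (F l)\<^sup>2) = (\<Sum>(L, n, d)\<leftarrow>tab. n * d\<^sup>2) \<and>
    real (card (\<Union>(L, n, d)\<in>set tab. L)) = (\<Sum>(L, n, d)\<leftarrow>tab. n)"
  using assms
proof (induction tab)
  case (Cons row tab)
  obtain L n d where row: "row = (L, n, d)" by (cases row)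
  define U where "U = (\<Union>(L, n, d)\<in>set tab. L)"
  have IH0: "finite U \<and> (\<Sum>l\<in>U. (F l)\<^sup>2) = (\<Sum>(L, n, d)\<leftarrow>tab. n * d\<^sup>2) \<and>
      real (card U) = (\<Sum>(L, n, d)\<leftarrow>tab. n)"
  unfolding U_def
  proof (rule Cons.IH)
    show "sorted_wrt (\<lambda>r s. fst r \<inter> fst s = {}) tab" using Cons.prems(1) by simp
    show "finite L \<and> real (card L) = n \<and> (\<forall>l\<in>L. F l = d)" if "(L, n, d) \<in> set tab" for L n d
      by (rule Cons.prems(2)) (use that in simp)
  qed
  note IH = IH0[THEN conjunct1] IH0[THEN conjunct2, THEN conjunct1] IH0[THEN conjunct2, THEN conjunct2]
  have L: "finite L" "real (card L) = n" "\<forall>l\<in>L. F l = d"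
    using Cons.prems(2)[of L n d] by (simp_all add: row)
  have disj: "L \<inter> U = {}" using Cons.prems(1) by (fastforce simp: row U_def)
  have "(\<Sum>l\<in>L. (F l)\<^sup>2) = n * d\<^sup>2" using L by simp
  moreover have "(\<Union>(L, n, d)\<in>set (row # tab). L) = L \<union> U" by (simp add: row U_def)
  ultimately show ?case
    using sum.union_disjoint[OF L(1) IH(1) disj, of "\<lambda>l. (F l)\<^sup>2"]
      card_Un_disjoint[OF L(1) IH(1) disj] IH L
    by (simp only:) (simp add: row)
qed simp

locale G2_prime_power = G2_unipotent G x + prime_power_field p f "TYPE('a)"
  for G :: "('g, 'b) monoid_scheme" (structure) and x :: "nat \<Rightarrow> 'a::{field,finite} \<Rightarrow> 'g" and p f
begin

text \<open>The last conclusion admits any labelling \<chi> that agrees with the inductions. It is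
  kept apart because for p = 2 two families are defined by uniqueness in \<open>Irr G\<close>, and
  the agreement can be proved only once the bijection is available.\<close>

lemma Irr_tableI:
  fixes tab :: "('l set \<times> real \<times> real) list"
  assumes disj: "sorted_wrt (\<lambda>r s. fst r \<inter> fst s = {}) tab"
    and rows: "\<And>L n d. (L, n, d) \<in> set tab \<Longrightarrow> finite L \<and> real (card L) = n \<and>
      (\<forall>l\<in>L. tuple_linear (H l) (\<mu> l) \<and> real CARD('a) ^ 6 = d * real (card (H l)))"
    and compat: "\<And>l m y. \<lbrakk>l \<in> (\<Union>(L, n, d)\<in>set tab. L); m \<in> (\<Union>(L, n, d)\<in>set tab. L);
        \<And>h h'. \<lbrakk>h \<in> H l; h' \<in> H m; h \<odot> y = y \<odot> h'\<rbrakk> \<Longrightarrow> \<mu> l h = \<mu> m h'\<rbrakk> \<Longrightarrow> l = m \<and> y \<in> H l"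
    and total: "(\<Sum>(L, n, d)\<leftarrow>tab. n * d\<^sup>2) = real CARD('a) ^ 6"
  shows "bij_betw (\<lambda>l. induced G (coord ` H l) (push (\<mu> l))) (\<Union>(L, n, d)\<in>set tab. L) (Irr G) \<and>
    real (card (Irr G)) = (\<Sum>(L, n, d)\<leftarrow>tab. n) \<and>
    (\<forall>\<chi>. (\<forall>l\<in>(\<Union>(L, n, d)\<in>set tab. L). \<chi> l = induced G (coord ` H l) (push (\<mu> l))) \<longrightarrow> Irr_table G \<chi> tab)"
proof -
  let ?U = "\<Union>(L, n, d)\<in>set tab. L"
  have lin: "tuple_linear (H l) (\<mu> l)" if "l \<in> ?U" for l using rows that by fastforce
  have q0: "real CARD('a) ^ 6 \<noteq> 0" by simp
  have deg: "real CARD('a) ^ 6 / real (card (H l)) = d" if "(L, n, d) \<in> set tab" "l \<in> L" for L n d l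
  proof -
    have "real CARD('a) ^ 6 = d * real (card (H l))" using rows[OF that(1)] that(2) by blast
    then show ?thesis using q0 by (metis mult_eq_0_iff nonzero_mult_div_cancel_right)
  qed
  have sums: "finite ?U \<and> (\<Sum>l\<in>?U. (real CARD('a) ^ 6 / real (card (H l)))\<^sup>2) = (\<Sum>(L, n, d)\<leftarrow>tab. n * d\<^sup>2) \<and>
      real (card ?U) = (\<Sum>(L, n, d)\<leftarrow>tab. n)"
    by (rule table_sums[OF disj]) (use rows deg in blast)
  have bij: "bij_betw (\<lambda>l. induced G (coord ` H l) (push (\<mu> l))) ?U (Irr G)"
  proof (rule Irr_bij_tuples)
    show "finite ?U" using sums by blast
    show "tuple_linear (H l) (\<mu> l)" if "l \<in> ?U" for l by (rule lin[OF that])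
    show "l = m \<and> y \<in> H l" if "l \<in> ?U" "m \<in> ?U"
      "\<And>h h'. \<lbrakk>h \<in> H l; h' \<in> H m; h \<odot> y = y \<odot> h'\<rbrakk> \<Longrightarrow> \<mu> l h = \<mu> m h'" for l m y
      by (rule compat[OF that])
    show "(\<Sum>l\<in>?U. (real CARD('a) ^ 6 / real (card (H l)))\<^sup>2) = real CARD('a) ^ 6"
      using sums total by simp
  qed
  have card: "real (card (Irr G)) = (\<Sum>(L, n, d)\<leftarrow>tab. n)"
    using bij_betw_same_card[OF bij] sums by simp
  have "Irr_table G \<chi> tab" if chi: "\<forall>l\<in>?U. \<chi> l = induced G (coord ` H l) (push (\<mu> l))" for \<chi>
  proof -
    note eq = chi[rule_format]
    have bij\<chi>: "bij_betw \<chi> ?U (Irr G)"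
      by (rule iffD2[OF bij_betw_cong[OF eq] bij])
    have "real (card (\<chi> ` L)) = n \<and> (\<forall>l\<in>L. \<chi> l \<one> = complex_of_real d)"
      if row: "(L, n, d) \<in> set tab" for L n d
    proof
      have LU: "L \<subseteq> ?U" using row by fastforce
      then have "inj_on \<chi> L" using bij\<chi> by (auto simp: bij_betw_def intro: inj_on_subset)
      then show "real (card (\<chi> ` L)) = n" using rows[OF row] by (simp add: card_image)
      show "\<forall>l\<in>L. \<chi> l \<one> = complex_of_real d"
      proof
        fix l assume l: "l \<in> L"
        then have lU: "l \<in> ?U" using LU by blast
        have "\<chi> l \<one> = complex_of_real (real CARD('a) ^ 6 / real (card (H l)))"
          using eq[OF lU] induced_push_one[OF lin[OF lU]] by simp
        then show "\<chi> l \<one> = complex_of_real d" by (simp only: deg[OF row l])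
      qed
  qed
  then show "Irr_table G \<chi> tab" using bij\<chi> by (auto simp: Irr_table_def)
  qed
  then show ?thesis using bij card by blast
qed

section \<open>Coordinate subgroups, their linear characters and compatibility\<close>

fun dot :: "'a tuple6 \<Rightarrow> 'a tuple6 \<Rightarrow> 'a" where
  "dot (c1, c2, c3, c4, c5, c6) (t1, t2, t3, t4, t5, t6) = c1*t1 + c2*t2 + c3*t3 + c4*t4 + c5*t5 + c6*t6"

definition tchar :: "'a tuple6 set \<Rightarrow> 'a tuple6 \<Rightarrow> 'a tuple6 \<Rightarrow> complex" where
  "tchar S c t = (if t \<in> S then \<phi> (dot c t) else 0)"

definition S2456 :: "'a tuple6 set" where
  "S2456 = {(a1, a2, a3, a4, a5, a6). a1 = 0 \<and> a3 = 0}"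

definition S13456 :: "'a tuple6 set" where
  "S13456 = {(a1, a2, a3, a4, a5, a6). a2 = 0}"

definition S3456 :: "'a tuple6 set" where
  "S3456 = {(a1, a2, a3, a4, a5, a6). a1 = 0 \<and> a2 = 0}"

definition S6 :: "'a tuple6 set" where
  "S6 = {(a1, a2, a3, a4, a5, a6). a1 = 0 \<and> a2 = 0 \<and> a3 = 0 \<and> a4 = 0 \<and> a5 = 0}"

definition first_in :: "'a set \<Rightarrow> 'a tuple6 set" where
  "first_in C = {a. fst a \<in> C}"

abbreviation S23456 :: "'a tuple6 set" where
  "S23456 \<equiv> first_in {0}"

lemma mem_S [simp]:
  "(a1, a2, a3, a4, a5, a6) \<in> S2456 \<longleftrightarrow> a1 = 0 \<and> a3 = 0"
  "(a1, a2, a3, a4, a5, a6) \<in> S13456 \<longleftrightarrow> a2 = 0"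
  "(a1, a2, a3, a4, a5, a6) \<in> S3456 \<longleftrightarrow> a1 = 0 \<and> a2 = 0"
  "(a1, a2, a3, a4, a5, a6) \<in> S6 \<longleftrightarrow> a1 = 0 \<and> a2 = 0 \<and> a3 = 0 \<and> a4 = 0 \<and> a5 = 0"
  "(a1, a2, a3, a4, a5, a6) \<in> first_in C \<longleftrightarrow> a1 \<in> C"
  by (simp_all add: S2456_def S13456_def S3456_def S6_def first_in_def)

lemma card_S: "card S2456 = CARD('a) ^ 4" "card S13456 = CARD('a) ^ 5"
  "card S3456 = CARD('a) ^ 4" "card (UNIV :: 'a tuple6 set) = CARD('a) ^ 6"
  "card (first_in C) = card C * CARD('a) ^ 5"
proof -
  have e: "S2456 = {0 :: 'a} \<times> (UNIV :: 'a set) \<times> {0 :: 'a} \<times> (UNIV :: ('a \<times> 'a \<times> 'a) set)"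
    "S13456 = (UNIV :: 'a set) \<times> {0 :: 'a} \<times> (UNIV :: ('a \<times> 'a \<times> 'a \<times> 'a) set)"
    "S3456 = {0 :: 'a} \<times> {0 :: 'a} \<times> (UNIV :: ('a \<times> 'a \<times> 'a \<times> 'a) set)"
    "first_in C = C \<times> (UNIV :: ('a \<times> 'a \<times> 'a \<times> 'a \<times> 'a) set)"
    by (auto simp: first_in_def)
  show "card S2456 = CARD('a) ^ 4" "card S13456 = CARD('a) ^ 5"
    "card S3456 = CARD('a) ^ 4" "card (UNIV :: 'a tuple6 set) = CARD('a) ^ 6"
    "card (first_in C) = card C * CARD('a) ^ 5"
    unfolding e by (simp_all add: card_cartesian_product numeral_eq_Suc)
qed

lemma card_eq_degree:
  "real CARD('a) ^ 6 = real CARD('a) ^ 2 * real (card S2456)"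
  "real CARD('a) ^ 6 = real CARD('a) ^ 2 * real (card S3456)"
  "real CARD('a) ^ 6 = real CARD('a) * real (card S13456)"
  "real CARD('a) ^ 6 = real CARD('a) * real (card S23456)"
  "real CARD('a) ^ 6 = real (card (UNIV :: 'a tuple6 set))"
  by (simp_all add: card_S numeral_eq_Suc)

lemma S_subset: "S3456 \<subseteq> S13456" "S3456 \<subseteq> S23456" "S6 \<subseteq> S3456" "S6 \<subseteq> S2456" "S6 \<subseteq> S13456"
  by auto

lemma tuple_linear_tchar:
  assumes "(0, 0, 0, 0, 0, 0) \<in> S" "\<And>a b. a \<in> S \<Longrightarrow> b \<in> S \<Longrightarrow> a \<odot> b \<in> S \<and> dot c (a \<odot> b) = dot c a + dot c b"
  shows "tuple_linear S (tchar S c)"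
  using assms by (auto simp: tuple_linear_def tchar_def \<phi>_add)

text \<open>The nonlinear terms of the product law in coordinates 2 and 6 all contain coordinate 1
  or 3 of a factor. For \<open>S13456\<close> the nonlinear terms in coordinates 1 to 5 likewise
  contain coordinate 2 of a factor.\<close>

lemma linear_S2456: "tuple_linear S2456 (tchar S2456 (0, b2, 0, 0, 0, b6))"
  by (rule tuple_linear_tchar) (auto simp: G2_tuples_def algebra_simps)

lemma linear_S13456: "tuple_linear S13456 (tchar S13456 (b1, 0, b3, b4, b5, 0))"
  by (rule tuple_linear_tchar) (auto simp: G2_tuples_def algebra_simps)

lemma linear_UNIV: "tuple_linear UNIV (tchar UNIV (b1, b2, 0, 0, 0, 0))"
  by (rule tuple_linear_tchar) (auto simp: G2_tuples_def algebra_simps)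

text \<open>In the following lemmas \<open>h y = y h'\<close> is solved for \<open>h'\<close>, and the coefficients of the
  resulting additive character of the coordinates of \<open>h\<close> are compared.\<close>

lemma compat_6:
  assumes "\<And>h h'. h \<odot> y = y \<odot> h' \<Longrightarrow> h \<in> S6 \<Longrightarrow>
      h' \<in> S6 \<Longrightarrow> \<phi> (dot c h) = \<phi> (dot c' h')"
  shows "snd (snd (snd (snd (snd c)))) = snd (snd (snd (snd (snd c'))))"
proof -
  obtain y1 y2 y3 y4 y5 y6 where y: "y = (y1, y2, y3, y4, y5, y6)" by (cases y)
  obtain c1 c2 c3 c4 c5 c6 where c: "c = (c1, c2, c3, c4, c5, c6)" by (cases c)
  obtain d1 d2 d3 d4 d5 d6 where d: "c' = (d1, d2, d3, d4, d5, d6)" by (cases c')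
  have "\<phi> (c6 * s) = \<phi> (d6 * s)" for s
    using assms[of "(0, 0, 0, 0, 0, s)" "(0, 0, 0, 0, 0, s)"] by (simp add: y c d G2_tuples_def)
  then show ?thesis by (simp add: c d \<phi>_inj)
qed

lemma compat_S3456:
  assumes C: "\<And>h h'. h \<odot> y = y \<odot> h' \<Longrightarrow> h \<in> S3456 \<Longrightarrow> h' \<in> S3456 \<Longrightarrow>
      \<phi> (dot (c1, c2, c3, c4, c5, c6) h) = \<phi> (dot (d1, d2, d3, d4, d5, d6) h')"
    and y: "y = (y1, y2, y3, y4, y5, y6)"
  shows "c6 = d6" "c5 = d5 - d6 * y1" "c4 = d4 - 3 * y2 * d5 + 3 * d6 * y3"
    "d6 = 0 \<or> (3 :: 'a) = 0 \<Longrightarrow> c3 = d3 - 2 * y2 * d4 + 3 * y2\<^sup>2 * d5"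
proof -
  have *: "\<phi> (c3 * h3 + c4 * h4 + c5 * h5 + c6 * h6) =
    \<phi> (d3 * h3 + d4 * (h4 - 2 * h3 * y2) + d5 * (h5 + 3 * h3 * y2\<^sup>2 - 3 * h4 * y2) +
       d6 * (h6 - 6 * h3 * y2 * y3 - 3 * h3\<^sup>2 * y2 + 3 * h4 * y3 - h5 * y1 - 3 * y4 * h3))" for h3 h4 h5 h6
    using C[of "(0, 0, h3, h4, h5, h6)" "(0, 0, h3, h4 - 2 * h3 * y2, h5 + 3 * h3 * y2\<^sup>2 - 3 * h4 * y2,
        h6 - 6 * h3 * y2 * y3 - 3 * h3\<^sup>2 * y2 + 3 * h4 * y3 - h5 * y1 - 3 * y4 * h3)"]
    by (simp add: y G2_tuples_def)
  show "c6 = d6" by (rule \<phi>_inj) (use *[of 0 0 0] in simp)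
  show "c5 = d5 - d6 * y1"
  proof (rule \<phi>_inj)
    fix s show "\<phi> (c5 * s) = \<phi> ((d5 - d6 * y1) * s)"
      using *[of 0 0 s 0] by (simp add: algebra_simps)
  qed
  show "c4 = d4 - 3 * y2 * d5 + 3 * d6 * y3"
  proof (rule \<phi>_inj)
    fix s show "\<phi> (c4 * s) = \<phi> ((d4 - 3 * y2 * d5 + 3 * d6 * y3) * s)"
      using *[of 0 s 0 0] by (simp add: algebra_simps)
  qed
  \<comment> \<open>The sixth coordinate of \<open>h'\<close> contains 3 h_3^2 y_2, which is not
    additive in h_3. Every term with h_3 there is a multiple of 3, so either alternative removes
    them all.\<close>
  assume "d6 = 0 \<or> (3 :: 'a) = 0"
  then have z: "d6 * (0 - 6 * s * y2 * y3 - 3 * s\<^sup>2 * y2 + 3 * 0 * y3 - 0 * y1 - 3 * y4 * s) = 0" for s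
  proof
    assume "(3 :: 'a) = 0"
    moreover have "(6 :: 'a) = 2 * 3" by simp
    ultimately show ?thesis by (simp only:) simp
  qed simp
  show "c3 = d3 - 2 * y2 * d4 + 3 * y2\<^sup>2 * d5"
  proof (rule \<phi>_inj)
    fix s show "\<phi> (c3 * s) = \<phi> ((d3 - 2 * y2 * d4 + 3 * y2\<^sup>2 * d5) * s)"
      using *[of s 0 0 0] unfolding z by (simp add: algebra_simps)
  qed
qed

lemma compat_S13456:
  assumes C: "\<And>h h'. h \<odot> y = y \<odot> h' \<Longrightarrow> h \<in> S13456 \<Longrightarrow> h' \<in> S13456 \<Longrightarrow>
      \<phi> (dot (c1, c2, c3, c4, c5, 0) h) = \<phi> (dot (d1, d2, d3, d4, d5, 0) h')"
    and y: "y = (y1, y2, y3, y4, y5, y6)"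
  shows "c1 = d1 - y2 * d3 + y2\<^sup>2 * d4 - y2 ^ 3 * d5"
proof (rule \<phi>_inj)
  fix s
  show "\<phi> (c1 * s) = \<phi> ((d1 - y2 * d3 + y2\<^sup>2 * d4 - y2 ^ 3 * d5) * s)"
    using C[of "(s, 0, 0, 0, 0, 0)" "(s, 0, - (y2 * s), y2\<^sup>2 * s, - (y2 ^ 3 * s),
       3 * y2\<^sup>2 * y3 * s - 3 * y2 ^ 3 * s\<^sup>2 + 2 * y2 ^ 3 * s\<^sup>2 + 3 * y4 * y2 * s + y5 * s)"]
    by (simp add: y G2_tuples_def algebra_simps power2_eq_square power3_eq_cube)
qed

lemma compat_S2456:
  assumes C: "\<And>h h'. h \<odot> y = y \<odot> h' \<Longrightarrow> h \<in> S2456 \<Longrightarrow> h' \<in> S2456 \<Longrightarrow>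
      \<phi> (dot (0, c2, 0, 0, 0, a) h) = \<phi> (dot (0, d2, 0, 0, 0, a) h')"
    and a: "a \<noteq> 0" and "(3 :: 'a) \<noteq> 0"
  shows "c2 = d2" "y \<in> S2456"
proof -
  obtain y1 y2 y3 y4 y5 y6 where y: "y = (y1, y2, y3, y4, y5, y6)" by (cases y)
  \<comment> \<open>The commutator [x_1, x_5] pairs X_1 with X_5 inside X_6, so a nontrivial
    character of X_6 forces y_1 = 0.\<close>
  have "\<phi> (0 * s) = \<phi> (- (a * y1) * s)" for s
    using C[of "(0, 0, 0, 0, s, 0)" "(0, 0, 0, 0, s, - (s * y1))"] by (simp add: y G2_tuples_def algebra_simps)
  from \<phi>_inj[OF this] have y1: "y1 = 0" using a by simp
  \<comment> \<open>[x_3, x_4] does the same for X_3 and X_4, with a factor 3. In characteristic 3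
    this pairing degenerates, which is why the characters nontrivial on X_6 form other families
    there.\<close>
  have "\<phi> (0 * s) = \<phi> ((3 * a * y3) * s)" for s
    using C[of "(0, 0, 0, s, 0, 0)" "(0, 0, 0, s, - (3 * s * y2), 3 * s * y3)"]
    by (simp add: y G2_tuples_def algebra_simps)
  from \<phi>_inj[OF this] have y3: "y3 = 0" using a assms(3) by simp
  show "y \<in> S2456" by (simp add: y y1 y3)
  show "c2 = d2"
  proof (rule \<phi>_inj)
    fix s show "\<phi> (c2 * s) = \<phi> (d2 * s)"
      using C[of "(0, s, 0, 0, 0, 0)" "(0, s, 0, 0, 3 * y4 * s, 0)"]
      by (simp add: y y1 y3 G2_tuples_def algebra_simps)
  qed
qed

end

section \<open>Characteristic at least 5\<close>

context G2_prime_power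
begin

text \<open>With first coordinate 0 and 3 = 0, only the fourth coordinate fails to be additive, and
  its coefficient here is 0.\<close>

lemma linear_S23456:
  assumes "(3 :: 'a) = 0"
  shows "tuple_linear S23456 (tchar S23456 (0, b2, b3, 0, b5, b6))"
proof -
  have 6: "(6 :: 'a) = 0" using assms by (metis mult_2 numeral_Bit0 numeral_plus_numeral add_0)
  show ?thesis
    by (rule tuple_linear_tchar) (auto simp: G2_tuples_def algebra_simps assms 6)
qed

lemma linear_S3456:
  assumes "(3 :: 'a) = 0"
  shows "tuple_linear S3456 (tchar S3456 (0, 0, 0, b4, 0, b6))"
  by (rule tuple_linear_tchar) (auto simp: G2_tuples_def algebra_simps assms)

text \<open>Conjugation of x_2(s) by y, reduced modulo 3. The fourth coordinate is left open because
  the lemma is applied where its coefficient is 0.\<close>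

lemma compat_S23456:
  assumes C: "\<And>h h'. h \<odot> y = y \<odot> h' \<Longrightarrow> h \<in> S23456 \<Longrightarrow> h' \<in> S23456 \<Longrightarrow> \<mu> h = \<nu> h'"
    and y: "y = (y1, y2, y3, y4, y5, y6)" and "(3 :: 'a) = 0"
  shows "\<exists>u v. \<mu> (0, s, 0, 0, 0, 0) = \<nu> (0, s, s * y1, u, s ^ 3 * y1, s ^ 3 * y1\<^sup>2)"
proof -
  have 6: "(6 :: 'a) = 0" using assms(3) by (metis mult_2 numeral_Bit0 numeral_plus_numeral add_0)
  have 2: "(2 :: 'a) = - 1"
  proof -
    have "(2 :: 'a) + 1 = 0" using assms(3) by simp
    then show ?thesis by (simp only: eq_neg_iff_add_eq_0)
  qed
  have "\<mu> (0, s, 0, 0, 0, 0) = \<nu> (0, s, s * y1, - 2 * s * y1 * y2 - s\<^sup>2 * y1 + 2 * s * y3, s ^ 3 * y1, s ^ 3 * y1\<^sup>2)"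
    by (rule C) (simp_all add: y G2_tuples_def assms(3) 6 algebra_simps power2_eq_square power3_eq_cube 2)
  then show ?thesis by blast
qed

end

text \<open>For p \<ge> 5 only the number of characters is claimed, so the labels are a choice of
  normal forms. As 2 and 3 are invertible, conjugation by X_2 can clear coefficient 4 in
  \<open>Five_a5\<close> and coefficient 3 in \<open>Five_a4\<close>; in \<open>Five_a3\<close> it
  clears coefficient 1.\<close>

datatype 'a label5 =
    Five_a6 'a 'a
  | Five_a5 'a 'a 'a
  | Five_a4 'a 'a
  | Five_a3 'a
  | Five_lin 'a 'a

context G2_prime_power
begin

fun H5 :: "'a label5 \<Rightarrow> 'a tuple6 set" where
  "H5 (Five_a6 b2 a6) = S2456"
| "H5 (Five_a5 b1 b3 a5) = S13456"
| "H5 (Five_a4 b1 a4) = S13456"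
| "H5 (Five_a3 a3) = S13456"
| "H5 (Five_lin b1 b2) = UNIV"

fun coef5 :: "'a label5 \<Rightarrow> 'a tuple6" where
  "coef5 (Five_a6 b2 a6) = (0, b2, 0, 0, 0, a6)"
| "coef5 (Five_a5 b1 b3 a5) = (b1, 0, b3, 0, a5, 0)"
| "coef5 (Five_a4 b1 a4) = (b1, 0, 0, a4, 0, 0)"
| "coef5 (Five_a3 a3) = (0, 0, a3, 0, 0, 0)"
| "coef5 (Five_lin b1 b2) = (b1, b2, 0, 0, 0, 0)"

definition tab5 :: "('a label5 set \<times> real \<times> real) list" where
  "tab5 = (let q = real CARD('a) in
    [({Five_a6 b2 a6 |b2 a6. a6 \<noteq> 0}, q * (q - 1), q ^ 2),
     ({Five_a5 b1 b3 a5 |b1 b3 a5. a5 \<noteq> 0}, q ^ 2 * (q - 1), q),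
     ({Five_a4 b1 a4 |b1 a4. a4 \<noteq> 0}, q * (q - 1), q),
     ({Five_a3 a3 |a3. a3 \<noteq> 0}, q - 1, q),
     ({Five_lin b1 b2 |b1 b2. True}, q ^ 2, 1)])"

lemma card_nonzero: "real (card (- {0 :: 'a})) = real CARD('a) - 1"
proof -
  have "card (- {0 :: 'a}) = CARD('a) - 1" by (simp add: Compl_eq_Diff_UNIV card_Diff_singleton)
  then show ?thesis using zero_less_card_finite[where ?'a = 'a] by (simp add: of_nat_diff One_nat_def)
qed

text \<open>Conjugation fixes the first two coordinates, and in the whole group every
  \<open>h\<close> has a partner \<open>h'\<close>.\<close>

lemma compat_UNIV_lin:
  assumes "\<And>h h'. h \<odot> y = y \<odot> h' \<Longrightarrow> \<phi> (dot (c1, c2, 0, 0, 0, 0) h) = \<phi> (dot (d1, d2, 0, 0, 0, 0) h')"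
  shows "c1 = d1 \<and> c2 = d2"
proof -
  interpret T: group "G2_tuples :: 'a tuple6 monoid" by (rule G2_tuples_group)
  have e: "\<exists>h'. h \<odot> y = y \<odot> h'" for h
  proof
    show "h \<odot> y = y \<odot> (inv\<^bsub>G2_tuples\<^esub> y \<odot> (h \<odot> y))"
      by (rule T.inv_cancel_left(1)[symmetric]) (simp_all add: G2_tuples_def)
  qed
  have "\<phi> (dot (c1, c2, 0, 0, 0, 0) h) = \<phi> (dot (d1, d2, 0, 0, 0, 0) h)" for h
  proof -
    obtain h' where h': "h \<odot> y = y \<odot> h'" using e by blast
    obtain y1 y2 y3 y4 y5 y6 where y: "y = (y1, y2, y3, y4, y5, y6)" by (cases y)
    obtain h1 h2 h3 h4 h5 h6 where h: "h = (h1, h2, h3, h4, h5, h6)" by (cases h)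
    obtain k1 k2 k3 k4 k5 k6 where k: "h' = (k1, k2, k3, k4, k5, k6)" by (cases h')
    have "h1 = k1" "h2 = k2" using h' by (simp_all add: y h k G2_tuples_def)
    then show ?thesis using assms[OF h'] by (simp add: h k)
  qed
  from this[of "(_, 0, 0, 0, 0, 0)"] this[of "(0, _, 0, 0, 0, 0)"]
  have "\<phi> (c1 * s) = \<phi> (d1 * s)" "\<phi> (c2 * s) = \<phi> (d2 * s)" for s by simp_all
  then show ?thesis using \<phi>_inj by blast
qed

text \<open>Coefficient 6 is an invariant. If it vanishes, both subgroups contain
  \<open>S13456\<close>, the last nonzero one among coefficients 5, 4, 3 is an invariant, and the
  relation for the coefficient cleared by the normal form gives y_2 = 0.\<close>

lemma tab5_compat:
  assumes p5: "(2 :: 'a) \<noteq> 0" "(3 :: 'a) \<noteq> 0"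
    and lm: "l \<in> (\<Union>(L, n, d)\<in>set tab5. L)" "m \<in> (\<Union>(L, n, d)\<in>set tab5. L)"
    and C: "\<And>h h'. \<lbrakk>h \<in> H5 l; h' \<in> H5 m; h \<odot> y = y \<odot> h'\<rbrakk> \<Longrightarrow>
      tchar (H5 l) (coef5 l) h = tchar (H5 m) (coef5 m) h'"
  shows "l = m \<and> y \<in> H5 l"
proof -
  have C': "\<phi> (dot (coef5 l) h) = \<phi> (dot (coef5 m) h')" if "h \<in> H5 l" "h' \<in> H5 m" "h \<odot> y = y \<odot> h'" for h h'
    using C[OF that] that by (simp add: tchar_def)
  obtain y1 y2 y3 y4 y5 y6 where y: "y = (y1, y2, y3, y4, y5, y6)" by (cases y)
  obtain l1 l2 l3 l4 l5 l6 where l: "coef5 l = (l1, l2, l3, l4, l5, l6)" by (cases "coef5 l")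
  obtain m1 m2 m3 m4 m5 m6 where m: "coef5 m = (m1, m2, m3, m4, m5, m6)" by (cases "coef5 m")
  have X6: "S6 \<subseteq> H5 k" for k by (cases k) auto
  have "snd (snd (snd (snd (snd (coef5 l))))) = snd (snd (snd (snd (snd (coef5 m)))))"
    by (rule compat_6[of y]) (rule C'; use X6 in blast)
  then have "l6 = m6" by (simp add: l m)
  have S: "S13456 \<subseteq> H5 k" if "snd (snd (snd (snd (snd (coef5 k))))) = 0" "k \<in> (\<Union>(L, n, d)\<in>set tab5. L)" for k
    using that by (cases k) (auto simp: tab5_def Let_def)
  show ?thesis
  proof (cases "l6 = 0")
    case True
    then have m60: "m6 = 0" using \<open>l6 = m6\<close> by simp
    have Sl: "S13456 \<subseteq> H5 l" "S13456 \<subseteq> H5 m" using S lm True m60 l m by auto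
    have D: "\<phi> (dot (l1, l2, l3, l4, l5, 0) h) = \<phi> (dot (m1, m2, m3, m4, m5, 0) h')"
      if "h \<odot> y = y \<odot> h'" "h \<in> S13456" "h' \<in> S13456" for h h'
      using C'[of h h'] that Sl True m60 l m by auto
    have D4: "\<phi> (dot (l1, l2, l3, l4, l5, 0) h) = \<phi> (dot (m1, m2, m3, m4, m5, 0) h')"
      if "h \<odot> y = y \<odot> h'" "h \<in> S3456" "h' \<in> S3456" for h h'
      by (rule D) (use that S_subset(1) in blast)+
    note e = compat_S3456[OF D4 y, simplified] compat_S13456[OF D y]
    have lin: "l1 = m1 \<and> l2 = m2" if "H5 l = UNIV" "H5 m = UNIV" "l3 = 0" "l4 = 0" "l5 = 0" "m3 = 0" "m4 = 0" "m5 = 0"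
      by (rule compat_UNIV_lin[of y]) (use C' that True m60 l m in auto)
    show ?thesis
      using e lin l m lm p5 True m60
      by (cases l; cases m) (auto simp: tab5_def Let_def y)
  next
    case False
    have l': "l = Five_a6 l2 l6" using False l by (cases l) auto
    have m': "m = Five_a6 m2 l6" using False m \<open>l6 = m6\<close> by (cases m) auto
    have D: "\<phi> (dot (0, l2, 0, 0, 0, l6) h) = \<phi> (dot (0, m2, 0, 0, 0, l6) h')"
      if "h \<odot> y = y \<odot> h'" "h \<in> S2456" "h' \<in> S2456" for h h'
      using C'[of h h'] that by (simp add: l' m')
    show ?thesis using compat_S2456[OF D False p5(2)] by (simp add: l' m')
  qed
qed

lemma card_Irr_5:
  assumes p5: "(2 :: 'a) \<noteq> 0" "(3 :: 'a) \<noteq> 0"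
  shows "real (card (Irr G)) = real CARD('a) ^ 3 + 2 * real CARD('a) ^ 2 - real CARD('a) - 1"
proof -
  let ?N = "- {0 :: 'a}"
  have img:
    "{Five_a6 b2 a6 |b2 a6. a6 \<noteq> (0 :: 'a)} = (\<lambda>(b2, a6). Five_a6 b2 a6) ` (UNIV \<times> ?N)"
    "{Five_a5 b1 b3 a5 |b1 b3 a5. a5 \<noteq> (0 :: 'a)} = (\<lambda>(b1, b3, a5). Five_a5 b1 b3 a5) ` (UNIV \<times> UNIV \<times> ?N)"
    "{Five_a4 b1 a4 |b1 a4. a4 \<noteq> (0 :: 'a)} = (\<lambda>(b1, a4). Five_a4 b1 a4) ` (UNIV \<times> ?N)"
    "{Five_a3 a3 |a3. a3 \<noteq> (0 :: 'a)} = Five_a3 ` ?N"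
    "{Five_lin b1 b2 |b1 b2 :: 'a. True} = (\<lambda>(b1, b2). Five_lin b1 b2) ` (UNIV \<times> UNIV)"
    by (auto simp: image_iff)
  have "real (card (Irr G)) = (\<Sum>(L, n, d)\<leftarrow>tab5. n)"
  proof (rule Irr_tableI[THEN conjunct2, THEN conjunct1])
    show "sorted_wrt (\<lambda>r s. fst r \<inter> fst s = {}) tab5"
      by (auto simp: tab5_def Let_def)
    show "(\<Sum>(L, n, d)\<leftarrow>tab5. n * d\<^sup>2) = real CARD('a) ^ 6"
      by (simp add: tab5_def Let_def algebra_simps power2_eq_square numeral_eq_Suc)
    show "l = m \<and> y \<in> H5 l"
      if "l \<in> (\<Union>(L, n, d)\<in>set tab5. L)" "m \<in> (\<Union>(L, n, d)\<in>set tab5. L)"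
        "\<And>h h'. \<lbrakk>h \<in> H5 l; h' \<in> H5 m; h \<odot> y = y \<odot> h'\<rbrakk> \<Longrightarrow>
          tchar (H5 l) (coef5 l) h = tchar (H5 m) (coef5 m) h'" for l m y
      by (rule tab5_compat[OF p5 that])
    show "finite L \<and> real (card L) = n \<and> (\<forall>l\<in>L. tuple_linear (H5 l) (tchar (H5 l) (coef5 l)) \<and>
        real CARD('a) ^ 6 = d * real (card (H5 l)))" if "(L, n, d) \<in> set tab5" for L n d
    proof (intro conjI)
      show "finite L" using that unfolding tab5_def Let_def img by auto
      show "real (card L) = n"
        using that unfolding tab5_def Let_def img by (auto simp: card_image inj_on_def card_cartesian_product
            card_nonzero power2_eq_square)
      show "\<forall>l\<in>L. tuple_linear (H5 l) (tchar (H5 l) (coef5 l)) \<and> real CARD('a) ^ 6 = d * real (card (H5 l))"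
        using that by (auto simp: tab5_def Let_def linear_S2456 linear_S13456 linear_UNIV card_S(4)
            simp flip: card_eq_degree simp del: card_prod)
    qed
  qed
  then show ?thesis by (simp add: tab5_def Let_def algebra_simps power2_eq_square numeral_eq_Suc)
qed

end

section \<open>Root subgroups in coordinates\<close>

context G2_prime_power
begin

lemma exists_coordinates: "\<exists>t :: nat \<Rightarrow> 'a. t 1 = a1 \<and> t 2 = a2 \<and> t 3 = a3 \<and> t 4 = a4 \<and> t 5 = a5 \<and> t 6 = a6"
  by (rule exI[of _ "\<lambda>i. [a1, a2, a3, a4, a5, a6] ! (i - 1)"]) simp

lemma root_prods:
  "root_prod G x {2,4,5,6} t = coord (0, t 2, 0, t 4, t 5, t 6)"
  "root_prod G x {1,3,4,5,6} t = coord (t 1, 0, t 3, t 4, t 5, t 6)"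
  "root_prod G x {2,3,4,5,6} t = coord (0, t 2, t 3, t 4, t 5, t 6)"
  "root_prod G x {3,4,5,6} t = coord (0, 0, t 3, t 4, t 5, t 6)"
  "root_prod G x {4,5,6} t = coord (0, 0, 0, t 4, t 5, t 6)"
  "root_prod G x {3,5,6} t = coord (0, 0, t 3, 0, t 5, t 6)"
  "root_prod G x {5,6} t = coord (0, 0, 0, 0, t 5, t 6)"
  "root_prod G x {4,6} t = coord (0, 0, 0, t 4, 0, t 6)"
  "root_prod G x {2} t = coord (0, t 2, 0, 0, 0, 0)"
  "root_prod G x {1..6} t = coord (t 1, t 2, t 3, t 4, t 5, t 6)"
  by (simp_all add: root_prod_eq_coord)

lemma coord_x:
  "x 1 t = coord (t, 0, 0, 0, 0, 0)" "x 2 t = coord (0, t, 0, 0, 0, 0)" "x 3 t = coord (0, 0, t, 0, 0, 0)"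
  "x 4 t = coord (0, 0, 0, t, 0, 0)" "x 5 t = coord (0, 0, 0, 0, t, 0)" "x 6 t = coord (0, 0, 0, 0, 0, t)"
  by (simp_all add: coord.simps x_zeros)

lemma root_set_eq:
  assumes "I \<subseteq> {1..6}"
  shows "root_set G x I = coord ` {(a1, a2, a3, a4, a5, a6). (1 \<notin> I \<longrightarrow> a1 = 0) \<and> (2 \<notin> I \<longrightarrow> a2 = 0) \<and>
    (3 \<notin> I \<longrightarrow> a3 = 0) \<and> (4 \<notin> I \<longrightarrow> a4 = 0) \<and> (5 \<notin> I \<longrightarrow> a5 = 0) \<and> (6 \<notin> I \<longrightarrow> a6 = 0)}" (is "_ = coord ` ?S")
proof (intro equalityI subsetI)
  fix g assume "g \<in> root_set G x I"
  then show "g \<in> coord ` ?S" by (auto simp: root_set_def root_prod_eq_coord[OF assms])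
next
  fix g assume "g \<in> coord ` ?S"
  then obtain a1 a2 a3 a4 a5 a6 where g: "g = coord (a1, a2, a3, a4, a5, a6)" "(a1, a2, a3, a4, a5, a6) \<in> ?S" by auto
  obtain t :: "nat \<Rightarrow> 'a" where "t 1 = a1 \<and> t 2 = a2 \<and> t 3 = a3 \<and> t 4 = a4 \<and> t 5 = a5 \<and> t 6 = a6"
    using exists_coordinates by blast
  then have "g = root_prod G x I t" using g by (auto simp: root_prod_eq_coord[OF assms])
  then show "g \<in> root_set G x I" by (simp add: root_set_def)
qed

lemma root_sets:
  "root_set G x {2,4,5,6} = coord ` S2456"
  "root_set G x {1,3,4,5,6} = coord ` S13456"
  "root_set G x {2,3,4,5,6} = coord ` S23456"
  "root_set G x {3,4,5,6} = coord ` S3456"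
  "root_set G x {4,5,6} = {coord (0, 0, 0, a4, a5, a6) |a4 a5 a6. True}"
  "root_set G x {3,5,6} = {coord (0, 0, a3, 0, a5, a6) |a3 a5 a6. True}"
  "root_set G x {5,6} = {coord (0, 0, 0, 0, a5, a6) |a5 a6. True}"
  "root_set G x {4,6} = {coord (0, 0, 0, a4, 0, a6) |a4 a6. True}"
  "root_set G x {2} = range (x 2)"
  "root_set G x {1..6} = coord ` UNIV"
  by (auto simp: root_set_eq S2456_def S13456_def S3456_def first_in_def coord_x image_iff)

text \<open>Resolves the definite description: the prescribed values cover the whole subgroup, and
  off it the character is 0. \<open>F t\<close> are the coordinates of the root product.\<close>

lemma root_linear_eq:
  assumes "root_set G x I = coord ` S" "tuple_linear S (tchar S c)"
    and "\<And>t. root_prod G x I t = coord (F t) \<and> \<psi> t = dot c (F t)"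
  shows "root_linear G x I \<psi> = push (tchar S c)"
  unfolding root_linear_def
proof (rule the_equality)
  have F: "F t \<in> S" for t
  proof -
    have "coord (F t) \<in> coord ` S" using assms(1,3) by (metis rangeI root_set_def)
    then show ?thesis by auto
  qed
  show "linear_character G (root_set G x I) (push (tchar S c)) \<and>
      (\<forall>t. push (tchar S c) (root_prod G x I t) = \<phi> (\<psi> t))"
    using linear_character_push[OF assms(2)] assms F by (simp add: tchar_def)
  fix \<nu> assume nu: "linear_character G (root_set G x I) \<nu> \<and> (\<forall>t. \<nu> (root_prod G x I t) = \<phi> (\<psi> t))"
  show "\<nu> = push (tchar S c)"
  proof
    fix g show "\<nu> g = push (tchar S c) g"
    proof (cases "g \<in> root_set G x I")
      case True
      then obtain t where "g = root_prod G x I t" by (auto simp: root_set_def)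
      then show ?thesis using nu assms(3) F by (simp add: tchar_def)
    next
      case False
      then show ?thesis
        using nu linear_character_push[OF assms(2)] by (simp add: linear_character_iff assms(1))
    qed
  qed
qed

lemma root_ind_eq:
  assumes "root_set G x I = coord ` S" "tuple_linear S (tchar S c)"
    and "\<And>t. root_prod G x I t = coord (F t) \<and> \<psi> t = dot c (F t)"
  shows "root_ind G x I \<psi> = induced G (coord ` S) (push (tchar S c))"
  by (simp only: root_ind_def root_linear_eq[OF assms] assms(1))

text \<open>Gives the linear characters the same form as the other families, as inductions from the
  whole group.\<close>

lemma induced_carrier:
  assumes "linear_character G (carrier G) \<mu>"
  shows "induced G (carrier G) \<mu> = \<mu>"
proof
  fix g show "induced G (carrier G) \<mu> g = \<mu> g"
  proof (cases "g \<in> carrier G")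
    case True
    have "\<mu> (inv y \<otimes> g \<otimes> y) = \<mu> g" if y: "y \<in> carrier G" for y
    proof -
      have "\<mu> (inv y \<otimes> g \<otimes> y) = inverse (\<mu> y) * \<mu> g * \<mu> y"
        using assms True y linear_character_inv[OF assms y] by (simp add: linear_character_iff)
      moreover have "\<mu> y \<noteq> 0" using assms y by (simp add: linear_character_iff)
      ultimately show ?thesis by simp
    qed
    then have "(\<Sum>y\<in>carrier G. \<mu> (inv y \<otimes> g \<otimes> y)) = of_nat (card (carrier G)) * \<mu> g" by simp
    moreover have "card (carrier G) \<noteq> 0" by (simp add: card_carrier)
    ultimately show ?thesis using induced_eq[OF assms True] by simp
  qed (use assms in \<open>simp add: induced_def linear_character_iff\<close>)
qed

lemma root_linear_UNIV:
  "root_linear G x {1..6} (\<lambda>t. b1 * t 1 + b2 * t 2)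
    = induced G (coord ` UNIV) (push (tchar UNIV (b1, b2, 0, 0, 0, 0)))"
proof -
  have e: "root_linear G x {1..6} (\<lambda>t. b1 * t 1 + b2 * t 2) = push (tchar UNIV (b1, b2, 0, 0, 0, 0))"
    by (rule root_linear_eq[OF root_sets(10) linear_UNIV, where F = "\<lambda>t. (t 1, t 2, t 3, t 4, t 5, t 6)"])
       (simp add: root_prods del: atLeastAtMost_iff)
  have "coord ` UNIV = carrier G" using bij_coord by (simp add: bij_betw_def)
  then show ?thesis
    using induced_carrier linear_character_push[OF linear_UNIV[of b1 b2]] by (simp only: e)
qed

text \<open>All conjugates of \<open>z\<close> take the value \<kappa> under \<mu>, so the summands
  of the induction are equal. It is applied also to elements that are central only modulo a
  kernel.\<close>

lemma induced_push_central:
  assumes lin: "tuple_linear H \<mu>" and z: "\<And>y. \<exists>z'. z \<odot> y = y \<odot> z' \<and> \<mu> z' = \<kappa>"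
  shows "induced G (coord ` H) (push \<mu>) (coord z) = of_nat (CARD('a) ^ 6) / of_nat (card H) * \<kappa>"
proof -
  have "push \<mu> (inv g \<otimes> coord z \<otimes> g) = \<kappa>" if g: "g \<in> carrier G" for g
  proof -
    obtain y where y: "g = coord y" using g by (rule coord_surj)
    obtain z' where z': "z \<odot> y = y \<odot> z'" "\<mu> z' = \<kappa>" using z by blast
    have "coord z \<otimes> g = g \<otimes> coord z'" using z'(1) by (simp add: y flip: coord_mult)
    then have "inv g \<otimes> coord z \<otimes> g = coord z'"
      using g by (simp add: m_assoc inv_cancel_left)
    then show ?thesis by (simp add: z'(2))
  qed
  moreover have "card (coord ` H) = card H"
    using bij_coord by (intro card_image) (auto simp: bij_betw_def intro: inj_on_subset)
  ultimately show ?thesis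
    using induced_eq[OF linear_character_push[OF lin] coord_closed, of z] by (simp add: card_carrier)
qed

text \<open>The sixth coordinate is left open, as the characters compared by means of this formula
  are trivial on X_6.\<close>

lemma conj_first:
  "\<exists>v. (s, 0, 0, 0, 0, 0) \<odot> (y1, y2, y3, y4, y5, y6)
     = (y1, y2, y3, y4, y5, y6) \<odot> (s, 0, - (y2 * s), y2\<^sup>2 * s, - (y2 ^ 3 * s), v :: 'a)"
  by (rule exI[of _ "3 * y2\<^sup>2 * y3 * s - 3 * y2 ^ 3 * s\<^sup>2 + 2 * y2 ^ 3 * s\<^sup>2 + 3 * y4 * y2 * s + y5 * s"])
     (simp add: G2_tuples_def algebra_simps power2_eq_square power3_eq_cube)

lemma conj_second:
  "\<exists>v. (0, s, 0, 0, 0, 0) \<odot> (y1, y2, y3, y4, y5, y6)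
     = (y1, y2, y3, y4, y5, y6) \<odot> (0, s, s * y1, - (s\<^sup>2 * y1) - 2 * s * y1 * y2 + 2 * s * y3,
         s ^ 3 * y1 + 3 * s * y1 * y2\<^sup>2 + 3 * s\<^sup>2 * y1 * y2 - 3 * s\<^sup>2 * y3 + 3 * s * y4, v :: 'a)"
proof (rule exI)
  \<comment> \<open>The sixth coordinate of a product is additive in that of the right factor and
    does not involve the fourth and fifth of that factor. The witness is therefore a difference of
    sixth coordinates, with zeros inserted.\<close>
  let ?p6 = "\<lambda>a. snd (snd (snd (snd (snd a)))) :: 'a"
  show "(0, s, 0, 0, 0, 0) \<odot> (y1, y2, y3, y4, y5, y6)
     = (y1, y2, y3, y4, y5, y6) \<odot> (0, s, s * y1, - (s\<^sup>2 * y1) - 2 * s * y1 * y2 + 2 * s * y3,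
         s ^ 3 * y1 + 3 * s * y1 * y2\<^sup>2 + 3 * s\<^sup>2 * y1 * y2 - 3 * s\<^sup>2 * y3 + 3 * s * y4,
         ?p6 ((0, s, 0, 0, 0, 0) \<odot> (y1, y2, y3, y4, y5, y6)) -
         ?p6 ((y1, y2, y3, y4, y5, y6) \<odot> (0, s, s * y1, 0, 0, 0)))"
    by (simp add: G2_tuples_def algebra_simps power2_eq_square power3_eq_cube)
qed

text \<open>Common shape of the exceptional characters in characteristics 2 and 3: \<xi> is a
  character of X', \<eta> one of X_2, and \<open>c\<close> carries the coefficients on the other
  root subgroups.\<close>

definition star :: "'a set \<Rightarrow> ('a \<Rightarrow> complex) \<Rightarrow> ('a \<Rightarrow> complex) \<Rightarrow> 'a tuple6 \<Rightarrow> 'a tuple6 \<Rightarrow> complex" where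
  "star C \<xi> \<eta> c t = (if fst t \<in> C then \<xi> (fst t) * \<eta> (fst (snd t)) * \<phi> (dot c t) else 0)"

text \<open>Treats p = 2 without a_5 and p = 3 without a_4 together. In either case the terms of
  coordinates 4 and 5 beyond the pairing of X_1 and X_2 have coefficient 0 or carry the factor
  p.\<close>

definition small_char :: "'a \<Rightarrow> 'a \<Rightarrow> bool" where
  "small_char c4 c5 \<longleftrightarrow> (2 :: 'a) = 0 \<and> c5 = 0 \<or> (3 :: 'a) = 0 \<and> c4 = 0"

text \<open>The exponent \<open>dot\<close> fails to be additive by exactly c_3 s b - c_4 s^2 b +
  c_5 s^3 b, where s is coordinate 2 of the left factor and b coordinate 1 of the right one. The
  hypothesis on \<open>C\<close> makes \<phi> blind to this defect.\<close>

lemma linear_star: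
  assumes C: "0 \<in> C" "\<And>a b. a \<in> C \<Longrightarrow> b \<in> C \<Longrightarrow> a + b \<in> C"
    and \<xi>: "\<And>a b. a \<in> C \<Longrightarrow> b \<in> C \<Longrightarrow> \<xi> (a + b) = \<xi> a * \<xi> b" "\<And>a. a \<in> C \<Longrightarrow> \<xi> a \<noteq> 0"
    and \<eta>: "\<And>a b. \<eta> (a + b) = \<eta> a * \<eta> b" "\<And>a. \<eta> a \<noteq> 0"
    and c: "small_char c4 c5"
    and inv: "\<And>b s. b \<in> C \<Longrightarrow> \<phi> (c3 * s * b - c4 * s\<^sup>2 * b + c5 * s ^ 3 * b) = 1"
  shows "tuple_linear (first_in C) (star C \<xi> \<eta> (0, 0, c3, c4, c5, 0))"
proof -
  have "a \<odot> b \<in> first_in C \<and> star C \<xi> \<eta> (0, 0, c3, c4, c5, 0) (a \<odot> b) =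
      star C \<xi> \<eta> (0, 0, c3, c4, c5, 0) a * star C \<xi> \<eta> (0, 0, c3, c4, c5, 0) b"
    if "a \<in> first_in C" "b \<in> first_in C" for a b
  proof -
    obtain a1 a2 a3 a4 a5 a6 where a: "a = (a1, a2, a3, a4, a5, a6)" by (cases a)
    obtain b1 b2 b3 b4 b5 b6 where b: "b = (b1, b2, b3, b4, b5, b6)" by (cases b)
    have ab: "a1 \<in> C" "b1 \<in> C" using that by (simp_all add: a b)
    have "dot (0, 0, c3, c4, c5, 0) (a \<odot> b) =
      dot (0, 0, c3, c4, c5, 0) a + dot (0, 0, c3, c4, c5, 0) b + (c3 * a2 * b1 - c4 * a2\<^sup>2 * b1 + c5 * a2 ^ 3 * b1)"
      using c by (auto simp: small_char_def a b G2_tuples_def algebra_simps)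
    then have "\<phi> (dot (0, 0, c3, c4, c5, 0) (a \<odot> b)) =
      \<phi> (dot (0, 0, c3, c4, c5, 0) a + dot (0, 0, c3, c4, c5, 0) b) *
      \<phi> (c3 * a2 * b1 - c4 * a2\<^sup>2 * b1 + c5 * a2 ^ 3 * b1)"
      by (simp only:) (rule \<phi>_add)
    then have "\<phi> (dot (0, 0, c3, c4, c5, 0) (a \<odot> b)) =
      \<phi> (dot (0, 0, c3, c4, c5, 0) a) * \<phi> (dot (0, 0, c3, c4, c5, 0) b)"
      by (simp only: \<phi>_add[of "dot _ _"] inv[OF ab(2)] mult_1_right)
    moreover have "fst (a \<odot> b) = a1 + b1" "fst (snd (a \<odot> b)) = a2 + b2"
      by (simp_all add: a b G2_tuples_def)
    ultimately show ?thesis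
      using ab C(2)[OF ab] \<xi>(1)[OF ab] \<eta>(1)[of a2 b2] by (simp add: star_def first_in_def a b)
  qed
  note mult = this
  show ?thesis
    unfolding tuple_linear_def
  proof (intro conjI ballI allI impI)
    have "(0, 0, 0, 0, 0, 0) \<in> first_in C" using C(1) by simp
    then show "first_in C \<noteq> {}" by blast
    show "star C \<xi> \<eta> (0, 0, c3, c4, c5, 0) a = 0" if "a \<notin> first_in C" for a
      using that by (simp add: star_def first_in_def)
    show "star C \<xi> \<eta> (0, 0, c3, c4, c5, 0) a \<noteq> 0" if "a \<in> first_in C" for a
      using that \<xi>(2) \<eta>(2) by (simp add: star_def first_in_def)
  qed (use mult in blast)+
qed

text \<open>The test elements are x_2(s) and x_1(t). Conjugating the former by y produces the
  pairing of s with y_1; conjugating the latter produces that of y_2 with t, which is trivial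
  because t lies in \<open>C\<close>.\<close>

lemma compat_star:
  assumes H: "\<And>h h'. h \<odot> y = y \<odot> h' \<Longrightarrow> h \<in> first_in C \<Longrightarrow> h' \<in> first_in C \<Longrightarrow>
      star C \<xi> \<eta> (0, 0, c3, c4, c5, 0) h = star C \<xi>' \<eta>' (0, 0, c3, c4, c5, 0) h'"
    and y: "y = (y1, y2, y3, y4, y5, y6)" and c: "small_char c4 c5" and C0: "0 \<in> C"
    and one: "\<xi> 0 = 1" "\<xi>' 0 = 1" "\<eta> 0 = 1" "\<eta>' 0 = 1"
    and inv: "\<And>b s. b \<in> C \<Longrightarrow> \<phi> (c3 * s * b - c4 * s\<^sup>2 * b + c5 * s ^ 3 * b) = 1"
  shows "\<eta> s = \<eta>' s * \<phi> (c3 * s * y1 - c4 * s\<^sup>2 * y1 + c5 * s ^ 3 * y1)"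
    and "t \<in> C \<Longrightarrow> \<xi> t = \<xi>' t"
proof -
  obtain v where v: "(0, s, 0, 0, 0, 0) \<odot> (y1, y2, y3, y4, y5, y6)
     = (y1, y2, y3, y4, y5, y6) \<odot> (0, s, s * y1, - (s\<^sup>2 * y1) - 2 * s * y1 * y2 + 2 * s * y3,
         s ^ 3 * y1 + 3 * s * y1 * y2\<^sup>2 + 3 * s\<^sup>2 * y1 * y2 - 3 * s\<^sup>2 * y3 + 3 * s * y4, v)"
    using conj_second by blast
  have d: "c3 * (s * y1) + c4 * (- (s\<^sup>2 * y1) - 2 * s * y1 * y2 + 2 * s * y3) +
      c5 * (s ^ 3 * y1 + 3 * s * y1 * y2\<^sup>2 + 3 * s\<^sup>2 * y1 * y2 - 3 * s\<^sup>2 * y3 + 3 * s * y4)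
    = c3 * s * y1 - c4 * s\<^sup>2 * y1 + c5 * s ^ 3 * y1"
    using c by (auto simp: small_char_def algebra_simps)
  show "\<eta> s = \<eta>' s * \<phi> (c3 * s * y1 - c4 * s\<^sup>2 * y1 + c5 * s ^ 3 * y1)"
    using H[unfolded y, OF v] C0 one by (simp add: star_def d)
  assume t: "t \<in> C"
  obtain w where w: "(t, 0, 0, 0, 0, 0) \<odot> (y1, y2, y3, y4, y5, y6)
     = (y1, y2, y3, y4, y5, y6) \<odot> (t, 0, - (y2 * t), y2\<^sup>2 * t, - (y2 ^ 3 * t), w)"
    using conj_first by blast
  have "c3 * (- (y2 * t)) + c4 * (y2\<^sup>2 * t) + c5 * (- (y2 ^ 3 * t)) =
      - (c3 * y2 * t - c4 * y2\<^sup>2 * t + c5 * y2 ^ 3 * t)"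
    by (simp add: algebra_simps)
  then have "\<phi> (c3 * (- (y2 * t)) + c4 * (y2\<^sup>2 * t) + c5 * (- (y2 ^ 3 * t))) = 1"
    by (simp only: \<phi>_minus inv[OF t]) simp
  then show "\<xi> t = \<xi>' t"
    using H[unfolded y, OF w] t one by (simp add: star_def)
qed

lemma linear_character_unique:
  assumes mu: "linear_character G (coord ` first_in C) \<mu>" and nu: "linear_character G (coord ` first_in C) \<nu>"
    and C0: "0 \<in> C" and 1: "\<And>t. t \<in> C \<Longrightarrow> \<mu> (x 1 t) = \<nu> (x 1 t)"
    and x: "\<And>t. \<mu> (x 2 t) = \<nu> (x 2 t)" "\<And>t. \<mu> (x 3 t) = \<nu> (x 3 t)" "\<And>t. \<mu> (x 4 t) = \<nu> (x 4 t)"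
      "\<And>t. \<mu> (x 5 t) = \<nu> (x 5 t)" "\<And>t. \<mu> (x 6 t) = \<nu> (x 6 t)"
  shows "\<mu> = \<nu>"
proof
  have val: "\<kappa> (coord (a1, a2, a3, a4, a5, a6)) = \<kappa> (x 1 a1) * (\<kappa> (x 2 a2) * (\<kappa> (x 3 a3) * (\<kappa> (x 4 a4) * (\<kappa> (x 5 a5) * \<kappa> (x 6 a6)))))"
    if k: "linear_character G (coord ` first_in C) \<kappa>" and a1: "a1 \<in> C" for \<kappa> a1 a2 a3 a4 a5 a6
  proof -
    have mem: "x 1 a1 \<in> coord ` first_in C" "x 2 a2 \<in> coord ` first_in C" "x 3 a3 \<in> coord ` first_in C"
      "x 4 a4 \<in> coord ` first_in C" "x 5 a5 \<in> coord ` first_in C"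
      unfolding coord_x using a1 C0 by auto
    show ?thesis
      unfolding coord.simps using mem by (simp add: linear_character_mult_left[OF k])
  qed
  fix g
  show "\<mu> g = \<nu> g"
  proof (cases "g \<in> coord ` first_in C")
    case True
    then obtain a1 a2 a3 a4 a5 a6 where "g = coord (a1, a2, a3, a4, a5, a6)" "a1 \<in> C" by auto
    then show ?thesis using val[OF mu] val[OF nu] 1 x by simp
  next
    case False
    then show ?thesis using mu nu by (simp add: linear_character_iff)
  qed
qed

lemma linear_character_x2_multiple:
  assumes mu: "linear_character G (coord ` first_in C) \<mu>" and "0 \<in> C"
  shows "\<mu> (x 2 (of_nat j * v)) = \<mu> (x 2 v) ^ j"
proof (induction j)
  case 0
  then show ?case using linear_character_one[OF mu] by (simp add: x_zeros)
next
  case (Suc j)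
  have "x 2 v \<in> coord ` first_in C" unfolding coord_x using assms(2) by auto
  then have "\<mu> (x 2 v \<otimes> x 2 (of_nat j * v)) = \<mu> (x 2 v) * \<mu> (x 2 (of_nat j * v))"
    by (simp add: linear_character_mult_left[OF mu])
  then show ?case using Suc by (simp add: collect_add distrib_right)
qed

text \<open>Under t \<mapsto> x_2(t), a complement in X_2 becomes an additive complement of the
  prime multiples of \<open>v\<close>. Writing Y' with multiples j v covers {0, v} for p = 2 and {0,
  v, -v} for p = 3.\<close>

lemma complement_character:
  assumes Y: "complement_in G Y (x 2 ` {of_nat j * v |j. j < p}) (root_set G x {2})"
    and v: "v \<noteq> 0"
  shows "Y \<subseteq> range (x 2)" "\<one> \<in> Y" "\<And>t. \<exists>j. x 2 (t - of_nat j * v) \<in> Y"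
    "\<And>\<epsilon> :: complex. \<epsilon> ^ p = 1 \<Longrightarrow> \<exists>\<eta>. (\<forall>s t. \<eta> (s + t) = \<eta> s * \<eta> t) \<and> \<eta> v = \<epsilon> \<and> (\<forall>s. x 2 s \<in> Y \<longrightarrow> \<eta> s = 1)"
proof -
  have sub: "subgroup Y G" and int: "x 2 ` {of_nat j * v |j. j < p} \<inter> Y = {\<one>}"
    and prod: "x 2 ` {of_nat j * v |j. j < p} <#> Y = range (x 2)"
    using Y by (auto simp: complement_in_def root_sets)
  show one: "\<one> \<in> Y" by (rule subgroup.one_closed[OF sub])
  have p0: "0 < p" using prime_gt_0_nat[OF p] .
  show YR: "Y \<subseteq> range (x 2)"
  proof
    fix g assume g: "g \<in> Y"
    have "x 2 0 \<in> x 2 ` {of_nat j * v |j. j < p}" using p0 by (auto intro!: exI[of _ 0])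
    then have "x 2 0 \<otimes> g \<in> x 2 ` {of_nat j * v |j. j < p} <#> Y" using g unfolding set_mult_def by blast
    then show "g \<in> range (x 2)" using g subgroup.mem_carrier[OF sub g] by (simp add: prod x_zeros)
  qed
  have x2: "x 2 s \<otimes> x 2 t = x 2 (s + t)" for s t by (simp add: collect_add)
  have x2_inj: "x 2 s = x 2 t \<longleftrightarrow> s = t" for s t by (simp add: coord_x)
  show ex: "\<exists>j. x 2 (t - of_nat j * v) \<in> Y" for t
  proof -
    have "x 2 t \<in> x 2 ` {of_nat j * v |j. j < p} <#> Y" by (simp add: prod)
    then obtain j g where j: "g \<in> Y" "x 2 t = x 2 (of_nat j * v) \<otimes> g" by (auto simp: set_mult_def)
    then obtain s where s: "g = x 2 s" using YR by blast
    then have "t = of_nat j * v + s" using j(2) by (simp add: x2 x2_inj)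
    then show ?thesis using j(1) s by (intro exI[of _ j]) simp
  qed
  fix \<epsilon> :: complex assume eps: "\<epsilon> ^ p = 1"
  have "\<exists>\<eta>. (\<forall>s t. \<eta> (s + t) = \<eta> s * \<eta> t) \<and> \<eta> v = \<epsilon> \<and> (\<forall>a\<in>{s. x 2 s \<in> Y}. \<eta> a = 1)"
  proof (rule exists_complement_character[OF _ _ _ _ _ eps])
    show "0 \<in> {s. x 2 s \<in> Y}" using one by (simp add: x_zeros)
    show "a + b \<in> {s. x 2 s \<in> Y}" if "a \<in> {s. x 2 s \<in> Y}" "b \<in> {s. x 2 s \<in> Y}" for a b
      using subgroup.m_closed[OF sub, of "x 2 a" "x 2 b"] that by (simp add: x2)
    show "- a \<in> {s. x 2 s \<in> Y}" if "a \<in> {s. x 2 s \<in> Y}" for a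
    proof -
      have "x 2 (- a) \<otimes> x 2 a = \<one>" by (simp add: x2 x_zeros)
      then have "inv (x 2 a) = x 2 (- a)" by (intro inv_equality) auto
      then show ?thesis using subgroup.m_inv_closed[OF sub, of "x 2 a"] that by simp
    qed
    show "j = 0" if j: "j < p" "of_nat j * v \<in> {s. x 2 s \<in> Y}" for j
    proof -
      have "x 2 (of_nat j * v) \<in> x 2 ` {of_nat j * v |j. j < p} \<inter> Y" using j by blast
      then have "x 2 (of_nat j * v) = x 2 0" by (simp add: int x_zeros)
      then have "(of_nat j :: 'a) = 0" using v by (simp add: x2_inj)
      then show ?thesis using j(1) by (auto simp: of_nat_eq_0_iff_char_dvd CHAR_eq dest: dvd_imp_le)
    qed
    show "\<exists>j. s - of_nat j * v \<in> {s. x 2 s \<in> Y}" for s using ex by simp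
  qed
  then show "\<exists>\<eta>. (\<forall>s t. \<eta> (s + t) = \<eta> s * \<eta> t) \<and> \<eta> v = \<epsilon> \<and> (\<forall>s. x 2 s \<in> Y \<longrightarrow> \<eta> s = 1)" by simp
qed

text \<open>X_2 is generated by \<open>Y\<close> and x_2(v), so triviality on \<open>Y\<close> and
  one value determine the character there. \<open>N\<close> is the product of root subgroups on
  which triviality is required, X_5 X_6 or X_4 X_6.\<close>

lemma star_character_unique:
  assumes mu: "linear_character G (coord ` first_in C) \<mu>" and nu: "linear_character G (coord ` first_in C) \<nu>"
    and C: "0 \<in> C" "\<And>t. t \<in> C \<Longrightarrow> \<mu> (x 1 t) = \<nu> (x 1 t)"
    and Y: "complement_in G Y (x 2 ` {of_nat j * v |j. j < p}) (root_set G x {2})" "v \<noteq> 0"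
    and v: "\<mu> (x 2 v) = \<nu> (x 2 v)"
    and N: "\<one> \<in> N" "N \<subseteq> carrier G" "\<And>g. g \<in> Y <#> N \<Longrightarrow> \<mu> g = 1 \<and> \<nu> g = 1"
    and x: "\<And>i t. i \<in> {3,4,5,6} \<Longrightarrow> x i t \<in> N \<or> \<mu> (x i t) = \<nu> (x i t)"
  shows "\<mu> = \<nu>"
proof (rule linear_character_unique[OF mu nu C])
  note Y' = complement_character[OF Y]
  have YN: "g \<in> Y <#> N" if "g \<in> Y \<or> g \<in> N" for g
  proof -
    have "g = g \<otimes> \<one>" "g = \<one> \<otimes> g" using that N(2) Y'(1) by auto
    then show ?thesis using that Y'(2) N(1) unfolding set_mult_def by blast
  qed
  show "\<mu> (x 2 t) = \<nu> (x 2 t)" for t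
  proof -
    obtain j where j: "x 2 (t - of_nat j * v) \<in> Y" using Y'(3) by blast
    have pow: "\<kappa> (x 2 t) = \<kappa> (x 2 v) ^ j"
      if k: "linear_character G (coord ` first_in C) \<kappa>" and one: "\<kappa> (x 2 (t - of_nat j * v)) = 1" for \<kappa>
    proof -
      have "x 2 (of_nat j * v) \<in> coord ` first_in C" unfolding coord_x using C(1) by auto
      then have "\<kappa> (x 2 (of_nat j * v) \<otimes> x 2 (t - of_nat j * v)) = \<kappa> (x 2 (of_nat j * v)) * \<kappa> (x 2 (t - of_nat j * v))"
        by (intro linear_character_mult_left[OF k]) simp_all
      then have "\<kappa> (x 2 t) = \<kappa> (x 2 (of_nat j * v)) * \<kappa> (x 2 (t - of_nat j * v))"
        by (simp only: collect_add) simp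
      then show ?thesis using one linear_character_x2_multiple[OF k C(1)] by simp
    qed
    have "\<mu> (x 2 (t - of_nat j * v)) = 1 \<and> \<nu> (x 2 (t - of_nat j * v)) = 1" using N(3)[OF YN] j by simp
    then show ?thesis using pow[OF mu] pow[OF nu] v by simp
  qed
  have "\<mu> (x i t) = \<nu> (x i t)" if "i \<in> {3,4,5,6}" for i t
    using x[OF that, of t] N(3)[OF YN, of "x i t"] by auto
  then show "\<mu> (x 3 t) = \<nu> (x 3 t)" "\<mu> (x 4 t) = \<nu> (x 4 t)" "\<mu> (x 5 t) = \<nu> (x 5 t)" "\<mu> (x 6 t) = \<nu> (x 6 t)" for t
    by simp_all
qed

lemma push_star_eq_1:
  assumes "0 \<in> C" "\<xi> 0 = 1" "Y \<subseteq> range (x 2)" "\<And>s. x 2 s \<in> Y \<Longrightarrow> \<eta> s = 1"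
    and "N \<subseteq> {coord (0, 0, 0, a4, a5, a6) |a4 a5 a6. c4 * a4 + c5 * a5 = 0}" and "g \<in> Y <#> N"
  shows "push (star C \<xi> \<eta> (0, 0, c3, c4, c5, 0)) g = 1"
proof -
  obtain b a4 a5 a6 where g: "b \<in> Y" "g = b \<otimes> coord (0, 0, 0, a4, a5, a6)" "c4 * a4 + c5 * a5 = 0"
    using assms(5,6) unfolding set_mult_def by blast
  then obtain t where t: "b = x 2 t" using assms(3) by blast
  have "g = coord (0, t, 0, a4, a5, a6)" by (simp add: g t coord.simps x_zeros)
  then show ?thesis using g(1,3) t assms(1,2,4) by (simp add: star_def)
qed

lemma push_star_x:
  assumes "0 \<in> C" "\<xi> 0 = 1" "\<eta> 0 = 1"
  shows "t \<in> C \<Longrightarrow> push (star C \<xi> \<eta> (0, 0, c3, c4, c5, 0)) (x 1 t) = \<xi> t"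
    and "push (star C \<xi> \<eta> (0, 0, c3, c4, c5, 0)) (x 2 t) = \<eta> t"
    and "push (star C \<xi> \<eta> (0, 0, c3, c4, c5, 0)) (x 3 t \<otimes> x 4 u) = \<phi> (c3 * t + c4 * u)"
    and "push (star C \<xi> \<eta> (0, 0, c3, c4, c5, 0)) (x 3 t \<otimes> x 5 u) = \<phi> (c3 * t + c5 * u)"
proof -
  have "x 3 t \<otimes> x 4 u = coord (0, 0, t, u, 0, 0)" "x 3 t \<otimes> x 5 u = coord (0, 0, t, 0, u, 0)"
    by (simp_all add: coord.simps x_zeros)
  then show "push (star C \<xi> \<eta> (0, 0, c3, c4, c5, 0)) (x 3 t \<otimes> x 4 u) = \<phi> (c3 * t + c4 * u)"
    "push (star C \<xi> \<eta> (0, 0, c3, c4, c5, 0)) (x 3 t \<otimes> x 5 u) = \<phi> (c3 * t + c5 * u)"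
    using assms by (simp_all add: star_def)
qed (use assms in \<open>simp_all add: coord_x star_def\<close>)

end

section \<open>Characteristic 2\<close>

context G2_prime_power
begin

lemma conj_S3456:
  "\<exists>v. (0, 0, h3, h4, h5, h6) \<odot> (y1, y2, y3, y4, y5, y6)
     = (y1, y2, y3, y4, y5, y6) \<odot> (0, 0, h3, h4 - 2 * h3 * y2, h5 + 3 * h3 * y2\<^sup>2 - 3 * h4 * y2, v :: 'a)"
  by (rule exI[of _ "h6 - 6 * h3 * y2 * y3 - 3 * h3\<^sup>2 * y2 + 3 * h4 * y3 - h5 * y1 - 3 * y4 * h3"])
     (simp add: G2_tuples_def)

fun H2 :: "'a label2 \<Rightarrow> 'a tuple6 set" where
  "H2 (Two_a6 b2 a6) = S2456"
| "H2 (Two_a5 b1 b3 a5) = S13456"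
| "H2 (Two_a3 a3) = S13456"
| "H2 (Two_a4 a4) = S13456"
| "H2 (Two_a3_a4 d1 d2 a3 a4) = first_in {0, a4 / a3\<^sup>2}"
| "H2 (Two_lin b1 b2) = UNIV"

fun coef2 :: "'a label2 \<Rightarrow> 'a tuple6" where
  "coef2 (Two_a6 b2 a6) = (0, b2, 0, 0, 0, a6)"
| "coef2 (Two_a5 b1 b3 a5) = (b1, 0, b3, 0, a5, 0)"
| "coef2 (Two_a3 a3) = (0, 0, a3, 0, 0, 0)"
| "coef2 (Two_a4 a4) = (0, 0, 0, a4, 0, 0)"
| "coef2 (Two_a3_a4 d1 d2 a3 a4) = (0, 0, a3, a4, 0, 0)"
| "coef2 (Two_lin b1 b2) = (b1, b2, 0, 0, 0, 0)"

text \<open>Only the values on the group \<open>{0, a4 / a3\<^sup>2}\<close> of order 2 enter, and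
  there this is a character.\<close>

definition sign_char :: "nat \<Rightarrow> 'a \<Rightarrow> complex" where
  "sign_char d t = (if t = 0 then 1 else (- 1) ^ d)"

fun mu2 :: "(nat \<Rightarrow> 'a \<Rightarrow> 'a \<Rightarrow> 'a \<Rightarrow> complex) \<Rightarrow> 'a label2 \<Rightarrow> 'a tuple6 \<Rightarrow> complex" where
  "mu2 \<eta> (Two_a3_a4 d1 d2 a3 a4) = star {0, a4 / a3\<^sup>2} (sign_char d1) (\<eta> d2 a3 a4) (0, 0, a3, a4, 0, 0)"
| "mu2 \<eta> l = tchar (H2 l) (coef2 l)"

definition labels2 :: "'a label2 set" where
  "labels2 = {Two_a6 b2 a6 |b2 a6. a6 \<noteq> 0} \<union> {Two_a5 b1 b3 a5 |b1 b3 a5. a5 \<noteq> 0} \<union>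
    {Two_a3 a3 |a3. a3 \<noteq> 0} \<union> {Two_a4 a4 |a4. a4 \<noteq> 0} \<union>
    {Two_a3_a4 d1 d2 a3 a4 |d1 d2 a3 a4. d1 \<in> {0,1} \<and> d2 \<in> {0,1} \<and> a3 \<noteq> 0 \<and> a4 \<noteq> 0} \<union>
    {Two_lin b1 b2 |b1 b2. True}"

lemma labels2_iff [simp]:
  "Two_a6 b2 a6 \<in> labels2 \<longleftrightarrow> a6 \<noteq> 0"
  "Two_a5 b1 b3 a5 \<in> labels2 \<longleftrightarrow> a5 \<noteq> 0"
  "Two_a3 a3 \<in> labels2 \<longleftrightarrow> a3 \<noteq> 0"
  "Two_a4 a4 \<in> labels2 \<longleftrightarrow> a4 \<noteq> 0"
  "Two_a3_a4 d1 d2 a3 a4 \<in> labels2 \<longleftrightarrow> (d1 = 0 \<or> d1 = 1) \<and> (d2 = 0 \<or> d2 = 1) \<and> a3 \<noteq> 0 \<and> a4 \<noteq> 0"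
  "Two_lin b1 b2 \<in> labels2"
  by (auto simp: labels2_def)

end

text \<open>\<open>\<eta> d a3 a4\<close> extends to X_2 the character of Y' with value (-1)^d,
  trivially along the chosen complement. As a parameter it gives the exceptional characters an
  explicit formula; its existence for any \<open>Y\<close> is shown later.\<close>

locale G2_char_2 = G2_prime_power G x 2 f
  for G :: "('g, 'b) monoid_scheme" (structure) and x :: "nat \<Rightarrow> 'a::{field,finite} \<Rightarrow> 'g" and f +
  fixes Y :: "'a \<Rightarrow> 'a \<Rightarrow> 'g set" and \<eta> :: "nat \<Rightarrow> 'a \<Rightarrow> 'a \<Rightarrow> 'a \<Rightarrow> complex"
  assumes complement: "\<And>a3 a4. a3 \<noteq> 0 \<Longrightarrow> a4 \<noteq> 0 \<Longrightarrow>
      complement_in G (Y a3 a4) {\<one>, x 2 (a3 / a4)} (root_set G x {2})"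
    and eta: "\<And>d a3 a4. a3 \<noteq> 0 \<Longrightarrow> a4 \<noteq> 0 \<Longrightarrow>
      (\<forall>s t. \<eta> d a3 a4 (s + t) = \<eta> d a3 a4 s * \<eta> d a3 a4 t) \<and> \<eta> d a3 a4 (a3 / a4) = (- 1) ^ d \<and>
      (\<forall>s. x 2 s \<in> Y a3 a4 \<longrightarrow> \<eta> d a3 a4 s = 1)"
begin

lemma two: "(2 :: 'a) = 0"
  using of_nat_CHAR[where ?'a = 'a] by (simp add: CHAR_eq)

lemma three: "(3 :: 'a) = 1"
proof -
  have "(3 :: 'a) = 2 + 1" by simp
  then show ?thesis by (simp only: two) simp
qed

lemma neg [simp]: "- (t :: 'a) = t"
proof -
  have "t + t = 2 * t" by simp
  then have "t + t = 0" by (simp only: two) simp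
  then show ?thesis by (simp add: eq_neg_iff_add_eq_0 eq_commute[of "- t"])
qed

lemma add_self [simp]: "(t :: 'a) + t = 0"
  using neg[of t] by (metis add.right_inverse)

lemma eta_0: "a3 \<noteq> 0 \<Longrightarrow> a4 \<noteq> 0 \<Longrightarrow> \<eta> d a3 a4 0 = 1"
  and eta_nonzero: "a3 \<noteq> 0 \<Longrightarrow> a4 \<noteq> 0 \<Longrightarrow> \<eta> d a3 a4 s \<noteq> 0"
proof -
  assume a: "a3 \<noteq> 0" "a4 \<noteq> 0"
  note e = eta[OF a, of d]
  have "\<eta> d a3 a4 (0 + a3 / a4) = \<eta> d a3 a4 0 * \<eta> d a3 a4 (a3 / a4)" using e by blast
  moreover have "\<eta> d a3 a4 (a3 / a4) \<noteq> 0" using e by simp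
  ultimately show 0: "\<eta> d a3 a4 0 = 1" by simp
  have "\<eta> d a3 a4 (s + s) = \<eta> d a3 a4 s * \<eta> d a3 a4 s" using e by blast
  then show "\<eta> d a3 a4 s \<noteq> 0" using 0 by auto
qed

text \<open>In characteristic 2, \<open>\<phi> (a3 s b)\<close> and \<open>\<phi> (a4 s\<^sup>2 b)\<close> cancel exactly when \<open>b\<close> is \<open>0\<close> or \<open>a4 / a3\<^sup>2\<close>.\<close>

lemma star_invariant_iff:
  assumes "a3 \<noteq> 0"
  shows "(\<forall>s. \<phi> (a3 * s * b - a4 * s\<^sup>2 * b + 0 * s ^ 3 * b :: 'a) = 1) \<longleftrightarrow> b \<in> {0, a4 / a3\<^sup>2}"
proof -
  have "(\<forall>s. \<phi> (a3 * s * b - a4 * s\<^sup>2 * b + 0 * s ^ 3 * b) = 1) \<longleftrightarrow>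
      (\<forall>s. \<phi> ((a3 * b) * s + (- (a4 * b)) * s\<^sup>2) = 1)"
    by (simp add: mult_ac del: neg)
  also have "\<dots> \<longleftrightarrow> (a3 * b)\<^sup>2 + - (a4 * b) = 0"
    by (rule \<phi>_linearized_trivial_iff)
  also have "\<dots> \<longleftrightarrow> b * (a3\<^sup>2 * b - a4) = 0"
    by (simp add: algebra_simps power2_eq_square del: neg)
  also have "\<dots> \<longleftrightarrow> b \<in> {0, a4 / a3\<^sup>2}"
    using assms by (auto simp: field_simps)
  finally show ?thesis .
qed

lemma small_char_2: "small_char a4 0"
  by (simp add: small_char_def two)

lemma linear_mu2: "l \<in> labels2 \<Longrightarrow> tuple_linear (H2 l) (mu2 \<eta> l)"
proof (cases l)
  case (Two_a3_a4 d1 d2 a3 a4)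
  assume "l \<in> labels2"
  then have a: "a3 \<noteq> 0" "a4 \<noteq> 0" by (auto simp: Two_a3_a4)
  have "tuple_linear (first_in {0, a4 / a3\<^sup>2}) (star {0, a4 / a3\<^sup>2} (sign_char d1) (\<eta> d2 a3 a4) (0, 0, a3, a4, 0, 0))"
  proof (rule linear_star)
    show "\<phi> (a3 * s * b - a4 * s\<^sup>2 * b + 0 * s ^ 3 * b) = 1" if "b \<in> {0, a4 / a3\<^sup>2}" for b s
      using star_invariant_iff[OF a(1)] that by blast
    show "sign_char d1 (b + b') = sign_char d1 b * sign_char d1 b'"
      if "b \<in> {0, a4 / a3\<^sup>2}" "b' \<in> {0, a4 / a3\<^sup>2}" for b b'
      using that a by (auto simp: sign_char_def simp flip: power_add)
    show "\<eta> d2 a3 a4 (s + t) = \<eta> d2 a3 a4 s * \<eta> d2 a3 a4 t" for s t using eta[OF a] by blast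
  qed (use a eta_nonzero small_char_2 in \<open>auto simp: sign_char_def\<close>)
  then show ?thesis by (simp add: Two_a3_a4)
qed (use linear_S2456 linear_S13456 linear_UNIV in simp_all)

lemma mu2_S3456:
  assumes "l \<in> labels2" "h \<in> S3456" "h \<in> H2 l"
  shows "mu2 \<eta> l h = \<phi> (dot (coef2 l) h)"
proof (cases l)
  case (Two_a3_a4 d1 d2 a3 a4)
  then have a: "a3 \<noteq> 0" "a4 \<noteq> 0" using assms by auto
  obtain h1 h2 h3 h4 h5 h6 where "h = (h1, h2, h3, h4, h5, h6)" by (cases h)
  then show ?thesis using assms(2) eta_0[OF a] by (simp add: Two_a3_a4 star_def sign_char_def)
qed (use assms in \<open>simp_all add: tchar_def\<close>)

lemma S6_H2: "S6 \<subseteq> H2 l"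
  by (cases l) auto

lemma S3456_H2: "coef2 l = (l1, l2, l3, l4, l5, 0) \<Longrightarrow> l \<in> labels2 \<Longrightarrow> S3456 \<subseteq> H2 l"
  by (cases l) auto

text \<open>Coefficient 6 is an invariant, and when it is 0 so is coefficient 5. When both vanish,
  coefficients 3 and 4 are invariants too, because 2 = 0, and they single out the exceptional
  family. The other labels with subgroup \<open>S13456\<close> lead to y_2 = 0.\<close>

lemma labels2_compat:
  assumes lm: "l \<in> labels2" "m \<in> labels2"
    and C: "\<And>h h'. \<lbrakk>h \<in> H2 l; h' \<in> H2 m; h \<odot> y = y \<odot> h'\<rbrakk> \<Longrightarrow> mu2 \<eta> l h = mu2 \<eta> m h'"
  shows "l = m \<and> y \<in> H2 l"
proof -
  obtain y1 y2 y3 y4 y5 y6 where y: "y = (y1, y2, y3, y4, y5, y6)" by (cases y)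
  obtain l1 l2 l3 l4 l5 l6 where l: "coef2 l = (l1, l2, l3, l4, l5, l6)" by (cases "coef2 l")
  obtain m1 m2 m3 m4 m5 m6 where m: "coef2 m = (m1, m2, m3, m4, m5, m6)" by (cases "coef2 m")
  have C34: "\<phi> (dot (coef2 l) h) = \<phi> (dot (coef2 m) h')"
    if "h \<odot> y = y \<odot> h'" "h \<in> S3456 \<inter> H2 l" "h' \<in> S3456 \<inter> H2 m" for h h'
    using C[OF _ _ that(1)] that mu2_S3456 lm by auto
  have "snd (snd (snd (snd (snd (coef2 l))))) = snd (snd (snd (snd (snd (coef2 m)))))"
    by (rule compat_6[of y]) (rule C34; use S6_H2 S_subset(3) in blast)
  then have l6: "l6 = m6" by (simp add: l m)
  show ?thesis
  proof (cases "l6 = 0")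
    case False
    have l': "l = Two_a6 l2 l6" using False l by (cases l) auto
    have m': "m = Two_a6 m2 l6" using False m l6 by (cases m) auto
    have "\<phi> (dot (0, l2, 0, 0, 0, l6) h) = \<phi> (dot (0, m2, 0, 0, 0, l6) h')"
      if "h \<odot> y = y \<odot> h'" "h \<in> S2456" "h' \<in> S2456" for h h'
      using C[of h h'] that by (simp add: l' m' tchar_def)
    from compat_S2456[OF this False] show ?thesis by (simp add: l' m' three)
  next
    case True
    have sub: "S3456 \<subseteq> H2 l" "S3456 \<subseteq> H2 m"
      using S3456_H2 l m lm True l6 by blast+
    have D: "\<phi> (dot (l1, l2, l3, l4, l5, 0) h) = \<phi> (dot (m1, m2, m3, m4, m5, 0) h')"
      if "h \<odot> y = y \<odot> h'" "h \<in> S3456" "h' \<in> S3456" for h h'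
      using C34[of h h'] that sub True l6 l m by auto
    note e = compat_S3456[OF D y, simplified two three, simplified]
    show ?thesis
    proof (cases "\<exists>d1 d2 a3 a4. l = Two_a3_a4 d1 d2 a3 a4 \<or> m = Two_a3_a4 d1 d2 a3 a4")
      case False
      have S: "S13456 \<subseteq> H2 l" "S13456 \<subseteq> H2 m"
        using False True l6 l m lm by (cases l; auto; fail) (cases m; use False True l6 l m lm in auto)
      have "\<phi> (dot (l1, l2, l3, l4, l5, 0) h) = \<phi> (dot (m1, m2, m3, m4, m5, 0) h')"
        if "h \<odot> y = y \<odot> h'" "h \<in> S13456" "h' \<in> S13456" for h h'
      proof -
        have "mu2 \<eta> l h = \<phi> (dot (coef2 l) h)" "mu2 \<eta> m h' = \<phi> (dot (coef2 m) h')"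
          using False that S by (cases l; auto simp: tchar_def; fail) (cases m; use False that S in \<open>auto simp: tchar_def\<close>)
        then show ?thesis using C[of h h'] that S True l6 l m by auto
      qed
      note e' = compat_S13456[OF this y, simplified]
      have lin: "l1 = m1 \<and> l2 = m2" if "l = Two_lin l1 l2" "m = Two_lin m1 m2"
        by (rule compat_UNIV_lin[of y]) (use C that in \<open>auto simp: tchar_def\<close>)
      show ?thesis
        using e e' lin l m lm False True l6
        by (cases l; cases m) (auto simp: y)
    next
      case star: True
      have "l5 = 0 \<and> l4 \<noteq> 0 \<and> l3 \<noteq> 0 \<and> m5 = 0 \<and> m4 = l4 \<and> m3 = l3"
        using star e l m lm True l6 by (auto split: if_splits)
      then obtain d1 d2 d1' d2' where l': "l = Two_a3_a4 d1 d2 l3 l4" and m': "m = Two_a3_a4 d1' d2' l3 l4"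
        using l m lm True l6 by (cases l; cases m) auto
      have a: "l3 \<noteq> 0" "l4 \<noteq> 0" using lm l' by auto
      let ?C = "{0, l4 / l3\<^sup>2}"
      have H: "star ?C (sign_char d1) (\<eta> d2 l3 l4) (0, 0, l3, l4, 0, 0) h =
          star ?C (sign_char d1') (\<eta> d2' l3 l4) (0, 0, l3, l4, 0, 0) h'"
        if "h \<odot> y = y \<odot> h'" "h \<in> first_in ?C" "h' \<in> first_in ?C" for h h'
        using C[of h h'] that by (simp add: l' m')
      have inv: "\<phi> (l3 * s * b - l4 * s\<^sup>2 * b + 0 * s ^ 3 * b) = 1" if "b \<in> ?C" for b s
        using star_invariant_iff[OF a(1)] that by blast
      have st: "\<eta> d2 l3 l4 s = \<eta> d2' l3 l4 s * \<phi> (l3 * s * y1 - l4 * s\<^sup>2 * y1 + 0 * s ^ 3 * y1)"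
        "t \<in> ?C \<Longrightarrow> sign_char d1 t = sign_char d1' t" for s t
        by (rule compat_star[OF H y small_char_2 _ _ _ _ _ inv];
            use a eta_0 in \<open>simp add: sign_char_def\<close>)+
      \<comment> \<open>s = a_3/a_4 lies in the radical of the pairing, so y_1 drops out and the
        values of the two \<eta> at s can be compared.\<close>
      have "l3 * (l3 / l4) * y1 - l4 * (l3 / l4)\<^sup>2 * y1 + 0 * (l3 / l4) ^ 3 * y1 = 0"
        using a by (simp add: power2_eq_square)
      then have "(- 1 :: complex) ^ d2 = (- 1) ^ d2'"
        using st(1)[of "l3 / l4"] eta[OF a] by simp
      then have d2: "d2 = d2'" using lm by (auto simp: l' m')
      \<comment> \<open>With equal \<eta> the relation says that y_1 pairs trivially with all of
        X_2, so y_1 lies in the other radical.\<close>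
      have "\<phi> (l3 * s * y1 - l4 * s\<^sup>2 * y1 + 0 * s ^ 3 * y1) = 1" for s
        using st(1)[of s] eta_nonzero[OF a] by (simp add: d2)
      then have y1: "y1 \<in> ?C" using star_invariant_iff[OF a(1)] by blast
      have "(- 1 :: complex) ^ d1 = (- 1) ^ d1'"
        using st(2)[of "l4 / l3\<^sup>2"] a by (simp add: sign_char_def)
      then have "d1 = d1'" using lm by (auto simp: l' m')
      then show ?thesis using d2 y1 by (simp add: l' m' y)
    qed
  qed
qed

end

context G2_prime_power
begin

lemma set_mult_root_set:
  assumes "0 \<in> C"
  shows "x 1 ` C <#> root_set G x {2,3,4,5,6} = coord ` first_in C"
proof
  have e: "x 1 a \<otimes> coord (0, a2, a3, a4, a5, a6) = coord (a, a2, a3, a4, a5, a6)" for a a2 a3 a4 a5 a6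
    by (simp add: coord.simps x_zeros)
  show "x 1 ` C <#> root_set G x {2,3,4,5,6} \<subseteq> coord ` first_in C"
    unfolding root_sets set_mult_def by (auto simp: e)
  show "coord ` first_in C \<subseteq> x 1 ` C <#> root_set G x {2,3,4,5,6}"
  proof
    fix g assume "g \<in> coord ` first_in C"
    then obtain a a2 a3 a4 a5 a6 where g: "g = coord (a, a2, a3, a4, a5, a6)" "a \<in> C" by auto
    then have "g = x 1 a \<otimes> coord (0, a2, a3, a4, a5, a6)" by (simp add: e)
    moreover have "coord (0, a2, a3, a4, a5, a6) \<in> root_set G x {2,3,4,5,6}"
      unfolding root_sets by auto
    ultimately show "g \<in> x 1 ` C <#> root_set G x {2,3,4,5,6}"
      using g(2) unfolding set_mult_def by blast
  qed
qed

end

section \<open>Identification of the labelled characters in characteristic 2\<close>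

context G2_char_2
begin

abbreviation X2 :: "'a label2 \<Rightarrow> 'g \<Rightarrow> complex" where
  "X2 l \<equiv> induced G (coord ` H2 l) (push (mu2 \<eta> l))"

abbreviation deg2 :: "'a label2 \<Rightarrow> complex" where
  "deg2 l \<equiv> of_nat (CARD('a) ^ 6) / of_nat (card (H2 l))"

text \<open>For p = 2 each of X_6, X_5 X_6 and X_3 X_4 X_5 X_6 is central modulo the preceding one,
  the last because [x_2, x_3] has coefficient 2 at x_4. Where the earlier coefficients vanish, these
  elements act by scalars that reveal the next ones.\<close>

lemma X2_values:
  assumes l: "l \<in> labels2" "coef2 l = (l1, l2, l3, l4, l5, l6)"
  shows "X2 l (coord (0, 0, 0, 0, 0, s)) = deg2 l * \<phi> (l6 * s)"
    and "l6 = 0 \<Longrightarrow> X2 l (coord (0, 0, 0, 0, s, t)) = deg2 l * \<phi> (l5 * s)"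
    and "l6 = 0 \<Longrightarrow> l5 = 0 \<Longrightarrow> X2 l (coord (0, 0, u, v, s, t)) = deg2 l * \<phi> (l3 * u + l4 * v)"
proof -
  have val: "mu2 \<eta> l (0, 0, h3, h4, h5, h6) = \<phi> (l3 * h3 + l4 * h4 + l5 * h5 + l6 * h6)"
    if "(0, 0, h3, h4, h5, h6) \<in> H2 l" for h3 h4 h5 h6
    using mu2_S3456[OF l(1) _ that] by (simp add: l(2))
  show "X2 l (coord (0, 0, 0, 0, 0, s)) = deg2 l * \<phi> (l6 * s)"
  proof (rule induced_push_central[OF linear_mu2[OF l(1)]])
    fix y
    have "(0, 0, 0, 0, 0, s) \<in> H2 l" using S6_H2[of l] by auto
    then have "mu2 \<eta> l (0, 0, 0, 0, 0, s) = \<phi> (l6 * s)" using val by simp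
    moreover have "(0, 0, 0, 0, 0, s) \<odot> y = y \<odot> (0, 0, 0, 0, 0, s)"
      by (cases y) (simp add: G2_tuples_def)
    ultimately show "\<exists>z'. (0, 0, 0, 0, 0, s) \<odot> y = y \<odot> z' \<and> mu2 \<eta> l z' = \<phi> (l6 * s)" by blast
  qed
  assume l6: "l6 = 0"
  then have sub: "S3456 \<subseteq> H2 l" using S3456_H2 l by blast
  then have val': "mu2 \<eta> l (0, 0, h3, h4, h5, h6) = \<phi> (l3 * h3 + l4 * h4 + l5 * h5)" for h3 h4 h5 h6
    using val[OF subsetD[OF sub]] by (simp add: l6)
  show "X2 l (coord (0, 0, 0, 0, s, t)) = deg2 l * \<phi> (l5 * s)"
  proof (rule induced_push_central[OF linear_mu2[OF l(1)]])
    fix y :: "'a tuple6"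
    obtain y1 y2 y3 y4 y5 y6 where y: "y = (y1, y2, y3, y4, y5, y6)" by (cases y)
    obtain w where "(0, 0, 0, 0, s, t) \<odot> y = y \<odot> (0, 0, 0, 0, s, w)"
      unfolding y using conj_S3456[of 0 0 s t y1 y2 y3 y4 y5 y6] by auto
    moreover have "mu2 \<eta> l (0, 0, 0, 0, s, w) = \<phi> (l5 * s)" by (simp add: val')
    ultimately show "\<exists>z'. (0, 0, 0, 0, s, t) \<odot> y = y \<odot> z' \<and> mu2 \<eta> l z' = \<phi> (l5 * s)" by blast
  qed
  assume l5: "l5 = 0"
  show "X2 l (coord (0, 0, u, v, s, t)) = deg2 l * \<phi> (l3 * u + l4 * v)"
  proof (rule induced_push_central[OF linear_mu2[OF l(1)]])
    fix y :: "'a tuple6"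
    obtain y1 y2 y3 y4 y5 y6 where y: "y = (y1, y2, y3, y4, y5, y6)" by (cases y)
    obtain w where w: "(0, 0, u, v, s, t) \<odot> y = y \<odot> (0, 0, u, v - 2 * u * y2, s + 3 * u * y2\<^sup>2 - 3 * v * y2, w)"
      unfolding y using conj_S3456[of u v s t y1 y2 y3 y4 y5 y6] by blast
    have "v - 2 * u * y2 = v" by (simp add: two)
    then have "mu2 \<eta> l (0, 0, u, v - 2 * u * y2, s + 3 * u * y2\<^sup>2 - 3 * v * y2, w) = \<phi> (l3 * u + l4 * v)"
      by (simp only: val') (simp add: l5)
    with w show "\<exists>z'. (0, 0, u, v, s, t) \<odot> y = y \<odot> z' \<and> mu2 \<eta> l z' = \<phi> (l3 * u + l4 * v)" by blast
  qed
qed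

lemma d2_nonzero: "l \<in> labels2 \<Longrightarrow> deg2 l \<noteq> 0"
  using linear_mu2[of l] by (simp add: tuple_linear_def card_eq_0_iff)

lemma X2_one: "l \<in> labels2 \<Longrightarrow> X2 l \<one> = deg2 l"
  by (rule induced_push_one[OF linear_mu2])

text \<open>The switch \<open>e\<close> treats both families at once: e = 1 is root 3, e = 0 is root
  4. For uniqueness, bijectivity gives any candidate a label; the kernel condition kills all but one
  of its coefficients 3 to 6, and the restriction condition makes the remaining one equal to
  \<open>a\<close>.\<close>

lemma irr_above_eq:
  fixes e :: 'a
  assumes bij: "bij_betw X2 labels2 (Irr G)" and a: "a \<noteq> 0" and e: "e = 0 \<or> e = 1"
    and l0: "l0 = (if e = 1 then Two_a3 a else Two_a4 a)"
    and N: "N = {coord (0, 0, (1 - e) * r, e * r, s, t) |r s t. True}"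
    and xi: "\<And>t. x i t = coord (0, 0, e * t, (1 - e) * t, 0, 0)"
  shows "irr_above G x N i a = X2 l0"
proof -
  have ker: "g \<in> character_kernel G (X2 l) \<longleftrightarrow> g \<in> carrier G \<and> X2 l g = deg2 l" if "l \<in> labels2" for l g
    using X2_one[OF that] by (auto simp: character_kernel_def)
  have trivial: "c = 0" if "l \<in> labels2" "\<And>s. deg2 l * \<phi> (c * s) = deg2 l" for c :: 'a and l
    using that d2_nonzero \<phi>_trivial_iff[of c] by (metis mult_cancel_left1 mult_cancel_left2)
  have scalar: "c = a" if l: "l \<in> labels2" and m: "\<And>s. deg2 l * \<phi> (c * s) = of_nat m * \<phi> (a * s)" for c :: 'a and l m
  proof (rule \<phi>_inj)
    fix s
    \<comment> \<open>At s = 0 the condition fixes the unspecified multiplicity as the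
      degree.\<close>
    have "deg2 l = of_nat m" using m[of 0] by simp
    then show "\<phi> (c * s) = \<phi> (a * s)" using m[of s] d2_nonzero[OF l] by (metis mult_cancel_left)
  qed
  have l: "l0 \<in> labels2" "coef2 l0 = (0, 0, e * a, (1 - e) * a, 0, 0)" and d: "deg2 l0 = of_nat CARD('a)"
    using a e by (auto simp: l0 card_S numeral_eq_Suc)
  show ?thesis
    unfolding irr_above_def
  proof (rule the_equality, intro conjI)
    show "X2 l0 \<in> Irr G" by (rule bij_betw_apply[OF bij l(1)])
    show "N \<subseteq> character_kernel G (X2 l0)"
    proof
      fix g assume "g \<in> N"
      then obtain r s t where g: "g = coord (0, 0, (1 - e) * r, e * r, s, t)" unfolding N by blast
      have "X2 l0 g = deg2 l0" using X2_values(3)[OF l refl refl] e by (auto simp: g)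
      then show "g \<in> character_kernel G (X2 l0)" unfolding ker[OF l(1)] by (simp add: g)
    qed
    show "\<exists>m. \<forall>t. X2 l0 (x i t) = of_nat m * \<phi> (a * t)"
    proof (rule exI, rule allI)
      fix t
      have "e * a * (e * t) + (1 - e) * a * ((1 - e) * t) = a * t" using e by auto
      then show "X2 l0 (x i t) = of_nat CARD('a) * \<phi> (a * t)"
        by (simp only: xi X2_values(3)[OF l refl refl] d)
    qed
  next
    fix \<chi> assume chi: "\<chi> \<in> Irr G \<and> N \<subseteq> character_kernel G \<chi> \<and> (\<exists>m. \<forall>t. \<chi> (x i t) = of_nat m * \<phi> (a * t))"
    then have "\<chi> \<in> X2 ` labels2" using bij by (simp add: bij_betw_def)
    then obtain k where k: "k \<in> labels2" "\<chi> = X2 k" by (rule imageE) simp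
    obtain k1 k2 k3 k4 k5 k6 where c: "coef2 k = (k1, k2, k3, k4, k5, k6)" by (cases "coef2 k")
    have "coord (0, 0, (1 - e) * r, e * r, s, t) \<in> character_kernel G (X2 k)" for r s t
      using chi unfolding N k(2) by blast
    then have K: "X2 k (coord (0, 0, (1 - e) * r, e * r, s, t)) = deg2 k" for r s t
      using ker[OF k(1)] by simp
    have k6: "k6 = 0"
      by (rule trivial[OF k(1)]) (use K[of 0 0] X2_values(1)[OF k(1) c] in simp)
    have k5: "k5 = 0"
      by (rule trivial[OF k(1)]) (use K[of 0 _ 0] X2_values(2)[OF k(1) c k6] in simp)
    note v = X2_values(3)[OF k(1) c k6 k5]
    have n: "k3 * (1 - e) + k4 * e = 0"
      by (rule trivial[OF k(1)]) (use K[of _ 0 0] v in \<open>simp add: algebra_simps\<close>)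
    obtain m where "\<forall>t. \<chi> (x i t) = of_nat m * \<phi> (a * t)" using chi by blast
    then have "k3 * e + k4 * (1 - e) = a"
      by (intro scalar[OF k(1), of _ m]) (use v[of _ _ 0 0] in \<open>simp add: k(2) xi algebra_simps\<close>)
    then show "\<chi> = X2 l0"
      using k c k6 k5 n e a unfolding l0 by (cases k) auto
  qed
qed

lemma irr_above_2:
  assumes "bij_betw X2 labels2 (Irr G)" "a \<noteq> 0"
  shows "irr_above G x (root_set G x {4,5,6}) 3 a = X2 (Two_a3 a)"
    and "irr_above G x (root_set G x {3,5,6}) 4 a = X2 (Two_a4 a)"
  using irr_above_eq[OF assms, of 1] irr_above_eq[OF assms, of 0] by (simp_all add: root_sets coord_x)

lemma complement_2:
  assumes "a3 \<noteq> 0" "a4 \<noteq> 0"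
  shows "complement_in G (Y a3 a4) (x 2 ` {of_nat j * (a3 / a4) |j. j < 2}) (root_set G x {2})"
proof -
  have "{of_nat j * (a3 / a4) |j. j < 2} = {0, a3 / a4}"
    by (auto simp: less_2_cases_iff intro: exI[of _ 0] exI[of _ 1])
  then show ?thesis using complement[OF assms] by (simp add: x_zeros)
qed

lemma star_label_2:
  assumes l: "Two_a3_a4 d1 d2 a3 a4 \<in> labels2"
  shows "chi2 G x Y (Two_a3_a4 d1 d2 a3 a4) = X2 (Two_a3_a4 d1 d2 a3 a4)"
proof -
  have a: "a3 \<noteq> 0" "a4 \<noteq> 0" using l by auto
  let ?c = "a4 / a3\<^sup>2" and ?v = "a3 / a4"
  let ?C = "{0, ?c}"
  let ?H = "coord ` first_in ?C"
  let ?Y = "Y a3 a4"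
  let ?\<mu> = "push (mu2 \<eta> (Two_a3_a4 d1 d2 a3 a4))"
  let ?P = "\<lambda>\<mu>. linear_character G ?H \<mu> \<and> (\<forall>g \<in> ?Y <#> root_set G x {5,6}. \<mu> g = 1) \<and>
           (\<forall>t3 t4. \<mu> (x 3 t3 \<otimes> x 4 t4) = \<phi> (a3 * t3 + a4 * t4)) \<and>
           \<mu> (x 1 ?c) = (-1) ^ d1 \<and> \<mu> (x 2 ?v) = (-1) ^ d2"
  have v0: "?v \<noteq> 0" using a by simp
  note Y = complement_character[OF complement_2[OF a] v0]
  have "{\<one>, x 1 ?c} = x 1 ` ?C" by (simp add: x_zeros)
  then have H: "{\<one>, x 1 ?c} <#> root_set G x {2,3,4,5,6} = ?H"
    using set_mult_root_set[of ?C] by simp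
  have N: "\<one> \<in> root_set G x {5,6}" "root_set G x {5,6} \<subseteq> carrier G" "x 5 t \<in> root_set G x {5,6}" "x 6 t \<in> root_set G x {5,6}"
    "root_set G x {5,6} \<subseteq> {coord (0, 0, 0, a4', a5, a6) |a4' a5 a6. a4 * a4' + 0 * a5 = 0}" for t
    unfolding root_sets coord_x by (auto simp flip: x_zeros(6) simp: coord_x)
  have 1: "sign_char d1 0 = 1" "\<eta> d2 a3 a4 0 = 1" using eta_0[OF a] by (simp_all add: sign_char_def)
  have C0: "0 \<in> ?C" by simp
  note val = push_star_x[where \<xi> = "sign_char d1" and \<eta> = "\<eta> d2 a3 a4", OF C0 1, where ?c3.0 = a3 and ?c4.0 = a4 and ?c5.0 = 0]
  have P: "?P ?\<mu>"
  proof (intro conjI ballI allI)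
    show "linear_character G ?H ?\<mu>"
      using linear_character_push[OF linear_mu2[OF l]] by simp
    show "?\<mu> (x 1 ?c) = (-1) ^ d1" "?\<mu> (x 2 ?v) = (-1) ^ d2" "?\<mu> (x 3 t3 \<otimes> x 4 t4) = \<phi> (a3 * t3 + a4 * t4)" for t3 t4
      using val a eta[OF a] by (simp_all add: sign_char_def)
    show "?\<mu> g = 1" if "g \<in> ?Y <#> root_set G x {5,6}" for g
      using push_star_eq_1[where \<xi> = "sign_char d1" and \<eta> = "\<eta> d2 a3 a4" and ?c3.0 = a3, OF C0 1(1) Y(1) _ N(5) that] eta[OF a] by simp
  qed
  have "(THE \<mu>. ?P \<mu>) = ?\<mu>"
  proof (rule the_equality, rule P)
    fix \<mu> assume mu: "?P \<mu>"
    show "\<mu> = ?\<mu>"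
    proof (rule star_character_unique[of ?C, OF _ _ C0 _ complement_2[OF a] v0 _ N(1,2)])
      show "x i t \<in> root_set G x {5,6} \<or> \<mu> (x i t) = ?\<mu> (x i t)" if "i \<in> {3,4,5,6}" for i t
      proof -
        have "\<mu> (x 3 t \<otimes> x 4 0) = ?\<mu> (x 3 t \<otimes> x 4 0)" "\<mu> (x 3 0 \<otimes> x 4 t) = ?\<mu> (x 3 0 \<otimes> x 4 t)"
          using mu P by simp_all
        then show ?thesis using that N(3,4) by (auto simp: x_zeros)
      qed
      show "\<mu> (x 1 t) = ?\<mu> (x 1 t)" if "t \<in> ?C" for t
        using that mu P linear_character_one[of ?H \<mu>] linear_character_one[of ?H ?\<mu>] by (auto simp: x_zeros)
    qed (use mu P in auto)
  qed
  then show ?thesis by (simp only: chi2.simps Let_def H H2.simps)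
qed

lemma chi2_eq:
  assumes "bij_betw X2 labels2 (Irr G)" "l \<in> labels2"
  shows "chi2 G x Y l = X2 l"
proof (cases l)
  case (Two_a6 b2 a6)
  have "root_ind G x {2,4,5,6} (\<lambda>t. b2 * t 2 + a6 * t 6) = induced G (coord ` S2456) (push (tchar S2456 (0, b2, 0, 0, 0, a6)))"
    by (rule root_ind_eq[OF root_sets(1) linear_S2456, where F = "\<lambda>t. (0, t 2, 0, t 4, t 5, t 6)"])
       (simp add: root_prods)
  then show ?thesis by (simp add: Two_a6)
next
  case (Two_a5 b1 b3 a5)
  have "root_ind G x {1,3,4,5,6} (\<lambda>t. b1 * t 1 + b3 * t 3 + a5 * t 5) = induced G (coord ` S13456) (push (tchar S13456 (b1, 0, b3, 0, a5, 0)))"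
    by (rule root_ind_eq[OF root_sets(2) linear_S13456, where F = "\<lambda>t. (t 1, 0, t 3, t 4, t 5, t 6)"])
       (simp add: root_prods)
  then show ?thesis by (simp add: Two_a5)
next
  case (Two_lin b1 b2)
  show ?thesis by (simp add: Two_lin root_linear_UNIV)
qed (use assms irr_above_2[OF assms(1)] star_label_2 in \<open>simp_all del: chi2.simps(5) mu2.simps(1)\<close>)

definition tab2 :: "('a label2 set \<times> real \<times> real) list" where
  "tab2 = (let q = real CARD('a) in
    [({Two_a6 b2 a6 |b2 a6. a6 \<noteq> 0}, q * (q - 1), q ^ 2),
     ({Two_a5 b1 b3 a5 |b1 b3 a5. a5 \<noteq> 0}, q ^ 2 * (q - 1), q),
     ({Two_a3 a3 |a3. a3 \<noteq> 0}, q - 1, q),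
     ({Two_a4 a4 |a4. a4 \<noteq> 0}, q - 1, q),
     ({Two_a3_a4 d1 d2 a3 a4 |d1 d2 a3 a4.
         d1 \<in> {0,1} \<and> d2 \<in> {0,1} \<and> a3 \<noteq> 0 \<and> a4 \<noteq> 0}, 4 * (q - 1) ^ 2, q / 2),
     ({Two_lin b1 b2 |b1 b2. True}, q ^ 2, 1)])"

lemma tab2_rows:
  assumes "(L, n, d) \<in> set tab2"
  shows "finite L \<and> real (card L) = n \<and>
    (\<forall>l\<in>L. tuple_linear (H2 l) (mu2 \<eta> l) \<and> real CARD('a) ^ 6 = d * real (card (H2 l)))"
proof -
  let ?N = "- {0 :: 'a}"
  have img:
    "{Two_a6 b2 a6 |b2 a6. a6 \<noteq> (0 :: 'a)} = (\<lambda>(b2, a6). Two_a6 b2 a6) ` (UNIV \<times> ?N)"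
    "{Two_a5 b1 b3 a5 |b1 b3 a5. a5 \<noteq> (0 :: 'a)} = (\<lambda>(b1, b3, a5). Two_a5 b1 b3 a5) ` (UNIV \<times> UNIV \<times> ?N)"
    "{Two_a3 a3 |a3. a3 \<noteq> (0 :: 'a)} = Two_a3 ` ?N"
    "{Two_a4 a4 |a4. a4 \<noteq> (0 :: 'a)} = Two_a4 ` ?N"
    "{Two_a3_a4 d1 d2 a3 a4 |d1 d2 a3 a4. d1 \<in> {0,1} \<and> d2 \<in> {0,1} \<and> a3 \<noteq> (0 :: 'a) \<and> a4 \<noteq> (0 :: 'a)}
      = (\<lambda>(d1, d2, a3, a4). Two_a3_a4 d1 d2 a3 a4) ` ({0,1} \<times> {0,1} \<times> ?N \<times> ?N)"
    "{Two_lin b1 b2 |b1 b2 :: 'a. True} = (\<lambda>(b1, b2). Two_lin b1 b2) ` (UNIV \<times> UNIV)"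
    by (auto simp: image_iff)
  have two: "card {0, a4 / a3\<^sup>2} = 2" if "a3 \<noteq> 0" "a4 \<noteq> 0" for a3 a4 :: 'a using that by simp
  have deg: "real CARD('a) ^ 6 = real CARD('a) / 2 * real (card (first_in {0, a4 / a3\<^sup>2}))"
    if "a3 \<noteq> 0" "a4 \<noteq> 0" for a3 a4 :: 'a
    unfolding card_S two[OF that] by (simp add: numeral_eq_Suc)
  have "L \<subseteq> labels2"
    using assms by (auto simp: tab2_def Let_def)
  moreover have "finite L \<and> real (card L) = n"
  proof -
    have "\<forall>r\<in>set tab2. finite (fst r) \<and> real (card (fst r)) = fst (snd r)"
      unfolding tab2_def Let_def img
      by (simp add: card_image inj_on_def card_cartesian_product card_nonzero power2_eq_square)
    then show ?thesis using assms by force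
  qed
  moreover have "\<forall>l\<in>L. real CARD('a) ^ 6 = d * real (card (H2 l))"
  proof -
    have "\<forall>r\<in>set tab2. \<forall>l\<in>fst r. real CARD('a) ^ 6 = snd (snd r) * real (card (H2 l))"
      unfolding tab2_def Let_def
    proof (simp only: list.set ball_simps(5,7) fst_conv snd_conv, intro conjI ballI)
      fix l :: "'a label2"
      assume "l \<in> {Two_a3_a4 d1 d2 a3 a4 |d1 d2 a3 a4. d1 \<in> {0,1} \<and> d2 \<in> {0,1} \<and> a3 \<noteq> 0 \<and> a4 \<noteq> 0}"
      then obtain d1 d2 a3 a4 where l: "l = Two_a3_a4 d1 d2 a3 a4" "a3 \<noteq> 0" "a4 \<noteq> 0" by blast
      show "real CARD('a) ^ 6 = real CARD('a) / 2 * real (card (H2 l))"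
        using deg[OF l(2,3)] by (simp only: l(1) H2.simps)
    qed (auto simp: card_S(4) simp flip: card_eq_degree simp del: card_prod)
    then show ?thesis using assms by force
  qed
  ultimately show ?thesis using linear_mu2 by blast
qed

lemma Irr_table_2:
  shows "Irr_table G (chi2 G x Y) tab2"
    and "real (card (Irr G)) = real CARD('a) ^ 3 + 5 * real CARD('a) ^ 2 - 7 * real CARD('a) + 2"
proof -
  have U: "(\<Union>(L, n, d)\<in>set tab2. L) = labels2"
    by (auto simp: tab2_def Let_def labels2_def)
  have disj: "sorted_wrt (\<lambda>r s. fst r \<inter> fst s = {}) tab2"
    by (auto simp: tab2_def Let_def)
  \<comment> \<open>The four choices of d_1, d_2 make up for the halved degree, so the exceptional
    family contributes q^2 (q-1)^2. With \<open>Two_a3\<close>, \<open>Two_a4\<close> and the linear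
    characters this gives q^4, the order of U(q)/(X_5 X_6).\<close>
  have total: "(\<Sum>(L, n, d)\<leftarrow>tab2. n * d\<^sup>2) = real CARD('a) ^ 6"
    by (simp add: tab2_def Let_def field_simps power2_eq_square numeral_eq_Suc)
  have T: "bij_betw X2 (\<Union>(L, n, d)\<in>set tab2. L) (Irr G) \<and>
    real (card (Irr G)) = (\<Sum>(L, n, d)\<leftarrow>tab2. n) \<and>
    (\<forall>\<chi>. (\<forall>l\<in>(\<Union>(L, n, d)\<in>set tab2. L). \<chi> l = X2 l) \<longrightarrow> Irr_table G \<chi> tab2)"
  proof (rule Irr_tableI[OF disj _ _ total])
    show "finite L \<and> real (card L) = n \<and>
      (\<forall>l\<in>L. tuple_linear (H2 l) (mu2 \<eta> l) \<and> real CARD('a) ^ 6 = d * real (card (H2 l)))"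
      if "(L, n, d) \<in> set tab2" for L n d by (rule tab2_rows[OF that])
    show "l = m \<and> y \<in> H2 l"
      if "l \<in> (\<Union>(L, n, d)\<in>set tab2. L)" "m \<in> (\<Union>(L, n, d)\<in>set tab2. L)"
        "\<And>h h'. \<lbrakk>h \<in> H2 l; h' \<in> H2 m; h \<odot> y = y \<odot> h'\<rbrakk> \<Longrightarrow> mu2 \<eta> l h = mu2 \<eta> m h'" for l m y
      using labels2_compat[OF _ _ that(3)] that(1,2) unfolding U by blast
  qed
  then have bij: "bij_betw X2 labels2 (Irr G)" unfolding U by (rule conjunct1)
  have "\<forall>l\<in>labels2. chi2 G x Y l = X2 l" using chi2_eq[OF bij] by (rule ballI)
  then show "Irr_table G (chi2 G x Y) tab2" using T unfolding U by blast
  show "real (card (Irr G)) = real CARD('a) ^ 3 + 5 * real CARD('a) ^ 2 - 7 * real CARD('a) + 2"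
    using T[THEN conjunct2, THEN conjunct1]
    by (simp add: tab2_def Let_def algebra_simps power2_eq_square numeral_eq_Suc)
qed

end

section \<open>Characteristic 3\<close>

context G2_prime_power
begin

text \<open>For nonzero a_5 this says that -a_3/a_5 is a nonzero square, equivalently that a_3 s +
  a_5 s^3 has a nonzero root s.\<close>

definition star_pair :: "'a \<Rightarrow> 'a \<Rightarrow> bool" where
  "star_pair a3 a5 \<longleftrightarrow> a5 \<noteq> 0 \<and> a3 \<in> (\<lambda>s. - a5 * s) ` nonzero_squares"

fun coef3 :: "'a label3 \<Rightarrow> 'a tuple6" where
  "coef3 (Three_a4_a6 a4 a6) = (0, 0, 0, a4, 0, a6)"
| "coef3 (Three_a6 b2 b3 a6) = (0, b2, b3, 0, 0, a6)"
| "coef3 (Three_a4 b1 b5 a4) = (b1, 0, 0, a4, b5, 0)"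
| "coef3 (Three_a3_a5 a3 a5) = (0, 0, a3, 0, a5, 0)"
| "coef3 (Three_a3 a3) = (0, 0, a3, 0, 0, 0)"
| "coef3 (Three_a5 a5) = (0, 0, 0, 0, a5, 0)"
| "coef3 (Three_a3s_a5 e1 e2 a3 a5) = (0, 0, a3, 0, a5, 0)"
| "coef3 (Three_lin b1 b2) = (b1, b2, 0, 0, 0, 0)"

text \<open>\<open>r a3 a5\<close> will be the generator 1/(a_3 \<omega>) of X', which depends on
  the chosen square root.\<close>

fun H3 :: "('a \<Rightarrow> 'a \<Rightarrow> 'a) \<Rightarrow> 'a label3 \<Rightarrow> 'a tuple6 set" where
  "H3 r (Three_a4_a6 a4 a6) = S3456"
| "H3 r (Three_a6 b2 b3 a6) = S23456"
| "H3 r (Three_a4 b1 b5 a4) = S13456"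
| "H3 r (Three_a3_a5 a3 a5) = S23456"
| "H3 r (Three_a3 a3) = S23456"
| "H3 r (Three_a5 a5) = S23456"
| "H3 r (Three_a3s_a5 e1 e2 a3 a5) = first_in {0, r a3 a5, - r a3 a5}"
| "H3 r (Three_lin b1 b2) = UNIV"

definition labels3 :: "'a label3 set" where
  "labels3 = {Three_a4_a6 a4 a6 |a4 a6. a4 \<noteq> 0 \<and> a6 \<noteq> 0} \<union> {Three_a6 b2 b3 a6 |b2 b3 a6. a6 \<noteq> 0} \<union>
    {Three_a4 b1 b5 a4 |b1 b5 a4. a4 \<noteq> 0} \<union>
    {Three_a3_a5 a3 a5 |a3 a5. a5 \<noteq> 0 \<and> a3 \<noteq> 0 \<and> a3 \<notin> (\<lambda>s. - a5 * s) ` nonzero_squares} \<union>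
    {Three_a3 a3 |a3. a3 \<noteq> 0} \<union> {Three_a5 a5 |a5. a5 \<noteq> 0} \<union>
    {Three_a3s_a5 e1 e2 a3 a5 |e1 e2 a3 a5.
      e1 \<in> {0,1,2} \<and> e2 \<in> {0,1,2} \<and> a5 \<noteq> 0 \<and> a3 \<in> (\<lambda>s. - a5 * s) ` nonzero_squares} \<union>
    {Three_lin b1 b2 |b1 b2. True}"

lemma labels3_iff [simp]:
  "Three_a4_a6 a4 a6 \<in> labels3 \<longleftrightarrow> a4 \<noteq> 0 \<and> a6 \<noteq> 0"
  "Three_a6 b2 b3 a6 \<in> labels3 \<longleftrightarrow> a6 \<noteq> 0"
  "Three_a4 b1 b5 a4 \<in> labels3 \<longleftrightarrow> a4 \<noteq> 0"
  "Three_a3_a5 a3 a5 \<in> labels3 \<longleftrightarrow> a5 \<noteq> 0 \<and> a3 \<noteq> 0 \<and> \<not> star_pair a3 a5"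
  "Three_a3 a3 \<in> labels3 \<longleftrightarrow> a3 \<noteq> 0"
  "Three_a5 a5 \<in> labels3 \<longleftrightarrow> a5 \<noteq> 0"
  "Three_a3s_a5 e1 e2 a3 a5 \<in> labels3 \<longleftrightarrow> e1 \<in> {0,1,2} \<and> e2 \<in> {0,1,2} \<and> star_pair a3 a5"
  "Three_lin b1 b2 \<in> labels3"
  by (auto simp: labels3_def star_pair_def)

end

locale G2_char_3 = G2_prime_power G x 3 f
  for G :: "('g, 'b) monoid_scheme" (structure) and x :: "nat \<Rightarrow> 'a::{field,finite} \<Rightarrow> 'g" and f +
  fixes \<zeta> :: complex and w :: "'a \<Rightarrow> 'a \<Rightarrow> 'a" and Y :: "'a \<Rightarrow> 'a \<Rightarrow> 'g set"
    and \<eta> :: "nat \<Rightarrow> 'a \<Rightarrow> 'a \<Rightarrow> 'a \<Rightarrow> complex"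
  assumes zeta: "\<zeta> ^ 3 = 1" "\<zeta> \<noteq> 1"
    and w: "\<And>a3 a5. star_pair a3 a5 \<Longrightarrow> (w a3 a5)\<^sup>2 = - a3 / a5"
    and complement: "\<And>a3 a5. star_pair a3 a5 \<Longrightarrow>
      complement_in G (Y a3 a5) {\<one>, x 2 (w a3 a5), x 2 (- w a3 a5)} (root_set G x {2})"
    and eta: "\<And>e a3 a5. star_pair a3 a5 \<Longrightarrow>
      (\<forall>s t. \<eta> e a3 a5 (s + t) = \<eta> e a3 a5 s * \<eta> e a3 a5 t) \<and> \<eta> e a3 a5 (w a3 a5) = \<zeta> ^ e \<and>
      (\<forall>s. x 2 s \<in> Y a3 a5 \<longrightarrow> \<eta> e a3 a5 s = 1)"
begin

lemma three: "(3 :: 'a) = 0"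
  using of_nat_CHAR[where ?'a = 'a] by (simp add: CHAR_eq)

lemma two: "(2 :: 'a) = - 1"
proof -
  have "(2 :: 'a) + 1 = 3" by simp
  then have "(2 :: 'a) + 1 = 0" by (simp only: three)
  then show ?thesis by (simp only: eq_neg_iff_add_eq_0)
qed

lemma add_self: "(t :: 'a) + t = - t"
proof -
  have "t + t = 2 * t" by simp
  then show ?thesis by (simp only: two) simp
qed

lemma neg_eq_self_iff [simp]: "- (t :: 'a) = t \<longleftrightarrow> t = 0" "t = - t \<longleftrightarrow> t = 0"
proof -
  have "- t = t \<longleftrightarrow> t + t = 0" by (metis add.inverse_unique add.right_inverse)
  then show "- t = t \<longleftrightarrow> t = 0" by (simp add: add_self)
  then show "t = - t \<longleftrightarrow> t = 0" by metis
qed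

definition r :: "'a \<Rightarrow> 'a \<Rightarrow> 'a" where
  "r a3 a5 = 1 / (a3 * w a3 a5)"

abbreviation C3 :: "'a \<Rightarrow> 'a \<Rightarrow> 'a set" where
  "C3 a3 a5 \<equiv> {0, r a3 a5, - r a3 a5}"

lemma star_pair_nonzero:
  assumes "star_pair a3 a5"
  shows "a3 \<noteq> 0" "a5 \<noteq> 0" "w a3 a5 \<noteq> 0" "r a3 a5 \<noteq> 0"
proof -
  show a: "a3 \<noteq> 0" "a5 \<noteq> 0" using assms by (auto simp: star_pair_def nonzero_squares_def)
  show "w a3 a5 \<noteq> 0" using w[OF assms] a by auto
  then show "r a3 a5 \<noteq> 0" using a by (simp add: r_def)
qed

text \<open>A character of the group {0, b, -b} of order 3: the last case is meant for -b = 2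
  b.\<close>

definition cube_char :: "nat \<Rightarrow> 'a \<Rightarrow> 'a \<Rightarrow> complex" where
  "cube_char e b t = (if t = 0 then 1 else if t = b then \<zeta> ^ e else \<zeta> ^ (2 * e))"

fun mu3 :: "'a label3 \<Rightarrow> 'a tuple6 \<Rightarrow> complex" where
  "mu3 (Three_a3s_a5 e1 e2 a3 a5) = star (C3 a3 a5) (cube_char e1 (r a3 a5)) (\<eta> e2 a3 a5) (0, 0, a3, 0, a5, 0)"
| "mu3 l = tchar (H3 r l) (coef3 l)"

lemma zeta_inj:
  assumes "\<zeta> ^ d = \<zeta> ^ e" "d \<in> {0,1,2}" "e \<in> {0,1,2}"
  shows "d = e"
proof -
  have z: "\<zeta> * \<zeta> * \<zeta> = 1" using zeta(1) by (simp add: power3_eq_cube)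
  then have "\<zeta> \<noteq> 0" by auto
  moreover have "\<zeta> * \<zeta> \<noteq> 1" using z zeta(2) by auto
  ultimately show ?thesis using assms zeta(2) by (auto simp: power2_eq_square)
qed

lemma eta_0: "star_pair a3 a5 \<Longrightarrow> \<eta> e a3 a5 0 = 1"
  and eta_nonzero: "star_pair a3 a5 \<Longrightarrow> \<eta> e a3 a5 s \<noteq> 0"
proof -
  assume a: "star_pair a3 a5"
  note e = eta[OF a, of e]
  have z: "\<zeta> \<noteq> 0" using zeta(1) by auto
  have "\<eta> e a3 a5 (0 + w a3 a5) = \<eta> e a3 a5 0 * \<eta> e a3 a5 (w a3 a5)" using e by blast
  moreover have "\<eta> e a3 a5 (w a3 a5) \<noteq> 0" using e z by simp
  ultimately show 0: "\<eta> e a3 a5 0 = 1" by simp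
  have "\<eta> e a3 a5 (s + - s) = \<eta> e a3 a5 s * \<eta> e a3 a5 (- s)" using e by blast
  then show "\<eta> e a3 a5 s \<noteq> 0" using 0 by auto
qed

text \<open>In characteristic 3, \<open>\<phi> (a3 s b)\<close> and \<open>\<phi> (a5 s\<^sup>3 b)\<close> cancel exactly when \<open>a3\<^sup>3 b\<^sup>3 + a5 b = 0\<close>.
  For \<open>b \<noteq> 0\<close> this exhibits \<open>- a3 / a5\<close> as a square, which separates the starred labels.\<close>

lemma cube_invariant_iff:
  "(\<forall>s. \<phi> (a3 * s * b - 0 * s\<^sup>2 * b + a5 * s ^ 3 * b :: 'a) = 1) \<longleftrightarrow> (a3 * b) ^ 3 + a5 * b = 0"
proof -
  have "(\<forall>s. \<phi> (a3 * s * b - 0 * s\<^sup>2 * b + a5 * s ^ 3 * b) = 1) \<longleftrightarrow>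
      (\<forall>s. \<phi> ((a3 * b) * s + (a5 * b) * s ^ 3) = 1)"
    by (simp add: mult_ac)
  also have "\<dots> \<longleftrightarrow> (a3 * b) ^ 3 + a5 * b = 0"
    by (rule \<phi>_linearized_trivial_iff)
  finally show ?thesis .
qed

lemma star_invariant_iff:
  assumes "star_pair a3 a5"
  shows "(\<forall>s. \<phi> (a3 * s * b - 0 * s\<^sup>2 * b + a5 * s ^ 3 * b :: 'a) = 1) \<longleftrightarrow> b \<in> C3 a3 a5"
proof -
  note a = star_pair_nonzero[OF assms]
  \<comment> \<open>From \<omega>^2 = -a_3/a_5 it follows that r^2 = -a_5/a_3^3, so r and -r are the
    nonzero roots b of a_3^3 b^3 + a_5 b.\<close>
  have "(r a3 a5)\<^sup>2 = 1 / (a3\<^sup>2 * (w a3 a5)\<^sup>2)"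
    by (simp add: r_def power_divide power_mult_distrib)
  also have "\<dots> = - a5 / a3 ^ 3"
    unfolding w[OF assms] by (simp add: power2_eq_square power3_eq_cube)
  finally have "(r a3 a5)\<^sup>2 = - a5 / a3 ^ 3" .
  then have r2: "a3 ^ 3 * (r a3 a5)\<^sup>2 = - a5" using a by simp
  have "(a3 * b) ^ 3 + a5 * b = b * (a3 ^ 3 * b\<^sup>2 - a3 ^ 3 * (r a3 a5)\<^sup>2)"
    unfolding r2 by (simp add: algebra_simps power2_eq_square power3_eq_cube)
  also have "\<dots> = a3 ^ 3 * (b * ((b - r a3 a5) * (b + r a3 a5)))"
    by (simp add: algebra_simps power2_eq_square)
  finally have "(a3 * b) ^ 3 + a5 * b = 0 \<longleftrightarrow> b \<in> C3 a3 a5"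
    using a by (auto simp: eq_neg_iff_add_eq_0)
  then show ?thesis unfolding cube_invariant_iff .
qed

lemma cube_root_imp_star_pair:
  assumes "(a3 * b) ^ 3 + a5 * b = 0" "b \<noteq> 0" "a3 \<noteq> 0" "a5 \<noteq> (0 :: 'a)"
  shows "star_pair a3 a5"
proof -
  have "b * (a3 ^ 3 * b\<^sup>2 + a5) = 0"
    using assms(1) by (simp add: algebra_simps power2_eq_square power3_eq_cube)
  then have "a5 = - (a3 ^ 3 * b\<^sup>2)" using assms(2) by (simp add: eq_neg_iff_add_eq_0 add.commute)
  then have "a3 = - a5 * (1 / (a3 * b))\<^sup>2"
    using assms by (simp add: field_simps power2_eq_square power3_eq_cube)
  moreover have "(1 / (a3 * b))\<^sup>2 \<in> nonzero_squares"
    using assms by (auto simp: nonzero_squares_def)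
  ultimately show ?thesis using assms(4) unfolding star_pair_def by blast
qed

lemma small_char_3: "small_char 0 a5"
  by (simp add: small_char_def three)

lemma linear_mu3: "l \<in> labels3 \<Longrightarrow> tuple_linear (H3 r l) (mu3 l)"
proof (cases l)
  case (Three_a3s_a5 e1 e2 a3 a5)
  assume "l \<in> labels3"
  then have a: "star_pair a3 a5" by (auto simp: Three_a3s_a5)
  note nz = star_pair_nonzero[OF a]
  let ?b = "r a3 a5"
  have z: "\<zeta> ^ e * \<zeta> ^ (2 * e) = 1" "\<zeta> ^ (2 * e) * \<zeta> ^ (2 * e) = \<zeta> ^ e" for e
  proof -
    have "\<zeta> ^ e * \<zeta> ^ (2 * e) = (\<zeta> ^ 3) ^ e" by (simp flip: power_add power_mult)
    then show 1: "\<zeta> ^ e * \<zeta> ^ (2 * e) = 1" by (simp add: zeta)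
    have "\<zeta> ^ (2 * e) * \<zeta> ^ (2 * e) = \<zeta> ^ e * (\<zeta> ^ e * \<zeta> ^ (2 * e))"
      by (simp flip: power_add)
    then show "\<zeta> ^ (2 * e) * \<zeta> ^ (2 * e) = \<zeta> ^ e" by (simp add: 1)
  qed
  have "tuple_linear (first_in (C3 a3 a5)) (star (C3 a3 a5) (cube_char e1 ?b) (\<eta> e2 a3 a5) (0, 0, a3, 0, a5, 0))"
  proof (rule linear_star)
    show "\<phi> (a3 * s * b - 0 * s\<^sup>2 * b + a5 * s ^ 3 * b) = 1" if "b \<in> C3 a3 a5" for b s
      using star_invariant_iff[OF a] that by blast
    show "b + b' \<in> C3 a3 a5" if "b \<in> C3 a3 a5" "b' \<in> C3 a3 a5" for b b'
      using that add_self[of ?b] add_self[of "- ?b"] by auto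
    have cc: "cube_char e1 ?b 0 = 1" "cube_char e1 ?b ?b = \<zeta> ^ e1" "cube_char e1 ?b (- ?b) = \<zeta> ^ (2 * e1)"
      using nz(4) by (simp_all add: cube_char_def)
    have bb: "?b + ?b = - ?b" "- ?b - ?b = ?b" using add_self[of ?b] add_self[of "- ?b"] by simp_all
    have zz: "\<zeta> ^ e1 * \<zeta> ^ e1 = \<zeta> ^ (2 * e1)" by (simp flip: power_add mult_2)
    show "cube_char e1 ?b (b + b') = cube_char e1 ?b b * cube_char e1 ?b b'"
      if "b \<in> C3 a3 a5" "b' \<in> C3 a3 a5" for b b'
      using that z[of e1] zz by (auto simp: cc bb mult.commute simp del: power_mult)
    show "\<eta> e2 a3 a5 (s + t) = \<eta> e2 a3 a5 s * \<eta> e2 a3 a5 t" for s t using eta[OF a] by blast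
    have "\<zeta> \<noteq> 0" using zeta(1) by auto
    then show "cube_char e1 ?b b \<noteq> 0" for b by (simp add: cube_char_def)
  qed (use eta_nonzero[OF a] small_char_3 in auto)
  then show ?thesis by (simp add: Three_a3s_a5)
qed (use linear_S3456[OF three] linear_S23456[OF three] linear_S13456 linear_UNIV in simp_all)

lemma S3456_H3: "S3456 \<subseteq> H3 r l"
  by (cases l) auto

lemma mu3_S3456:
  assumes "l \<in> labels3" "h \<in> S3456"
  shows "mu3 l h = \<phi> (dot (coef3 l) h)"
proof (cases l)
  case (Three_a3s_a5 e1 e2 a3 a5)
  then have a: "star_pair a3 a5" using assms by auto
  obtain h1 h2 h3 h4 h5 h6 where "h = (h1, h2, h3, h4, h5, h6)" by (cases h)
  then show ?thesis using assms(2) eta_0[OF a] by (simp add: Three_a3s_a5 star_def cube_char_def)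
qed (use assms subsetD[OF S3456_H3[of l] assms(2)] in \<open>simp_all add: tchar_def\<close>)

text \<open>Coefficients 4 and 6 are invariants, since 3 = 0. A nonzero coefficient 6 gives y_1 = 0
  through the relation for coefficient 5, and a nonzero coefficient 4 gives y_2 = 0 through that for
  coefficient 3. If both vanish, coefficients 3 and 5 are invariants, and y_1 is restricted by its
  pairing with X_2.\<close>

lemma labels3_compat:
  assumes lm: "l \<in> labels3" "m \<in> labels3"
    and C: "\<And>h h'. \<lbrakk>h \<in> H3 r l; h' \<in> H3 r m; h \<odot> y = y \<odot> h'\<rbrakk> \<Longrightarrow> mu3 l h = mu3 m h'"
  shows "l = m \<and> y \<in> H3 r l"
proof -
  obtain y1 y2 y3 y4 y5 y6 where y: "y = (y1, y2, y3, y4, y5, y6)" by (cases y)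
  obtain l1 l2 l3 l4 l5 l6 where l: "coef3 l = (l1, l2, l3, l4, l5, l6)" by (cases "coef3 l")
  obtain m1 m2 m3 m4 m5 m6 where m: "coef3 m = (m1, m2, m3, m4, m5, m6)" by (cases "coef3 m")
  have D: "\<phi> (dot (l1, l2, l3, l4, l5, l6) h) = \<phi> (dot (m1, m2, m3, m4, m5, m6) h')"
    if "h \<odot> y = y \<odot> h'" "h \<in> S3456" "h' \<in> S3456" for h h'
    using C[OF subsetD[OF S3456_H3 that(2)] subsetD[OF S3456_H3 that(3)] that(1)]
      mu3_S3456[OF lm(1) that(2)] mu3_S3456[OF lm(2) that(3)] by (simp add: l m)
  have e: "l6 = m6" "l5 = m5 - m6 * y1" "l4 = m4" "l3 = m3 + y2 * m4"
    using compat_S3456(1-3)[OF D y] compat_S3456(4)[OF D y disjI2[OF three]]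
    by (simp_all add: three two)
  show ?thesis
  proof (cases "\<exists>e1 e2 a3 a5. l = Three_a3s_a5 e1 e2 a3 a5 \<or> m = Three_a3s_a5 e1 e2 a3 a5")
    case False
    have mu: "mu3 l = tchar (H3 r l) (coef3 l)" "mu3 m = tchar (H3 r m) (coef3 m)"
    proof -
      have "mu3 k = tchar (H3 r k) (coef3 k)" if "\<nexists>e1 e2 a3 a5. k = Three_a3s_a5 e1 e2 a3 a5" for k
        using that by (cases k) auto
      then show "mu3 l = tchar (H3 r l) (coef3 l)" "mu3 m = tchar (H3 r m) (coef3 m)"
        using False by blast+
    qed
    have lin: "l1 = m1 \<and> l2 = m2" if "l = Three_lin l1 l2" "m = Three_lin m1 m2"
      by (rule compat_UNIV_lin[of y]) (use C that in \<open>auto simp: tchar_def\<close>)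
    have c1: "l1 = m1 - y2 * m3 + y2\<^sup>2 * m4 - y2 ^ 3 * m5"
      if H: "H3 r l = S13456" "H3 r m = S13456" and 6: "l6 = 0" "m6 = 0"
    proof (rule compat_S13456[OF _ y])
      show "\<phi> (dot (l1, l2, l3, l4, l5, 0) h) = \<phi> (dot (m1, m2, m3, m4, m5, 0) h')"
        if "h \<odot> y = y \<odot> h'" "h \<in> S13456" "h' \<in> S13456" for h h'
        using C[of h h'] that H by (simp add: mu tchar_def l m 6)
    qed
    have c2: "\<phi> (l2 * s) = \<phi> (m2 * s + m3 * (s * y1) + m5 * (s ^ 3 * y1) + m6 * (s ^ 3 * y1\<^sup>2))"
      if H: "H3 r l = S23456" "H3 r m = S23456" and 4: "m4 = 0" for s
    proof -
      have "\<phi> (dot (l1, l2, l3, l4, l5, l6) h) = \<phi> (dot (m1, m2, m3, m4, m5, m6) h')"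
        if "h \<odot> y = y \<odot> h'" "h \<in> S23456" "h' \<in> S23456" for h h'
        using C[of h h'] that H by (simp add: mu tchar_def l m)
      from compat_S23456[where \<mu> = "\<lambda>h. \<phi> (dot (l1, l2, l3, l4, l5, l6) h)"
          and \<nu> = "\<lambda>h. \<phi> (dot (m1, m2, m3, m4, m5, m6) h)", OF this y three, where s = s]
      show ?thesis by (simp add: 4)
    qed
    have c3: "l2 = m2" if "H3 r l = S23456" "H3 r m = S23456" "m4 = 0" "y1 = 0"
      by (rule \<phi>_inj) (use c2[OF that(1-3)] that(4) in simp)
    \<comment> \<open>Both characters are trivial on X_2 here, so y_1 must pair trivially with all
      of X_2.\<close>
    have c4: "(m3 * y1) ^ 3 + m5 * y1 = 0"
      if "H3 r l = S23456" "H3 r m = S23456" "m4 = 0" "m6 = 0" "l2 = 0" "m2 = 0"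
    proof -
      have "\<forall>s. \<phi> (m3 * s * y1 - 0 * s\<^sup>2 * y1 + m5 * s ^ 3 * y1) = 1"
        using c2[OF that(1-3)] that(4-6) by (simp add: mult.assoc)
      then show ?thesis unfolding cube_invariant_iff .
    qed
    \<comment> \<open>A nonzero y_1 with this property would put the pair into the exceptional
      family.\<close>
    have c5: "y1 = 0" if "m \<in> labels3" "m = Three_a3_a5 m3 m5" "(m3 * y1) ^ 3 + m5 * y1 = 0"
      using cube_root_imp_star_pair[OF that(3)] that(1,2) by auto
    show ?thesis
    proof (cases l)
      case (Three_a4_a6 a4 a6)
      then have "m = Three_a4_a6 m4 m6" using e l m lm by (cases m) auto
      then show ?thesis using e l m lm Three_a4_a6 by (auto simp: y)
    next
      case (Three_a6 b2 b3 a6)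
      then have m': "m = Three_a6 m2 m3 m6" using e l m lm by (cases m) auto
      then have "y1 = 0" using e l m lm Three_a6 by auto
      then show ?thesis using c3 e l m Three_a6 m' by (auto simp: y)
    next
      case (Three_a4 b1 b5 a4)
      then have m': "m = Three_a4 m1 m5 m4" using e l m lm by (cases m) auto
      then have "y2 = 0" using e l m lm Three_a4 by auto
      then show ?thesis using c1 e l m Three_a4 m' by (auto simp: y)
    next
      case (Three_a3_a5 a3 a5)
      then have m': "m = Three_a3_a5 m3 m5" using e l m lm False by (cases m) auto
      have "y1 = 0" by (rule c5[OF lm(2) m' c4]) (use l m m' Three_a3_a5 in auto)
      then show ?thesis using e l m Three_a3_a5 m' by (auto simp: y)
    next
      case (Three_a3 a3)
      then have m': "m = Three_a3 m3" using e l m lm False by (cases m) auto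
      have "(m3 * y1) ^ 3 + m5 * y1 = 0" by (rule c4) (use l m m' Three_a3 in auto)
      then show ?thesis using e l m lm Three_a3 m' by (auto simp: y)
    next
      case (Three_a5 a5)
      then have m': "m = Three_a5 m5" using e l m lm False by (cases m) auto
      have "(m3 * y1) ^ 3 + m5 * y1 = 0" by (rule c4) (use l m m' Three_a5 in auto)
      then show ?thesis using e l m lm Three_a5 m' by (auto simp: y)
    next
      case (Three_lin b1 b2)
      then have "m = Three_lin m1 m2" using e l m lm False by (cases m) auto
      then show ?thesis using lin l m Three_lin by auto
    qed (use False in blast)
  next
    case star: True
    have "l6 = 0 \<and> m6 = 0 \<and> l4 = 0 \<and> m4 = 0 \<and> m3 = l3 \<and> m5 = l5 \<and> star_pair l3 l5"
      using star e l m lm by auto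
    then obtain e1 e2 e1' e2' where l': "l = Three_a3s_a5 e1 e2 l3 l5" and m': "m = Three_a3s_a5 e1' e2' l3 l5"
      and a: "star_pair l3 l5"
      using l m lm star_pair_nonzero[of l3 l5] by (cases l; cases m) auto
    note nz = star_pair_nonzero[OF a]
    let ?C = "C3 l3 l5" and ?b = "r l3 l5" and ?w = "w l3 l5"
    have H: "star ?C (cube_char e1 ?b) (\<eta> e2 l3 l5) (0, 0, l3, 0, l5, 0) h =
        star ?C (cube_char e1' ?b) (\<eta> e2' l3 l5) (0, 0, l3, 0, l5, 0) h'"
      if "h \<odot> y = y \<odot> h'" "h \<in> first_in ?C" "h' \<in> first_in ?C" for h h'
      using C[of h h'] that by (simp add: l' m')
    have inv: "\<phi> (l3 * s * b - 0 * s\<^sup>2 * b + l5 * s ^ 3 * b) = 1" if "b \<in> ?C" for b s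
      using star_invariant_iff[OF a] that by blast
    have st: "\<eta> e2 l3 l5 s = \<eta> e2' l3 l5 s * \<phi> (l3 * s * y1 - 0 * s\<^sup>2 * y1 + l5 * s ^ 3 * y1)"
      "t \<in> ?C \<Longrightarrow> cube_char e1 ?b t = cube_char e1' ?b t" for s t
      by (rule compat_star[OF H y small_char_3 _ _ _ _ _ inv];
          use eta_0[OF a] in \<open>simp add: cube_char_def\<close>)+
    \<comment> \<open>\<omega> is a root of l_3 s + l_5 s^3, so its pairing with any y_1 is trivial
      and the two \<eta> agree at \<omega>.\<close>
    have "l3 * ?w * y1 - 0 * ?w\<^sup>2 * y1 + l5 * ?w ^ 3 * y1 = ?w * y1 * (l3 + l5 * ?w\<^sup>2)"
      by (simp add: algebra_simps power2_eq_square power3_eq_cube)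
    also have "\<dots> = 0" using w[OF a] nz by simp
    finally have "\<zeta> ^ e2 = \<zeta> ^ e2'"
      using st(1)[of ?w] eta[OF a] by simp
    then have e2: "e2 = e2'" using lm by (intro zeta_inj) (auto simp: l' m')
    have "\<phi> (l3 * s * y1 - 0 * s\<^sup>2 * y1 + l5 * s ^ 3 * y1) = 1" for s
      using st(1)[of s] eta_nonzero[OF a] by (simp add: e2)
    then have y1: "y1 \<in> ?C" using star_invariant_iff[OF a] by blast
    have "\<zeta> ^ e1 = \<zeta> ^ e1'"
      using st(2)[of ?b] nz by (simp add: cube_char_def)
    then have "e1 = e1'" using lm by (intro zeta_inj) (auto simp: l' m')
    then show ?thesis using e2 y1 by (simp add: l' m' y)
  qed
qed

section \<open>Identification of the labelled characters in characteristic 3\<close>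

abbreviation X3 :: "'a label3 \<Rightarrow> 'g \<Rightarrow> complex" where
  "X3 l \<equiv> induced G (coord ` H3 r l) (push (mu3 l))"

lemma complement_3:
  assumes "star_pair a3 a5"
  shows "complement_in G (Y a3 a5) (x 2 ` {of_nat j * w a3 a5 |j. j < 3}) (root_set G x {2})"
proof -
  have "{of_nat j * w a3 a5 |j. j < 3} = {0, w a3 a5, - w a3 a5}"
  proof -
    have j: "j < 3 \<longleftrightarrow> j = 0 \<or> j = 1 \<or> j = 2" for j :: nat by auto
    have "{of_nat j * w a3 a5 |j. j < 3} = {of_nat 0 * w a3 a5, of_nat 1 * w a3 a5, of_nat 2 * w a3 a5}"
      unfolding j by blast
    then show ?thesis by (simp add: two)
  qed
  then show ?thesis using complement[OF assms] by (simp add: x_zeros)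
qed

lemma star_label_3:
  assumes l: "Three_a3s_a5 e1 e2 a3 a5 \<in> labels3"
  shows "chi3 G x \<zeta> w Y (Three_a3s_a5 e1 e2 a3 a5) = X3 (Three_a3s_a5 e1 e2 a3 a5)"
proof -
  have a: "star_pair a3 a5" using l by auto
  note nz = star_pair_nonzero[OF a]
  let ?c = "r a3 a5" and ?v = "w a3 a5"
  let ?C = "C3 a3 a5"
  let ?H = "coord ` first_in ?C"
  let ?Y = "Y a3 a5"
  let ?\<mu> = "push (mu3 (Three_a3s_a5 e1 e2 a3 a5))"
  let ?P = "\<lambda>\<mu>. linear_character G ?H \<mu> \<and> (\<forall>g \<in> ?Y <#> root_set G x {4,6}. \<mu> g = 1) \<and>
           (\<forall>t3 t5. \<mu> (x 3 t3 \<otimes> x 5 t5) = \<phi> (a3 * t3 + a5 * t5)) \<and>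
           \<mu> (x 1 ?c) = \<zeta> ^ e1 \<and> \<mu> (x 2 ?v) = \<zeta> ^ e2"
  note Y = complement_character[OF complement_3[OF a] nz(3)]
  have "{\<one>, x 1 ?c, x 1 (- ?c)} = x 1 ` ?C" by (simp add: x_zeros)
  then have H: "{\<one>, x 1 ?c, x 1 (- ?c)} <#> root_set G x {2,3,4,5,6} = ?H"
    using set_mult_root_set[of ?C] by simp
  have N: "\<one> \<in> root_set G x {4,6}" "root_set G x {4,6} \<subseteq> carrier G" "x 4 t \<in> root_set G x {4,6}" "x 6 t \<in> root_set G x {4,6}"
    "root_set G x {4,6} \<subseteq> {coord (0, 0, 0, a4, a5', a6) |a4 a5' a6. 0 * a4 + a5 * a5' = 0}" for t
    unfolding root_sets coord_x by (auto simp flip: x_zeros(6) simp: coord_x)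
  have 1: "cube_char e1 ?c 0 = 1" "\<eta> e2 a3 a5 0 = 1" using eta_0[OF a] by (simp_all add: cube_char_def)
  have C0: "0 \<in> ?C" by simp
  note val = push_star_x[where \<xi> = "cube_char e1 ?c" and \<eta> = "\<eta> e2 a3 a5", OF C0 1, where ?c3.0 = a3 and ?c4.0 = 0 and ?c5.0 = a5]
  have P: "?P ?\<mu>"
  proof (intro conjI ballI allI)
    show "linear_character G ?H ?\<mu>"
      using linear_character_push[OF linear_mu3[OF l]] by simp
    show "?\<mu> (x 1 ?c) = \<zeta> ^ e1" "?\<mu> (x 2 ?v) = \<zeta> ^ e2" "?\<mu> (x 3 t3 \<otimes> x 5 t5) = \<phi> (a3 * t3 + a5 * t5)" for t3 t5
      using val nz eta[OF a] by (simp_all add: cube_char_def)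
    show "?\<mu> g = 1" if "g \<in> ?Y <#> root_set G x {4,6}" for g
      using push_star_eq_1[where \<xi> = "cube_char e1 ?c" and \<eta> = "\<eta> e2 a3 a5" and ?c3.0 = a3, OF C0 1(1) Y(1) _ N(5) that] eta[OF a] by simp
  qed
  have "(THE \<mu>. ?P \<mu>) = ?\<mu>"
  proof (rule the_equality, rule P)
    fix \<mu> assume mu: "?P \<mu>"
    show "\<mu> = ?\<mu>"
    proof (rule star_character_unique[of ?C, OF _ _ C0 _ complement_3[OF a] nz(3) _ N(1,2)])
      show "x i t \<in> root_set G x {4,6} \<or> \<mu> (x i t) = ?\<mu> (x i t)" if "i \<in> {3,4,5,6}" for i t
      proof -
        have "\<mu> (x 3 t \<otimes> x 5 0) = ?\<mu> (x 3 t \<otimes> x 5 0)" "\<mu> (x 3 0 \<otimes> x 5 t) = ?\<mu> (x 3 0 \<otimes> x 5 t)"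
          using mu P by simp_all
        then show ?thesis using that N(3,4) by (auto simp: x_zeros)
      qed
      \<comment> \<open>The value at x_1(-c) is not prescribed, but -c = c + c in characteristic
        3.\<close>
      have neg: "\<kappa> (x 1 (- ?c)) = \<zeta> ^ e1 * \<zeta> ^ e1" if k: "?P \<kappa>" for \<kappa>
      proof -
        have "x 1 ?c \<in> ?H" unfolding coord_x by auto
        then have "\<kappa> (x 1 ?c \<otimes> x 1 ?c) = \<kappa> (x 1 ?c) * \<kappa> (x 1 ?c)"
          by (intro linear_character_mult_left[OF conjunct1[OF k]]) simp_all
        then show ?thesis using k by (simp only: collect_add add_self)
      qed
      show "\<mu> (x 1 t) = ?\<mu> (x 1 t)" if "t \<in> ?C" for t
        using that mu P linear_character_one[of ?H \<mu>] linear_character_one[of ?H ?\<mu>] neg[OF mu] neg[OF P]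
        by (auto simp: x_zeros)
    qed (use mu P in auto)
  qed
  then show ?thesis by (simp only: chi3.simps Let_def r_def[symmetric] H H3.simps)
qed

lemma chi3_eq:
  assumes "l \<in> labels3"
  shows "chi3 G x \<zeta> w Y l = X3 l"
proof -
  note S23 = linear_S23456[OF three]
  have 23: "root_ind G x {2,3,4,5,6} (\<lambda>t. b2 * t 2 + b3 * t 3 + b5 * t 5 + b6 * t 6)
      = induced G (coord ` S23456) (push (tchar S23456 (0, b2, b3, 0, b5, b6)))" for b2 b3 b5 b6
    by (rule root_ind_eq[OF root_sets(3) S23, where F = "\<lambda>t. (0, t 2, t 3, t 4, t 5, t 6)"])
       (simp add: root_prods)
  show ?thesis
  proof (cases l)
    case (Three_a4_a6 a4 a6)
    have "root_ind G x {3,4,5,6} (\<lambda>t. a4 * t 4 + a6 * t 6) = induced G (coord ` S3456) (push (tchar S3456 (0, 0, 0, a4, 0, a6)))"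
      by (rule root_ind_eq[OF root_sets(4) linear_S3456[OF three], where F = "\<lambda>t. (0, 0, t 3, t 4, t 5, t 6)"])
         (simp add: root_prods)
    then show ?thesis by (simp add: Three_a4_a6)
  next
    case (Three_a4 b1 b5 a4)
    have "root_ind G x {1,3,4,5,6} (\<lambda>t. b1 * t 1 + a4 * t 4 + b5 * t 5) = induced G (coord ` S13456) (push (tchar S13456 (b1, 0, 0, a4, b5, 0)))"
      by (rule root_ind_eq[OF root_sets(2) linear_S13456, where F = "\<lambda>t. (t 1, 0, t 3, t 4, t 5, t 6)"])
         (simp add: root_prods)
    then show ?thesis by (simp add: Three_a4)
  next
    case (Three_a6 b2 b3 a6)
    then show ?thesis using 23[of b2 b3 0 a6] by simp
  next
    case (Three_a3_a5 a3 a5)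
    then show ?thesis using 23[of 0 a3 a5 0] by simp
  next
    case (Three_a3 a3)
    then show ?thesis using 23[of 0 a3 0 0] by simp
  next
    case (Three_a5 a5)
    then show ?thesis using 23[of 0 0 a5 0] by simp
  next
    case (Three_a3s_a5 e1 e2 a3 a5)
    then show ?thesis using star_label_3 assms by blast
  next
    case (Three_lin b1 b2)
    show ?thesis by (simp add: Three_lin root_linear_UNIV)
  qed
qed

text \<open>Squaring on the nonzero elements has the fibres {v, -v}, of size 2 in characteristic
  3.\<close>

lemma card_nonzero_squares: "2 * card (nonzero_squares :: 'a set) = card (- {0 :: 'a})"
proof -
  have sq: "nonzero_squares = (\<lambda>u. u\<^sup>2) ` (- {0 :: 'a})"
    by (auto simp: nonzero_squares_def image_iff)
  have fiber: "card {u \<in> - {0}. u\<^sup>2 = s} = 2" if s: "s \<in> nonzero_squares" for s :: 'a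
  proof -
    obtain v where v: "v \<noteq> 0" "s = v\<^sup>2" using s by (auto simp: nonzero_squares_def)
    then have "{u \<in> - {0}. u\<^sup>2 = s} = {v, - v}" by (auto simp: power2_eq_iff)
    then show ?thesis using v by simp
  qed
  have "card (- {0 :: 'a}) = (\<Sum>s\<in>(\<lambda>u. u\<^sup>2) ` (- {0 :: 'a}). card {u \<in> - {0}. u\<^sup>2 = s})"
    using sum.image_gen[of "- {0 :: 'a}" "\<lambda>_. 1 :: nat" "\<lambda>u. u\<^sup>2"] by simp
  then show ?thesis using fiber by (simp flip: sq)
qed

text \<open>A starred pair amounts to a nonzero square s = -a_3/a_5 and a free nonzero a_5. The
  unstarred pairs are the other half of all (q-1)^2 pairs.\<close>

lemma card_star_pairs:
  "real (card {(a3, a5). star_pair a3 a5}) = (real CARD('a) - 1)\<^sup>2 / 2"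
  "real (card {(a3, a5). a5 \<noteq> (0 :: 'a) \<and> a3 \<noteq> 0 \<and> \<not> star_pair a3 a5}) = (real CARD('a) - 1)\<^sup>2 / 2"
proof -
  let ?N = "- {0 :: 'a}" and ?S = "{(a3, a5). star_pair a3 a5}"
  let ?T = "{(a3, a5). a5 \<noteq> (0 :: 'a) \<and> a3 \<noteq> 0 \<and> \<not> star_pair a3 a5}"
  have "bij_betw (\<lambda>(s, a5). (- a5 * s, a5)) (nonzero_squares \<times> ?N) ?S"
    by (rule bij_betwI[where g = "\<lambda>(a3, a5). (- a3 / a5, a5)"])
       (auto simp: star_pair_def)
  from bij_betw_same_card[OF this]
  have "card ?S = card (nonzero_squares :: 'a set) * card ?N" by (simp add: card_cartesian_product)
  then have "2 * card ?S = 2 * card (nonzero_squares :: 'a set) * card ?N" by simp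
  then have "2 * card ?S = card ?N * card ?N" unfolding card_nonzero_squares .
  from arg_cong[OF this, of real]
  have "2 * real (card ?S) = real (card ?N) * real (card ?N)"
    by (simp only: of_nat_mult of_nat_numeral)
  then show S: "real (card ?S) = (real CARD('a) - 1)\<^sup>2 / 2"
    by (simp add: card_nonzero power2_eq_square)
  have "?S \<union> ?T = ?N \<times> ?N" using star_pair_nonzero by auto
  moreover have "?S \<inter> ?T = {}" by auto
  ultimately have "card ?N * card ?N = card ?S + card ?T"
    using card_Un_disjoint[of ?S ?T] by (simp add: card_cartesian_product)
  from arg_cong[OF this, of real]
  have "real (card ?N) * real (card ?N) = real (card ?S) + real (card ?T)"
    by (simp only: of_nat_add of_nat_mult)
  then show "real (card ?T) = (real CARD('a) - 1)\<^sup>2 / 2"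
    unfolding S by (simp add: card_nonzero power2_eq_square)
qed

definition tab3 :: "('a label3 set \<times> real \<times> real) list" where
  "tab3 = (let q = real CARD('a) in
    [({Three_a4_a6 a4 a6 |a4 a6. a4 \<noteq> 0 \<and> a6 \<noteq> 0}, (q - 1) ^ 2, q ^ 2),
     ({Three_a6 b2 b3 a6 |b2 b3 a6. a6 \<noteq> 0}, q ^ 2 * (q - 1), q),
     ({Three_a4 b1 b5 a4 |b1 b5 a4. a4 \<noteq> 0}, q ^ 2 * (q - 1), q),
     ({Three_a3_a5 a3 a5 |a3 a5.
         a5 \<noteq> 0 \<and> a3 \<noteq> 0 \<and> a3 \<notin> (\<lambda>s. - a5 * s) ` nonzero_squares}, (q - 1) ^ 2 / 2, q),
     ({Three_a3 a3 |a3. a3 \<noteq> 0}, q - 1, q),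
     ({Three_a5 a5 |a5. a5 \<noteq> 0}, q - 1, q),
     ({Three_a3s_a5 e1 e2 a3 a5 |e1 e2 a3 a5.
         e1 \<in> {0,1,2} \<and> e2 \<in> {0,1,2} \<and> a5 \<noteq> 0 \<and> a3 \<in> (\<lambda>s. - a5 * s) ` nonzero_squares},
       9 * (q - 1) ^ 2 / 2, q / 3),
     ({Three_lin b1 b2 |b1 b2. True}, q ^ 2, 1)])"

lemma tab3_rows:
  assumes "(L, n, d) \<in> set tab3"
  shows "finite L \<and> real (card L) = n \<and>
    (\<forall>l\<in>L. tuple_linear (H3 r l) (mu3 l) \<and> real CARD('a) ^ 6 = d * real (card (H3 r l)))"
proof -
  let ?N = "- {0 :: 'a}" and ?S = "{(a3, a5). star_pair a3 a5}"
  let ?T = "{(a3, a5). a5 \<noteq> (0 :: 'a) \<and> a3 \<noteq> 0 \<and> \<not> star_pair a3 a5}"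
  have img:
    "{Three_a4_a6 a4 a6 |a4 a6 :: 'a. a4 \<noteq> 0 \<and> a6 \<noteq> 0} = (\<lambda>(a4, a6). Three_a4_a6 a4 a6) ` (?N \<times> ?N)"
    "{Three_a6 b2 b3 a6 |b2 b3 a6 :: 'a. a6 \<noteq> 0} = (\<lambda>(b2, b3, a6). Three_a6 b2 b3 a6) ` (UNIV \<times> UNIV \<times> ?N)"
    "{Three_a4 b1 b5 a4 |b1 b5 a4 :: 'a. a4 \<noteq> 0} = (\<lambda>(b1, b5, a4). Three_a4 b1 b5 a4) ` (UNIV \<times> UNIV \<times> ?N)"
    "{Three_a3_a5 a3 a5 |a3 a5 :: 'a. a5 \<noteq> 0 \<and> a3 \<noteq> 0 \<and> a3 \<notin> (\<lambda>s. - a5 * s) ` nonzero_squares} = (\<lambda>(a3, a5). Three_a3_a5 a3 a5) ` ?T"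
    "{Three_a3 a3 |a3 :: 'a. a3 \<noteq> 0} = Three_a3 ` ?N"
    "{Three_a5 a5 |a5 :: 'a. a5 \<noteq> 0} = Three_a5 ` ?N"
    "{Three_a3s_a5 e1 e2 a3 a5 |e1 e2 (a3 :: 'a) a5.
         e1 \<in> {0,1,2} \<and> e2 \<in> {0,1,2} \<and> a5 \<noteq> 0 \<and> a3 \<in> (\<lambda>s. - a5 * s) ` nonzero_squares} = (\<lambda>(e1, e2, a3, a5). Three_a3s_a5 e1 e2 a3 a5) ` ({0,1,2} \<times> {0,1,2} \<times> ?S)"
    "{Three_lin b1 b2 |b1 b2 :: 'a. True} = (\<lambda>(b1, b2). Three_lin b1 b2) ` (UNIV \<times> UNIV)"
    unfolding star_pair_def by (auto simp: image_iff)
  have deg: "real CARD('a) ^ 6 = real CARD('a) / 3 * real (card (first_in (C3 a3 a5)))"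
    if "star_pair a3 a5" for a3 a5 :: 'a
  proof -
    have "card (C3 a3 a5) = 3" using star_pair_nonzero(4)[OF that] by simp
    then show ?thesis unfolding card_S by (simp add: numeral_eq_Suc)
  qed
  have "L \<subseteq> labels3"
    using assms unfolding labels3_def by (auto simp: tab3_def Let_def)
  moreover have "finite L \<and> real (card L) = n"
  proof -
    have "\<forall>r\<in>set tab3. finite (fst r) \<and> real (card (fst r)) = fst (snd r)"
      unfolding tab3_def Let_def img
      by (simp add: card_image inj_on_def card_cartesian_product card_nonzero card_star_pairs power2_eq_square)
    then show ?thesis using assms by force
  qed
  moreover have "\<forall>l\<in>L. real CARD('a) ^ 6 = d * real (card (H3 r l))"
  proof -
    have "\<forall>r'\<in>set tab3. \<forall>l\<in>fst r'. real CARD('a) ^ 6 = snd (snd r') * real (card (H3 r l))"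
      unfolding tab3_def Let_def
    proof (simp only: list.set ball_simps(5,7) fst_conv snd_conv, intro conjI ballI)
      fix l :: "'a label3"
      assume "l \<in> {Three_a3s_a5 e1 e2 a3 a5 |e1 e2 (a3 :: 'a) a5.
         e1 \<in> {0,1,2} \<and> e2 \<in> {0,1,2} \<and> a5 \<noteq> 0 \<and> a3 \<in> (\<lambda>s. - a5 * s) ` nonzero_squares}"
      then obtain e1 e2 a3 a5 where l: "l = Three_a3s_a5 e1 e2 a3 a5" "star_pair a3 a5"
        unfolding star_pair_def by blast
      show "real CARD('a) ^ 6 = real CARD('a) / 3 * real (card (H3 r l))"
        using deg[OF l(2)] by (simp only: l(1) H3.simps)
    qed (auto simp: card_S(4) simp flip: card_eq_degree simp del: card_prod)
    then show ?thesis using assms by force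
  qed
  ultimately show ?thesis using linear_mu3 by blast
qed

lemma Irr_table_3:
  shows "Irr_table G (chi3 G x \<zeta> w Y) tab3"
    and "real (card (Irr G)) = 2 * real CARD('a) ^ 3 + 5 * real CARD('a) ^ 2 - 10 * real CARD('a) + 4"
proof -
  have U: "(\<Union>(L, n, d)\<in>set tab3. L) = labels3"
    unfolding labels3_def tab3_def Let_def by (simp add: Un_assoc)
  have disj: "sorted_wrt (\<lambda>r s. fst r \<inter> fst s = {}) tab3"
    by (auto simp: tab3_def Let_def)
  \<comment> \<open>The nine choices of e_1, e_2 make up for the degree q/3, so starred and
    unstarred pairs both contribute q^2 (q-1)^2 / 2. The families with coefficients 4 and 6 equal to
    0 add up to q^4.\<close>
  have total: "(\<Sum>(L, n, d)\<leftarrow>tab3. n * d\<^sup>2) = real CARD('a) ^ 6"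
    by (simp add: tab3_def Let_def field_simps power2_eq_square numeral_eq_Suc)
  have T: "bij_betw X3 (\<Union>(L, n, d)\<in>set tab3. L) (Irr G) \<and>
    real (card (Irr G)) = (\<Sum>(L, n, d)\<leftarrow>tab3. n) \<and>
    (\<forall>\<chi>. (\<forall>l\<in>(\<Union>(L, n, d)\<in>set tab3. L). \<chi> l = X3 l) \<longrightarrow> Irr_table G \<chi> tab3)"
  proof (rule Irr_tableI[OF disj _ _ total])
    show "finite L \<and> real (card L) = n \<and>
      (\<forall>l\<in>L. tuple_linear (H3 r l) (mu3 l) \<and> real CARD('a) ^ 6 = d * real (card (H3 r l)))"
      if "(L, n, d) \<in> set tab3" for L n d by (rule tab3_rows[OF that])
    show "l = m \<and> y \<in> H3 r l"
      if "l \<in> (\<Union>(L, n, d)\<in>set tab3. L)" "m \<in> (\<Union>(L, n, d)\<in>set tab3. L)"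
        "\<And>h h'. \<lbrakk>h \<in> H3 r l; h' \<in> H3 r m; h \<odot> y = y \<odot> h'\<rbrakk> \<Longrightarrow> mu3 l h = mu3 m h'" for l m y
      using labels3_compat[OF _ _ that(3)] that(1,2) unfolding U by blast
  qed
  have "\<forall>l\<in>labels3. chi3 G x \<zeta> w Y l = X3 l" using chi3_eq by (rule ballI)
  then show "Irr_table G (chi3 G x \<zeta> w Y) tab3" using T unfolding U by blast
  show "real (card (Irr G)) = 2 * real CARD('a) ^ 3 + 5 * real CARD('a) ^ 2 - 10 * real CARD('a) + 4"
    using T[THEN conjunct2, THEN conjunct1]
    by (simp add: tab3_def Let_def field_simps power2_eq_square numeral_eq_Suc)
qed

end

section \<open>Existence of the choices\<close>

lemma CHAR_eq_of_CARD_power: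
  assumes "prime p" "CARD('a::{field,finite}) = p ^ f"
  shows "CHAR('a) = p"
proof -
  have "CHAR('a) dvd p ^ f" using CHAR_dvd_CARD[where ?'a = 'a] assms(2) by simp
  then have "CHAR('a) dvd p" by (rule prime_dvd_power[OF prime_CHAR])
  then show ?thesis using assms(1) prime_CHAR[where ?'a = 'a] by (simp add: primes_dvd_imp_eq)
qed

text \<open>The table is claimed for every choice of complements, so \<eta> has to be built from the
  given \<open>Y\<close>: it continues the value (-1)^d on Y' trivially along
  \<open>Y\<close>.\<close>

lemma (in G2_prime_power) exists_G2_char_2:
  assumes p: "p = 2"
    and Y: "\<And>a3 a4. a3 \<noteq> 0 \<Longrightarrow> a4 \<noteq> 0 \<Longrightarrow>
      complement_in G (Y a3 a4) {\<one>, x 2 (a3 / a4)} (root_set G x {2})"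
  shows "\<exists>\<eta>. G2_char_2 G x f Y \<eta>"
proof -
  have "\<exists>\<eta>. (\<forall>s t. \<eta> (s + t) = \<eta> s * \<eta> t) \<and> \<eta> (a3 / a4) = (- 1) ^ d \<and>
      (\<forall>s. x 2 s \<in> Y a3 a4 \<longrightarrow> \<eta> s = (1 :: complex))" if a: "a3 \<noteq> 0" "a4 \<noteq> 0" for d :: nat and a3 a4
  proof (rule complement_character(4))
    have "{of_nat j * (a3 / a4) |j. j < p} = {0, a3 / a4}"
      by (auto simp: p less_2_cases_iff intro: exI[of _ 0] exI[of _ 1])
    then show "complement_in G (Y a3 a4) (x 2 ` {of_nat j * (a3 / a4) |j. j < p}) (root_set G x {2})"
      using Y[OF a] by (simp add: x_zeros)
    show "a3 / a4 \<noteq> 0" using a by simp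
    have "((- 1 :: complex) ^ d) ^ 2 = ((- 1) ^ 2) ^ d" by (simp add: mult.commute flip: power_mult)
    then show "((- 1 :: complex) ^ d) ^ p = 1" by (simp add: p)
  qed
  note ex = this
  define \<eta> where "\<eta> d a3 a4 = (SOME h. (\<forall>s t. h (s + t) = h s * h t) \<and> h (a3 / a4) = (- 1) ^ d \<and>
      (\<forall>s. x 2 s \<in> Y a3 a4 \<longrightarrow> h s = (1 :: complex)))" for d a3 a4
  have "(\<forall>s t. \<eta> d a3 a4 (s + t) = \<eta> d a3 a4 s * \<eta> d a3 a4 t) \<and> \<eta> d a3 a4 (a3 / a4) = (- 1) ^ d \<and>
      (\<forall>s. x 2 s \<in> Y a3 a4 \<longrightarrow> \<eta> d a3 a4 s = (1 :: complex))" if "a3 \<noteq> 0" "a4 \<noteq> 0" for d a3 a4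
    unfolding \<eta>_def by (rule someI_ex[OF ex]) (use that in simp_all)
  then have "G2_char_2 G x f Y \<eta>"
    using G2_prime_power_axioms Y by (simp add: G2_char_2_def G2_char_2_axioms_def p)
  then show ?thesis by blast
qed

lemma (in G2_prime_power) exists_G2_char_3:
  assumes p: "p = 3" and zeta: "\<zeta> ^ 3 = 1" "\<zeta> \<noteq> 1"
    and w: "\<And>a3 a5. star_pair a3 a5 \<Longrightarrow> (w a3 a5)\<^sup>2 = - a3 / a5 \<and>
      complement_in G (Y a3 a5) {\<one>, x 2 (w a3 a5), x 2 (- w a3 a5)} (root_set G x {2})"
  shows "\<exists>\<eta>. G2_char_3 G x f \<zeta> w Y \<eta>"
proof -
  have "(3 :: 'a) = 0" using of_nat_CHAR[where ?'a = 'a] by (simp add: CHAR_eq p)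
  moreover have "(2 :: 'a) + 1 = 3" by simp
  ultimately have two: "(2 :: 'a) = - 1" by (simp only: eq_neg_iff_add_eq_0)
  have "\<exists>\<eta>. (\<forall>s t. \<eta> (s + t) = \<eta> s * \<eta> t) \<and> \<eta> (w a3 a5) = \<zeta> ^ e \<and>
      (\<forall>s. x 2 s \<in> Y a3 a5 \<longrightarrow> \<eta> s = (1 :: complex))" if a: "star_pair a3 a5" for e :: nat and a3 a5
  proof (rule complement_character(4))
    have j: "j < 3 \<longleftrightarrow> j = 0 \<or> j = 1 \<or> j = 2" for j :: nat by auto
    have "{of_nat j * w a3 a5 |j. j < p} = {of_nat 0 * w a3 a5, of_nat 1 * w a3 a5, of_nat 2 * w a3 a5}"
      unfolding p j by blast
    then show "complement_in G (Y a3 a5) (x 2 ` {of_nat j * w a3 a5 |j. j < p}) (root_set G x {2})"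
      using w[OF a] by (simp add: x_zeros two)
    show "w a3 a5 \<noteq> 0"
      using w[OF a] a by (auto simp: star_pair_def nonzero_squares_def)
    have "(\<zeta> ^ e) ^ 3 = (\<zeta> ^ 3) ^ e" by (simp add: mult.commute flip: power_mult)
    then show "(\<zeta> ^ e) ^ p = 1" by (simp add: p zeta)
  qed
  note ex = this
  define \<eta> where "\<eta> e a3 a5 = (SOME h. (\<forall>s t. h (s + t) = h s * h t) \<and> h (w a3 a5) = \<zeta> ^ e \<and>
      (\<forall>s. x 2 s \<in> Y a3 a5 \<longrightarrow> h s = (1 :: complex)))" for e a3 a5
  have "(\<forall>s t. \<eta> e a3 a5 (s + t) = \<eta> e a3 a5 s * \<eta> e a3 a5 t) \<and> \<eta> e a3 a5 (w a3 a5) = \<zeta> ^ e \<and>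
      (\<forall>s. x 2 s \<in> Y a3 a5 \<longrightarrow> \<eta> e a3 a5 s = (1 :: complex))" if "star_pair a3 a5" for e a3 a5
    unfolding \<eta>_def by (rule someI_ex[OF ex]) (use that in simp_all)
  then have "G2_char_3 G x f \<zeta> w Y \<eta>"
    using G2_prime_power_axioms w zeta by (simp add: G2_char_3_def G2_char_3_axioms_def p)
  then show ?thesis by blast
qed

context G2_prime_power
begin

lemma field_trace_of_nat_mult: "field_trace (of_nat j * t :: 'a) = of_nat j * field_trace t"
proof -
  have "(of_nat j :: 'a) ^ p ^ i = of_nat j" for i
  proof (induction i)
    case (Suc i)
    have "(of_nat j :: 'a) ^ p ^ Suc i = (of_nat j ^ p ^ i) ^ p"
      by (simp add: mult.commute flip: power_mult)
    then show ?case
      unfolding Suc.IH by (simp add: of_nat_power_CHAR[where ?'a = 'a, unfolded CHAR_eq])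
  qed simp
  then have "(of_nat j * t :: 'a) ^ p ^ i = of_nat j * t ^ p ^ i" for i
    by (simp add: power_mult_distrib)
  then show ?thesis by (simp add: field_trace_eq sum_distrib_left)
qed

text \<open>The kernel of \<open>s \<mapsto> Tr (c s)\<close> is a complement of the multiples of \<open>v\<close> as soon as \<open>Tr (c v) \<noteq> 0\<close>.\<close>

lemma exists_complement:
  assumes v: "v \<noteq> 0"
  shows "\<exists>Y. complement_in G Y (x 2 ` {of_nat j * v |j. j < p}) (root_set G x {2})"
proof -
  obtain t0 :: 'a where t0: "field_trace t0 \<noteq> 0" using field_trace_nontrivial by blast
  \<comment> \<open>Rescales an element of nonzero trace so that Tr(c v) is nonzero.\<close>
  define c where "c = t0 / v"
  have cv: "field_trace (c * v) = field_trace t0" using v by (simp add: c_def)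
  define K where "K = {s. field_trace (c * s) = 0}"
  have p0: "0 < p" using prime_gt_0_nat[OF p] .
  have x2: "x 2 s \<otimes> x 2 t = x 2 (s + t)" for s t by (simp add: collect_add)
  have x2_inj: "x 2 s = x 2 t \<longleftrightarrow> s = t" for s t by (simp add: coord_x)
  have tr0: "field_trace (0 :: 'a) = 0" using field_trace_of_nat_mult[of 0 0] by simp
  have "complement_in G (x 2 ` K) (x 2 ` {of_nat j * v |j. j < p}) (root_set G x {2})"
    unfolding complement_in_def
  proof (intro conjI)
    show "subgroup (x 2 ` K) G"
    proof (rule finite_closed_imp_subgroup[OF finite_carrier])
      have "0 \<in> K" by (simp add: K_def tr0)
      then show "x 2 ` K \<noteq> {}" by blast
      show "a \<otimes> b \<in> x 2 ` K" if "a \<in> x 2 ` K" "b \<in> x 2 ` K" for a b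
        using that by (auto simp: x2 x2_inj K_def distrib_left field_trace_add intro!: imageI)
    qed auto
    show "x 2 ` K \<subseteq> root_set G x {2}" by (auto simp: root_sets)
    show "x 2 ` {of_nat j * v |j. j < p} \<inter> x 2 ` K = {\<one>}"
    proof (intro equalityI subsetI)
      fix g assume "g \<in> x 2 ` {of_nat j * v |j. j < p} \<inter> x 2 ` K"
      then obtain j s where g: "j < p" "g = x 2 (of_nat j * v)" "s \<in> K" "g = x 2 s" by blast
      then have j: "of_nat j * v \<in> K" by (simp add: x2_inj)
      then have "of_nat j * field_trace t0 = 0"
        using field_trace_of_nat_mult[of j "c * v"] j by (simp add: K_def cv mult.left_commute)
      then have "(of_nat j :: 'a) = 0" using t0 by simp
      then show "g \<in> {\<one>}" using g(2) by (simp add: x_zeros)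
    next
      fix g assume "g \<in> {\<one>}"
      then have g: "g = x 2 0" by (simp add: x_zeros)
      have "0 \<in> K" "0 \<in> {of_nat j * v |j. j < p}" using p0 by (auto simp: K_def tr0 intro!: exI[of _ 0])
      then show "g \<in> x 2 ` {of_nat j * v |j. j < p} \<inter> x 2 ` K" unfolding g by blast
    qed
    show "x 2 ` {of_nat j * v |j. j < p} <#> x 2 ` K = root_set G x {2}"
    proof (intro equalityI subsetI)
      fix g assume "g \<in> x 2 ` {of_nat j * v |j. j < p} <#> x 2 ` K"
      then show "g \<in> root_set G x {2}" by (auto simp: set_mult_def root_sets x2)
    next
      fix g assume "g \<in> root_set G x {2}"
      then obtain s where s: "g = x 2 s" by (auto simp: root_sets)
      \<comment> \<open>Traces lie in the prime field, so this quotient is the image of some natural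
        j < p; it is the component of s along v.\<close>
      have "(field_trace (c * s) / field_trace t0) ^ CHAR('a) = field_trace (c * s) / field_trace t0"
        using field_trace_in_prime_field by (simp add: CHAR_eq power_divide)
      then obtain j where j: "j < p" "of_nat j = field_trace (c * s) / field_trace t0"
        using prime_field_eq by (metis CHAR_eq)
      have "field_trace (c * (s - of_nat j * v)) + field_trace (of_nat j * (c * v)) = field_trace (c * s)"
        by (simp add: algebra_simps flip: field_trace_add)
      moreover have "field_trace (of_nat j * (c * v)) = of_nat j * field_trace t0"
        by (simp only: field_trace_of_nat_mult cv)
      moreover have "of_nat j * field_trace t0 = field_trace (c * s)" using j(2) t0 by simp
      ultimately have "s - of_nat j * v \<in> K" by (simp only: K_def) simp
      moreover have "g = x 2 (of_nat j * v) \<otimes> x 2 (s - of_nat j * v)" by (simp add: x2 s)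
      ultimately show "g \<in> x 2 ` {of_nat j * v |j. j < p} <#> x 2 ` K"
        using j(1) unfolding set_mult_def by blast
    qed
  qed
  then show ?thesis by blast
qed

text \<open>The tables presuppose the complements, whereas the numbers of irreducible characters are
  claimed outright; hence complements must be shown to exist.\<close>

lemma exists_complement_2:
  assumes "p = 2"
  shows "\<exists>Y. \<forall>a3 a4. a3 \<noteq> 0 \<and> a4 \<noteq> 0 \<longrightarrow> complement_in G (Y a3 a4) {\<one>, x 2 (a3 / a4)} (root_set G x {2})"
proof -
  have ex: "\<exists>Y. complement_in G Y {\<one>, x 2 (a3 / a4)} (root_set G x {2})" if "a3 \<noteq> 0" "a4 \<noteq> 0" for a3 a4
  proof -
    have "{of_nat j * (a3 / a4) |j. j < p} = {0, a3 / a4}"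
      by (auto simp: assms less_2_cases_iff intro: exI[of _ 0] exI[of _ 1])
    then show ?thesis using exists_complement[of "a3 / a4"] that by (simp add: x_zeros)
  qed
  show ?thesis
    by (rule exI[of _ "\<lambda>a3 a4. SOME Y. complement_in G Y {\<one>, x 2 (a3 / a4)} (root_set G x {2})"])
       (use someI_ex[OF ex] in blast)
qed

lemma exists_choices_3:
  assumes p: "p = 3"
  shows "\<exists>(\<zeta> :: complex) w Y. \<zeta> ^ 3 = 1 \<and> \<zeta> \<noteq> 1 \<and>
    (\<forall>a3 a5. star_pair a3 a5 \<longrightarrow> (w a3 a5)\<^sup>2 = - a3 / a5 \<and>
      complement_in G (Y a3 a5) {\<one>, x 2 (w a3 a5), x 2 (- w a3 a5)} (root_set G x {2}))"
proof -
  have three: "(3 :: 'a) = 0" using of_nat_CHAR[where ?'a = 'a] by (simp add: CHAR_eq p)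
  moreover have "(2 :: 'a) + 1 = 3" by simp
  ultimately have two: "(2 :: 'a) = - 1" by (simp only: eq_neg_iff_add_eq_0)
  \<comment> \<open>For p = 3 any value of \<phi> other than 1 is a primitive cube root of
    unity.\<close>
  obtain t :: 'a where t: "\<phi> t \<noteq> 1" using \<phi>_trivial_iff[of 1] by auto
  have "\<phi> t ^ 3 = \<phi> (3 * t)"
  proof -
    have "3 * t = t + t + t" by (simp add: algebra_simps)
    then show ?thesis by (simp only: \<phi>_add power3_eq_cube)
  qed
  then have z: "\<phi> t ^ 3 = 1" by (simp add: three)
  define w where "w a3 a5 = (SOME u. u\<^sup>2 = - a3 / a5)" for a3 a5 :: 'a
  have w: "(w a3 a5)\<^sup>2 = - a3 / a5" if "star_pair a3 a5" for a3 a5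
    unfolding w_def
  proof (rule someI_ex)
    show "\<exists>u. u\<^sup>2 = - a3 / a5" using that by (auto simp: star_pair_def nonzero_squares_def)
  qed
  have ex: "\<exists>Y. complement_in G Y {\<one>, x 2 (w a3 a5), x 2 (- w a3 a5)} (root_set G x {2})"
    if s: "star_pair a3 a5" for a3 a5
  proof -
    have j: "j < 3 \<longleftrightarrow> j = 0 \<or> j = 1 \<or> j = 2" for j :: nat by auto
    have "{of_nat j * w a3 a5 |j. j < p} = {of_nat 0 * w a3 a5, of_nat 1 * w a3 a5, of_nat 2 * w a3 a5}"
      unfolding p j by blast
    moreover have "w a3 a5 \<noteq> 0" using w[OF s] s by (auto simp: star_pair_def nonzero_squares_def)
    ultimately show ?thesis using exists_complement[of "w a3 a5"] by (simp add: x_zeros two)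
  qed
  define Y where "Y a3 a5 = (SOME Y. complement_in G Y {\<one>, x 2 (w a3 a5), x 2 (- w a3 a5)} (root_set G x {2}))" for a3 a5
  have "complement_in G (Y a3 a5) {\<one>, x 2 (w a3 a5), x 2 (- w a3 a5)} (root_set G x {2})"
    if "star_pair a3 a5" for a3 a5
    unfolding Y_def by (rule someI_ex[OF ex[OF that]])
  then show ?thesis using w z t by blast
qed

end

theorem theorem1p1:
  fixes G :: "('g, 'b) monoid_scheme"
    and x :: "nat \<Rightarrow> 'a::{field,finite} \<Rightarrow> 'g"
    and p f q :: nat
  assumes "prime p" and "f \<ge> 1" and "q = p ^ f" and "CARD('a) = q"
    and "G2_unipotent G x"
  shows
    "(p = 2 \<longrightarrow>
       (\<forall>Y :: 'a \<Rightarrow> 'a \<Rightarrow> 'g set.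
          (\<forall>a3 a4. a3 \<noteq> 0 \<and> a4 \<noteq> 0 \<longrightarrow>
             complement_in G (Y a3 a4) {\<one>\<^bsub>G\<^esub>, x 2 (a3 / a4)} (root_set G x {2})) \<longrightarrow>
          Irr_table G (chi2 G x Y)
            [({Two_a6 b2 a6 |b2 a6. a6 \<noteq> 0}, real q * (real q - 1), real q ^ 2),
             ({Two_a5 b1 b3 a5 |b1 b3 a5. a5 \<noteq> 0}, real q ^ 2 * (real q - 1), real q),
             ({Two_a3 a3 |a3. a3 \<noteq> 0}, real q - 1, real q),
             ({Two_a4 a4 |a4. a4 \<noteq> 0}, real q - 1, real q),
             ({Two_a3_a4 d1 d2 a3 a4 |d1 d2 a3 a4.
                 d1 \<in> {0,1} \<and> d2 \<in> {0,1} \<and> a3 \<noteq> 0 \<and> a4 \<noteq> 0}, 4 * (real q - 1) ^ 2, real q / 2),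
             ({Two_lin b1 b2 |b1 b2. True}, real q ^ 2, 1)])) \<and>
     (p = 3 \<longrightarrow>
       (\<forall>(\<zeta> :: complex) (w :: 'a \<Rightarrow> 'a \<Rightarrow> 'a) (Y :: 'a \<Rightarrow> 'a \<Rightarrow> 'g set).
          \<zeta> ^ 3 = 1 \<and> \<zeta> \<noteq> 1 \<and>
          (\<forall>a5. a5 \<noteq> 0 \<longrightarrow> (\<forall>a3 \<in> (\<lambda>s. - a5 * s) ` nonzero_squares.
             (w a3 a5)\<^sup>2 = - a3 / a5 \<and>
             complement_in G (Y a3 a5) {\<one>\<^bsub>G\<^esub>, x 2 (w a3 a5), x 2 (- w a3 a5)} (root_set G x {2}))) \<longrightarrow>
          Irr_table G (chi3 G x \<zeta> w Y)
            [({Three_a4_a6 a4 a6 |a4 a6. a4 \<noteq> 0 \<and> a6 \<noteq> 0}, (real q - 1) ^ 2, real q ^ 2),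
             ({Three_a6 b2 b3 a6 |b2 b3 a6. a6 \<noteq> 0}, real q ^ 2 * (real q - 1), real q),
             ({Three_a4 b1 b5 a4 |b1 b5 a4. a4 \<noteq> 0}, real q ^ 2 * (real q - 1), real q),
             ({Three_a3_a5 a3 a5 |a3 a5.
                 a5 \<noteq> 0 \<and> a3 \<noteq> 0 \<and> a3 \<notin> (\<lambda>s. - a5 * s) ` nonzero_squares}, (real q - 1) ^ 2 / 2, real q),
             ({Three_a3 a3 |a3. a3 \<noteq> 0}, real q - 1, real q),
             ({Three_a5 a5 |a5. a5 \<noteq> 0}, real q - 1, real q),
             ({Three_a3s_a5 e1 e2 a3 a5 |e1 e2 a3 a5.
                 e1 \<in> {0,1,2} \<and> e2 \<in> {0,1,2} \<and> a5 \<noteq> 0 \<and> a3 \<in> (\<lambda>s. - a5 * s) ` nonzero_squares},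
               9 * (real q - 1) ^ 2 / 2, real q / 3),
             ({Three_lin b1 b2 |b1 b2. True}, real q ^ 2, 1)])) \<and>
     (p \<ge> 5 \<longrightarrow> int (card (Irr G)) = int q ^ 3 + 2 * int q ^ 2 - int q - 1) \<and>
     (p = 3 \<longrightarrow> int (card (Irr G)) = 2 * int q ^ 3 + 5 * int q ^ 2 - 10 * int q + 4) \<and>
     (p = 2 \<longrightarrow> int (card (Irr G)) = int q ^ 3 + 5 * int q ^ 2 - 7 * int q + 2)"
proof -
  have CHAR: "CHAR('a) = p"
    using CHAR_eq_of_CARD_power[OF assms(1)] assms(3,4) by simp
  have G2: "G2_prime_power G x p f"
    using assms(3-5) CHAR by (simp add: G2_prime_power_def prime_power_field_def)
  \<comment> \<open>The tables count in the reals, the final formulas in the integers, where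
    subtraction does not truncate.\<close>
  have card_int: "int c = z" if "real c = of_int z" for c :: nat and z :: int
    using that by (metis of_int_eq_iff of_int_of_nat_eq)
  interpret G2_prime_power G x p f by (rule G2)
  show ?thesis
  proof (intro conjI impI allI)
    fix Y :: "'a \<Rightarrow> 'a \<Rightarrow> 'g set"
    assume p2: "p = 2" and Y: "\<forall>a3 a4. a3 \<noteq> 0 \<and> a4 \<noteq> 0 \<longrightarrow>
      complement_in G (Y a3 a4) {\<one>\<^bsub>G\<^esub>, x 2 (a3 / a4)} (root_set G x {2})"
    then obtain \<eta> where loc: "G2_char_2 G x f Y \<eta>" using exists_G2_char_2[of Y] by blast
    from G2_char_2.Irr_table_2(1)[OF loc]
    show "Irr_table G (chi2 G x Y)
            [({Two_a6 b2 a6 |b2 a6. a6 \<noteq> 0}, real q * (real q - 1), real q ^ 2),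
             ({Two_a5 b1 b3 a5 |b1 b3 a5. a5 \<noteq> 0}, real q ^ 2 * (real q - 1), real q),
             ({Two_a3 a3 |a3. a3 \<noteq> 0}, real q - 1, real q),
             ({Two_a4 a4 |a4. a4 \<noteq> 0}, real q - 1, real q),
             ({Two_a3_a4 d1 d2 a3 a4 |d1 d2 a3 a4.
                 d1 \<in> {0,1} \<and> d2 \<in> {0,1} \<and> a3 \<noteq> 0 \<and> a4 \<noteq> 0}, 4 * (real q - 1) ^ 2, real q / 2),
             ({Two_lin b1 b2 |b1 b2. True}, real q ^ 2, 1)]"
      by (simp only: G2_char_2.tab2_def[OF loc] Let_def assms(4))
  next
    fix \<zeta> :: complex and w :: "'a \<Rightarrow> 'a \<Rightarrow> 'a" and Y :: "'a \<Rightarrow> 'a \<Rightarrow> 'g set"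
    assume p3: "p = 3" and h: "\<zeta> ^ 3 = 1 \<and> \<zeta> \<noteq> 1 \<and>
      (\<forall>a5. a5 \<noteq> 0 \<longrightarrow> (\<forall>a3 \<in> (\<lambda>s. - a5 * s) ` nonzero_squares.
         (w a3 a5)\<^sup>2 = - a3 / a5 \<and>
         complement_in G (Y a3 a5) {\<one>\<^bsub>G\<^esub>, x 2 (w a3 a5), x 2 (- w a3 a5)} (root_set G x {2})))"
    then obtain \<eta> where loc: "G2_char_3 G x f \<zeta> w Y \<eta>"
      using exists_G2_char_3[of \<zeta> w Y] unfolding star_pair_def by blast
    from G2_char_3.Irr_table_3(1)[OF loc]
    show "Irr_table G (chi3 G x \<zeta> w Y)
            [({Three_a4_a6 a4 a6 |a4 a6. a4 \<noteq> 0 \<and> a6 \<noteq> 0}, (real q - 1) ^ 2, real q ^ 2),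
             ({Three_a6 b2 b3 a6 |b2 b3 a6. a6 \<noteq> 0}, real q ^ 2 * (real q - 1), real q),
             ({Three_a4 b1 b5 a4 |b1 b5 a4. a4 \<noteq> 0}, real q ^ 2 * (real q - 1), real q),
             ({Three_a3_a5 a3 a5 |a3 a5.
                 a5 \<noteq> 0 \<and> a3 \<noteq> 0 \<and> a3 \<notin> (\<lambda>s. - a5 * s) ` nonzero_squares}, (real q - 1) ^ 2 / 2, real q),
             ({Three_a3 a3 |a3. a3 \<noteq> 0}, real q - 1, real q),
             ({Three_a5 a5 |a5. a5 \<noteq> 0}, real q - 1, real q),
             ({Three_a3s_a5 e1 e2 a3 a5 |e1 e2 a3 a5.
                 e1 \<in> {0,1,2} \<and> e2 \<in> {0,1,2} \<and> a5 \<noteq> 0 \<and> a3 \<in> (\<lambda>s. - a5 * s) ` nonzero_squares},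
               9 * (real q - 1) ^ 2 / 2, real q / 3),
             ({Three_lin b1 b2 |b1 b2. True}, real q ^ 2, 1)]"
      by (simp only: G2_char_3.tab3_def[OF loc] Let_def assms(4))
  next
    assume p5: "p \<ge> 5"
    have "\<not> p dvd 2" "\<not> p dvd 3" using p5 by (auto dest: dvd_imp_le)
    then have "(of_nat 2 :: 'a) \<noteq> 0" "(of_nat 3 :: 'a) \<noteq> 0"
      by (simp_all only: of_nat_eq_0_iff_char_dvd CHAR not_False_eq_True)
    then have "real (card (Irr G)) = real q ^ 3 + 2 * real q ^ 2 - real q - 1"
      using card_Irr_5 assms(4) by simp
    then show "int (card (Irr G)) = int q ^ 3 + 2 * int q ^ 2 - int q - 1"
      by (intro card_int) simp
  next
    assume p3: "p = 3"
    then obtain \<zeta> :: complex and w Y \<eta> where "G2_char_3 G x f \<zeta> w Y \<eta>"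
      using exists_choices_3[OF p3] exists_G2_char_3[OF p3] by metis
    then have "real (card (Irr G)) = 2 * real q ^ 3 + 5 * real q ^ 2 - 10 * real q + 4"
      using G2_char_3.Irr_table_3(2) assms(4) by metis
    then show "int (card (Irr G)) = 2 * int q ^ 3 + 5 * int q ^ 2 - 10 * int q + 4"
      by (intro card_int) simp
  next
    assume p2: "p = 2"
    then obtain Y \<eta> where "G2_char_2 G x f Y \<eta>"
      using exists_complement_2[OF p2] exists_G2_char_2[OF p2] by metis
    then have "real (card (Irr G)) = real q ^ 3 + 5 * real q ^ 2 - 7 * real q + 2"
      using G2_char_2.Irr_table_2(2) assms(4) by metis
    then show "int (card (Irr G)) = int q ^ 3 + 5 * int q ^ 2 - 7 * int q + 2"
      by (intro card_int) simp
  qed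
qed

end
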